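(* There exist a probability space $(\Omega,\mathcal A,\mu)$, an ergodic automorphism $T$ of it, a filtration $(\mathcal F_i)_{i\in\mathbb Z}$ of sub-$\sigma$-algebras of $\mathcal A$ ($\mathcal F_i\subset\mathcal F_{i+1}$) with $\mathcal F_{i+1}=T^{-1}\mathcal F_i$ such that regular conditional probabilities $m_\omega$ with respect to $\mathcal F_0$ exist, a function $e\in L^2(\mathcal F_0)\ominus L^2(\mathcal F_{-1})$ with $\|e\|_2=1$, and real numbers $(a_i)_{i\ge0}$ with $\sum_{i\ge 0}a_i^2<\infty$, such that for $$f=\sum_{i=0}^\infty a_i\,e\circ T^{-i},\qquad S_n(f)=\sum_{i=0}^{n-1}f\circ T^i,\qquad \sigma_n=\|S_n(f)\|_2,\qquad \bar\sigma_n=\|S_n(f)-E(S_n(f)\mid\mathcal F_0)\|_2$$ (so that $(f\circ T^i)_i$ is a causal stationary linear process with martingale difference innovations) the following hold: (i) the Maxwell–Woodroofe condition $$\sum_{n=1}^\infty\frac{\|E(S_n(f)\mid\mathcal F_0)\|_2}{n^{3/2}}<\infty$$ and the Hannan condition $$\sum_{i=0}^\infty\|P_0(f\circ T^i)\|_2<\infty$$ are satisfied; (ii) $\sigma_n\to\infty$, $\sigma_n/\sqrt n\to0$, and $\|E(S_n(f)\mid\mathcal F_0)\|_2/\sigma_n\to0$, i.e. $\bar\sigma_n/\sigma_n\to1$; (iii) $S_n(f)/\sigma_n$ converges in distribution (under $\mu$) to the standard normal law $\mathcal N(0,1)$; (iv) the convergence is not quenched, neither for $S_n(f)/\sigma_n$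 nor for $(S_n(f)-E(S_n(f)\mid\mathcal F_0))/\sigma_n$; that is, for each of these two sequences it is not true that for $\mu$-almost every $\omega$ its distributions under $m_\omega$ converge weakly to $\mathcal N(0,1)$; (v) the weak invariance principle does not hold for $S_n(f)$ normalized by $\sigma_n$.
   Context: An automorphism is an invertible, bimeasurable, measure preserving transformation. $L^2(\mathcal F_0)\ominus L^2(\mathcal F_{-1})$ is the orthogonal complement of $L^2(\mathcal F_{-1})$ in $L^2(\mathcal F_0)$, so $(e\circ T^i)_i$ is a stationary martingale difference sequence adapted to $(\mathcal F_i)_i$. $P_0 h=E(h\mid\mathcal F_0)-E(h\mid\mathcal F_{-1})$ for $h\in L^2$. The Maxwell–Woodroofe and Hannan conditions are formulated for adapted regular processes, i.e. $f$ is $\mathcal F_0$-measurable and $E(f\mid\mathcal F_{-\infty})=0$ with $\mathcal F_{-\infty}=\bigcap_i\mathcal F_i$. $m_\omega$ is the regular conditional probability given $\mathcal F_0$: $m_\omega$ is a probability measure on $\mathcal A$ and $\omega\mapsto m_\omega(A)$ is a version of $\mu(A\mid\mathcal F_0)$ for each $A\in\mathcal A$. The weak invariance principle for $S_n(f)$ normalized by $\sigma_n$ is the statement that the random functions $t\mapsto S_{\lfloor nt\rfloor}(f)/\sigma_n$, $t\in[0,1]$ (with $S_0(f)=0$), converge in distribution under $\mu$ in the Skorokhod space $D[0,1]$ to a standard Brownian motion. *)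

theory Defs
  imports "HOL-Probability.Probability"
begin

section \<open>Measure preserving dynamics\<close>

definition automorphism :: "'a measure \<Rightarrow> ('a \<Rightarrow> 'a) \<Rightarrow> bool" where
  "automorphism M T \<longleftrightarrow>
     bij_betw T (space M) (space M) \<and>
     T \<in> measurable M M \<and> inv_into (space M) T \<in> measurable M M \<and>
     distr M M T = M"

definition ergodic :: "'a measure \<Rightarrow> ('a \<Rightarrow> 'a) \<Rightarrow> bool" where
  "ergodic M T \<longleftrightarrow>
     (\<forall>A\<in>sets M. T -` A \<inter> space M = A \<longrightarrow> measure M A = 0 \<or> measure M A = 1)"

definition stationary_filtration ::
    "'a measure \<Rightarrow> ('a \<Rightarrow> 'a) \<Rightarrow> (int \<Rightarrow> 'a measure) \<Rightarrow> bool" where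
  "stationary_filtration M T F \<longleftrightarrow>
     (\<forall>i. subalgebra M (F i)) \<and>
     (\<forall>i. sets (F i) \<subseteq> sets (F (i + 1))) \<and>
     (\<forall>i. sets (F (i + 1)) = {T -` A \<inter> space M | A. A \<in> sets (F i)})"

definition tail_algebra :: "'a measure \<Rightarrow> (int \<Rightarrow> 'a measure) \<Rightarrow> 'a measure" where
  "tail_algebra M F = sigma (space M) (\<Inter>i. sets (F i))"

definition regular_cond_prob ::
    "'a measure \<Rightarrow> 'a measure \<Rightarrow> ('a \<Rightarrow> 'a measure) \<Rightarrow> bool" where
  "regular_cond_prob M G m \<longleftrightarrow>
     (\<forall>\<omega>\<in>space M. prob_space (m \<omega>) \<and> sets (m \<omega>) = sets M) \<and>
     (\<forall>A\<in>sets M. (\<lambda>\<omega>. measure (m \<omega>) A) \<in> borel_measurable G \<and>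
        (AE \<omega> in M. measure (m \<omega>) A = real_cond_exp M G (indicator A) \<omega>))"


section \<open>Square integrable functions\<close>

text \<open>The space \<open>L2_on M G\<close> consists of functions, not of classes modulo null sets.\<close>

definition L2_on :: "'a measure \<Rightarrow> 'a measure \<Rightarrow> ('a \<Rightarrow> real) set" where
  "L2_on M G = {h \<in> borel_measurable G. integrable M (\<lambda>x. (h x)\<^sup>2)}"

definition L2_norm :: "'a measure \<Rightarrow> ('a \<Rightarrow> real) \<Rightarrow> real" where
  "L2_norm M h = sqrt (\<integral>x. (h x)\<^sup>2 \<partial>M)"

definition L2_ominus :: "'a measure \<Rightarrow> 'a measure \<Rightarrow> 'a measure \<Rightarrow> ('a \<Rightarrow> real) set" where
  "L2_ominus M G H = {h \<in> L2_on M G. \<forall>k\<in>L2_on M H. (\<integral>x. h x * k x \<partial>M) = 0}"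


section \<open>Stationary processes\<close>

definition partial_sum :: "('a \<Rightarrow> 'a) \<Rightarrow> ('a \<Rightarrow> real) \<Rightarrow> nat \<Rightarrow> 'a \<Rightarrow> real" where
  "partial_sum T f n x = (\<Sum>i<n. f ((T ^^ i) x))"

text \<open>The series of the linear process is understood as an \<open>L\<^sup>2\<close> limit.\<close>

definition is_linear_process ::
    "'a measure \<Rightarrow> ('a \<Rightarrow> 'a) \<Rightarrow> ('a \<Rightarrow> real) \<Rightarrow> (nat \<Rightarrow> real) \<Rightarrow> ('a \<Rightarrow> real) \<Rightarrow> bool" where
  "is_linear_process M T e a f \<longleftrightarrow>
     (\<lambda>N. L2_norm M (\<lambda>x. f x - (\<Sum>i<N. a i * e ((inv_into (space M) T ^^ i) x))))
       \<longlonglongrightarrow> 0"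

definition adapted_regular :: "'a measure \<Rightarrow> (int \<Rightarrow> 'a measure) \<Rightarrow> ('a \<Rightarrow> real) \<Rightarrow> bool" where
  "adapted_regular M F f \<longleftrightarrow>
     f \<in> borel_measurable (F 0) \<and> (AE x in M. real_cond_exp M (tail_algebra M F) f x = 0)"

definition maxwell_woodroofe ::
    "'a measure \<Rightarrow> ('a \<Rightarrow> 'a) \<Rightarrow> (int \<Rightarrow> 'a measure) \<Rightarrow> ('a \<Rightarrow> real) \<Rightarrow> bool" where
  "maxwell_woodroofe M T F f \<longleftrightarrow>
     summable (\<lambda>n. L2_norm M (real_cond_exp M (F 0) (partial_sum T f (Suc n)))
                     / real (Suc n) powr (3/2))"

definition proj0 ::
    "'a measure \<Rightarrow> (int \<Rightarrow> 'a measure) \<Rightarrow> ('a \<Rightarrow> real) \<Rightarrow> 'a \<Rightarrow> real" where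
  "proj0 M F h x = real_cond_exp M (F 0) h x - real_cond_exp M (F (-1)) h x"

definition hannan ::
    "'a measure \<Rightarrow> ('a \<Rightarrow> 'a) \<Rightarrow> (int \<Rightarrow> 'a measure) \<Rightarrow> ('a \<Rightarrow> real) \<Rightarrow> bool" where
  "hannan M T F f \<longleftrightarrow> summable (\<lambda>i. L2_norm M (proj0 M F (\<lambda>x. f ((T ^^ i) x))))"


section \<open>Convergence to the standard normal law\<close>

definition clt :: "'a measure \<Rightarrow> (nat \<Rightarrow> 'a \<Rightarrow> real) \<Rightarrow> bool" where
  "clt M X \<longleftrightarrow> weak_conv_m (\<lambda>n. distr M borel (X n)) std_normal_distribution"

definition quenched_clt ::
    "'a measure \<Rightarrow> ('a \<Rightarrow> 'a measure) \<Rightarrow> (nat \<Rightarrow> 'a \<Rightarrow> real) \<Rightarrow> bool" where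
  "quenched_clt M m X \<longleftrightarrow> (AE \<omega> in M. clt (m \<omega>) X)"


section \<open>The Skorokhod space on the unit interval\<close>

text \<open>Functions on \<open>[0,1]\<close> are represented by total functions that are \<open>undefined\<close> outside.\<close>

definition cadlag01 :: "(real \<Rightarrow> real) set" where
  "cadlag01 = {x \<in> extensional {0..1}.
     (\<forall>t\<in>{0..<1}. (x \<longlongrightarrow> x t) (at_right t)) \<and>
     (\<forall>t\<in>{0<..1}. \<exists>l. (x \<longlongrightarrow> l) (at_left t))}"

text \<open>Continuity of a time change is automatic, since it is increasing and onto.\<close>

definition time_changes :: "(real \<Rightarrow> real) set" where
  "time_changes = {l. strict_mono_on {0..1} l \<and> l ` {0..1} = {0..1}}"

definition skorokhod_close :: "(real \<Rightarrow> real) \<Rightarrow> (real \<Rightarrow> real) \<Rightarrow> real \<Rightarrow> bool" where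
  "skorokhod_close x y \<epsilon> \<longleftrightarrow>
     (\<exists>l\<in>time_changes. \<forall>t\<in>{0..1}. \<bar>l t - t\<bar> \<le> \<epsilon> \<and> \<bar>x t - y (l t)\<bar> \<le> \<epsilon>)"

text \<open>The value \<open>0\<close> off the Skorokhod space is there because \<^locale>\<open>Metric_space\<close> wants a
  distance that is nonnegative everywhere.\<close>

definition skorokhod_dist :: "(real \<Rightarrow> real) \<Rightarrow> (real \<Rightarrow> real) \<Rightarrow> real" where
  "skorokhod_dist x y =
     (if x \<in> cadlag01 \<and> y \<in> cadlag01 then Inf {\<epsilon>. 0 < \<epsilon> \<and> skorokhod_close x y \<epsilon>} else 0)"

definition skorokhod_topology :: "(real \<Rightarrow> real) topology" where
  "skorokhod_topology = Metric_space.mtopology cadlag01 skorokhod_dist"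

definition skorokhod_borel :: "(real \<Rightarrow> real) measure" where
  "skorokhod_borel = sigma cadlag01 {U. openin skorokhod_topology U}"

definition step_path :: "nat \<Rightarrow> (nat \<Rightarrow> real) \<Rightarrow> real \<Rightarrow> real" where
  "step_path n v = (\<lambda>t\<in>{0..1}. v (nat \<lfloor>real n * t\<rfloor>))"

text \<open>\<open>wiener_law N\<close>: under the law \<open>N\<close> on the Skorokhod space the coordinate process
  is a standard Brownian motion.\<close>

definition wiener_law :: "(real \<Rightarrow> real) measure \<Rightarrow> bool" where
  "wiener_law N \<longleftrightarrow>
     prob_space N \<and> sets N = sets skorokhod_borel \<and>
     (AE w in N. w 0 = 0 \<and> continuous_on {0..1} w) \<and>
     (\<forall>s t. 0 \<le> s \<and> s < t \<and> t \<le> 1 \<longrightarrow>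
        distributed N lborel (\<lambda>w. w t - w s) (normal_density 0 (sqrt (t - s)))) \<and>
     (\<forall>(k::nat) \<tau>. (\<forall>i\<le>k. \<tau> i \<in> {0..1}) \<and> (\<forall>i<k. \<tau> i \<le> \<tau> (Suc i)) \<longrightarrow>
        prob_space.indep_vars N (\<lambda>_. borel) (\<lambda>i w. w (\<tau> (Suc i)) - w (\<tau> i)) {..<k})"

text \<open>Convergence in distribution of the random elements \<open>X n\<close> to the law \<open>N\<close>. For the step paths
  used below the integrands are measurable by \<open>measurable_step_path\<close>.\<close>

definition converges_in_law_D ::
    "'a measure \<Rightarrow> (nat \<Rightarrow> 'a \<Rightarrow> real \<Rightarrow> real) \<Rightarrow> (real \<Rightarrow> real) measure \<Rightarrow> bool" where
  "converges_in_law_D M X N \<longleftrightarrow>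
     (\<forall>h. continuous_map skorokhod_topology euclideanreal h \<and> bounded (h ` cadlag01) \<longrightarrow>
        (\<lambda>n. \<integral>\<omega>. h (X n \<omega>) \<partial>M) \<longlonglongrightarrow> (\<integral>w. h w \<partial>N))"

definition weak_invariance_principle ::
    "'a measure \<Rightarrow> (nat \<Rightarrow> 'a \<Rightarrow> real) \<Rightarrow> (nat \<Rightarrow> real) \<Rightarrow> bool" where
  "weak_invariance_principle M S \<sigma> \<longleftrightarrow>
     (\<exists>N. wiener_law N \<and>
        converges_in_law_D M (\<lambda>n \<omega>. step_path n (\<lambda>k. S k \<omega> / \<sigma> n)) N)"


subsection \<open>The Skorokhod distance is a metric\<close>

lemma time_changes_id: "(\<lambda>t. t) \<in> time_changes"
  by (auto simp: time_changes_def strict_mono_on_def)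

lemma time_changes_mem: "l \<in> time_changes \<Longrightarrow> t \<in> {0..1} \<Longrightarrow> l t \<in> {0..1}"
  by (auto simp: time_changes_def)

lemma time_changes_comp:
  assumes "l \<in> time_changes" "k \<in> time_changes"
  shows "(\<lambda>t. k (l t)) \<in> time_changes"
proof -
  have "(\<lambda>t. k (l t)) ` {0..1} = k ` (l ` {0..1})" by (simp add: image_image)
  then show ?thesis
    using assms time_changes_mem[OF assms(1)]
    unfolding time_changes_def strict_mono_on_def by auto
qed

lemma time_changes_inv:
  assumes "l \<in> time_changes"
  shows "inv_into {0..1} l \<in> time_changes"
proof -
  have sm: "strict_mono_on {0..1} l" and im: "l ` {0..1} = {0..1}"
    using assms by (auto simp: time_changes_def)
  have inj: "inj_on l {0..1}" using sm by (rule strict_mono_on_imp_inj_on)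
  have "strict_mono_on {0..1} (inv_into {0..1} l)"
  proof (rule strict_mono_onI)
    fix r s :: real assume rs: "r \<in> {0..1}" "s \<in> {0..1}" "r < s"
    let ?r = "inv_into {0..1} l r" and ?s = "inv_into {0..1} l s"
    have mem: "?r \<in> {0..1}" "?s \<in> {0..1}" using rs im by (metis inv_into_into)+
    have val: "l ?r = r" "l ?s = s" using rs im by (metis f_inv_into_f)+
    show "?r < ?s"
    proof (rule ccontr)
      assume "\<not> ?r < ?s"
      then have "?s < ?r \<or> ?s = ?r" by auto
      then show False using strict_mono_onD[OF sm mem(2) mem(1)] val rs by auto
    qed
  qed
  moreover have "inv_into {0..1} l ` {0..1} = {0..1}"
    using inv_into_image_cancel[OF inj, of "{0..1}"] im by simp
  ultimately show ?thesis by (auto simp: time_changes_def)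
qed

lemma time_changes_endpoint:
  assumes "l \<in> time_changes"
  shows "l 1 = 1"
proof -
  have sm: "strict_mono_on {0..1} l" and im: "l ` {0..1} = {0..1}"
    using assms by (auto simp: time_changes_def)
  have "1 \<in> l ` {0..1}" using im by simp
  then obtain u where u: "u \<in> {0..1}" "l u = 1" by auto
  have "u = 1"
  proof (rule ccontr)
    assume "u \<noteq> 1"
    then have "l u < l 1" using u by (intro strict_mono_onD[OF sm]) auto
    then show False using u time_changes_mem[OF assms, of 1] by auto
  qed
  then show ?thesis using u by simp
qed

lemma skorokhod_close_mono:
  "skorokhod_close x y \<epsilon> \<Longrightarrow> \<epsilon> \<le> \<delta> \<Longrightarrow> skorokhod_close x y \<delta>"
  unfolding skorokhod_close_def by (meson order_trans)

lemma skorokhod_close_sym: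
  assumes "skorokhod_close x y \<epsilon>"
  shows "skorokhod_close y x \<epsilon>"
proof -
  obtain l where l: "l \<in> time_changes"
      and *: "\<And>t. t \<in> {0..1} \<Longrightarrow> \<bar>l t - t\<bar> \<le> \<epsilon> \<and> \<bar>x t - y (l t)\<bar> \<le> \<epsilon>"
    using assms by (auto simp: skorokhod_close_def)
  have im: "l ` {0..1} = {0..1}" using l by (auto simp: time_changes_def)
  have "\<bar>inv_into {0..1} l t - t\<bar> \<le> \<epsilon> \<and> \<bar>y t - x (inv_into {0..1} l t)\<bar> \<le> \<epsilon>"
    if t: "t \<in> {0..1}" for t
  proof -
    have "inv_into {0..1} l t \<in> {0..1}" "l (inv_into {0..1} l t) = t"
      using t im by (metis inv_into_into, metis f_inv_into_f)
    then show ?thesis using *[of "inv_into {0..1} l t"] by (auto simp: abs_minus_commute)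
  qed
  then show ?thesis
    unfolding skorokhod_close_def using time_changes_inv[OF l] by blast
qed

lemma skorokhod_close_trans:
  assumes "skorokhod_close x y \<epsilon>" "skorokhod_close y z \<delta>"
  shows "skorokhod_close x z (\<epsilon> + \<delta>)"
proof -
  obtain l where l: "l \<in> time_changes"
      and *: "\<And>t. t \<in> {0..1} \<Longrightarrow> \<bar>l t - t\<bar> \<le> \<epsilon> \<and> \<bar>x t - y (l t)\<bar> \<le> \<epsilon>"
    using assms by (auto simp: skorokhod_close_def)
  obtain k where k: "k \<in> time_changes"
      and **: "\<And>t. t \<in> {0..1} \<Longrightarrow> \<bar>k t - t\<bar> \<le> \<delta> \<and> \<bar>y t - z (k t)\<bar> \<le> \<delta>"
    using assms by (auto simp: skorokhod_close_def)
  have "\<bar>k (l t) - t\<bar> \<le> \<epsilon> + \<delta> \<and> \<bar>x t - z (k (l t))\<bar> \<le> \<epsilon> + \<delta>" if "t \<in> {0..1}" for t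
    using *[OF that] **[OF time_changes_mem[OF l that]] by linarith
  then show ?thesis
    unfolding skorokhod_close_def using time_changes_comp[OF l k] by (intro bexI) auto
qed

lemma cadlag01_locally_bounded:
  assumes x: "x \<in> cadlag01" and t: "t \<in> {0..1}"
  shows "\<exists>d>0. \<exists>B. \<forall>s\<in>{0..1}. \<bar>s - t\<bar> < d \<longrightarrow> \<bar>x s\<bar> \<le> B"
proof -
  have right: "\<exists>b>t. \<exists>B. \<forall>s\<in>{0..1}. t < s \<and> s < b \<longrightarrow> \<bar>x s\<bar> \<le> B"
  proof (cases "t < 1")
    case True
    then have "(x \<longlongrightarrow> x t) (at_right t)" using x t by (auto simp: cadlag01_def)
    then have "eventually (\<lambda>s. dist (x s) (x t) < 1) (at_right t)" by (rule tendstoD) simp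
    then obtain b where b: "b > t" "\<And>s. t < s \<Longrightarrow> s < b \<Longrightarrow> dist (x s) (x t) < 1"
      by (auto simp: eventually_at_right_field)
    have "\<bar>x s\<bar> \<le> \<bar>x t\<bar> + 1" if "t < s" "s < b" for s
      using b(2)[OF that] by (auto simp: dist_real_def)
    then show ?thesis using b(1) by blast
  next
    case False
    then show ?thesis by (intro exI[of _ "t + 1"]) auto
  qed
  have left: "\<exists>b<t. \<exists>B. \<forall>s\<in>{0..1}. b < s \<and> s < t \<longrightarrow> \<bar>x s\<bar> \<le> B"
  proof (cases "0 < t")
    case True
    then obtain l where "(x \<longlongrightarrow> l) (at_left t)" using x t by (force simp: cadlag01_def)
    then have "eventually (\<lambda>s. dist (x s) l < 1) (at_left t)" by (rule tendstoD) simp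
    then obtain b where b: "b < t" "\<And>s. b < s \<Longrightarrow> s < t \<Longrightarrow> dist (x s) l < 1"
      by (auto simp: eventually_at_left_field)
    have "\<bar>x s\<bar> \<le> \<bar>l\<bar> + 1" if "b < s" "s < t" for s
      using b(2)[OF that] by (auto simp: dist_real_def)
    then show ?thesis using b(1) by blast
  next
    case False
    then show ?thesis by (intro exI[of _ "t - 1"]) auto
  qed
  obtain b B where b: "b > t" "\<And>s. s \<in> {0..1} \<Longrightarrow> t < s \<Longrightarrow> s < b \<Longrightarrow> \<bar>x s\<bar> \<le> B"
    using right by blast
  obtain c C where c: "c < t" "\<And>s. s \<in> {0..1} \<Longrightarrow> c < s \<Longrightarrow> s < t \<Longrightarrow> \<bar>x s\<bar> \<le> C"
    using left by blast
  let ?d = "min (b - t) (t - c)" and ?B = "max (max B C) \<bar>x t\<bar>"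
  have "\<bar>x s\<bar> \<le> ?B" if "s \<in> {0..1}" "\<bar>s - t\<bar> < ?d" for s
  proof -
    consider "s < t" | "s = t" | "t < s" by linarith
    then show ?thesis
    proof cases
      case 1
      have "\<bar>x s\<bar> \<le> C" using that 1 by (intro c(2)) auto
      then show ?thesis by simp
    next
      case 3
      have "\<bar>x s\<bar> \<le> B" using that 3 by (intro b(2)) auto
      then show ?thesis by simp
    qed auto
  qed
  moreover have "?d > 0" using b(1) c(1) by simp
  ultimately show ?thesis by blast
qed

lemma cadlag01_bounded:
  assumes x: "x \<in> cadlag01"
  obtains B where "\<And>t. t \<in> {0..1} \<Longrightarrow> \<bar>x t\<bar> \<le> B"
proof -
  obtain d B where d: "\<And>t. t \<in> {0..1} \<Longrightarrow> d t > 0"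
      and B: "\<And>t s. t \<in> {0..1} \<Longrightarrow> s \<in> {0..1} \<Longrightarrow> \<bar>s - t\<bar> < d t \<Longrightarrow> \<bar>x s\<bar> \<le> B t"
    using cadlag01_locally_bounded[OF x] by metis
  obtain C where C: "C \<subseteq> {0..1}" "finite C" "{0..1} \<subseteq> (\<Union>t\<in>C. ball t (d t))"
  proof (rule compactE_image[of "{0..1::real}" "{0..1}" "\<lambda>t. ball t (d t)"])
    show "{0..1} \<subseteq> (\<Union>t\<in>{0..1}. ball t (d t))" using d by force
  qed auto
  have "\<bar>x s\<bar> \<le> (\<Sum>t\<in>C. \<bar>B t\<bar>)" if s: "s \<in> {0..1}" for s
  proof -
    obtain t where t: "t \<in> C" "s \<in> ball t (d t)" using C s by blast
    have "\<bar>x s\<bar> \<le> \<bar>B t\<bar>"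
      using B[of t s] t C s by (force simp: dist_real_def abs_minus_commute)
    also have "\<dots> \<le> (\<Sum>t\<in>C. \<bar>B t\<bar>)" using t C by (intro member_le_sum) auto
    finally show ?thesis .
  qed
  then show ?thesis using that by blast
qed

lemma skorokhod_dist_less_iff:
  assumes "x \<in> cadlag01" "y \<in> cadlag01"
  shows "skorokhod_dist x y < r \<longleftrightarrow> (\<exists>\<epsilon>. 0 < \<epsilon> \<and> \<epsilon> < r \<and> skorokhod_close x y \<epsilon>)"
proof -
  obtain B C where B: "\<And>t. t \<in> {0..1} \<Longrightarrow> \<bar>x t\<bar> \<le> B" and C: "\<And>t. t \<in> {0..1} \<Longrightarrow> \<bar>y t\<bar> \<le> C"
    using cadlag01_bounded assms by metis
  have "\<bar>x t - y t\<bar> \<le> \<bar>B\<bar> + \<bar>C\<bar> + 1" if "t \<in> {0..1}" for t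
    using B[OF that] C[OF that] by linarith
  then have "skorokhod_close x y (\<bar>B\<bar> + \<bar>C\<bar> + 1)"
    unfolding skorokhod_close_def by (intro bexI[OF _ time_changes_id]) auto
  then have "{\<epsilon>. 0 < \<epsilon> \<and> skorokhod_close x y \<epsilon>} \<noteq> {}"
    by (auto intro!: exI[of _ "\<bar>B\<bar> + \<bar>C\<bar> + 1"])
  moreover have "bdd_below {\<epsilon>. 0 < \<epsilon> \<and> skorokhod_close x y \<epsilon>}"
    by (rule bdd_belowI[of _ 0]) auto
  ultimately show ?thesis
    using assms by (simp add: skorokhod_dist_def cInf_less_iff conj_ac)
qed

lemma skorokhod_dist_nonneg:
  assumes "x \<in> cadlag01" "y \<in> cadlag01"
  shows "0 \<le> skorokhod_dist x y"
  using skorokhod_dist_less_iff[OF assms, of 0] by (meson not_less order_less_asym)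

lemma skorokhod_dist_le:
  assumes "x \<in> cadlag01" "y \<in> cadlag01" "0 \<le> \<epsilon>" "skorokhod_close x y \<epsilon>"
  shows "skorokhod_dist x y \<le> \<epsilon>"
proof (rule ccontr)
  assume "\<not> skorokhod_dist x y \<le> \<epsilon>"
  then have "\<epsilon> < skorokhod_dist x y" by simp
  then obtain \<delta> where \<delta>: "\<epsilon> < \<delta>" "\<delta> < skorokhod_dist x y" using dense by blast
  have "skorokhod_dist x y < skorokhod_dist x y"
    unfolding skorokhod_dist_less_iff[OF assms(1,2)]
    using \<delta> assms(3) skorokhod_close_mono[OF assms(4), of \<delta>] by (intro exI[of _ \<delta>]) auto
  then show False by simp
qed

lemma cadlag01_limit_values:
  assumes y: "y \<in> cadlag01" and t: "0 < t" "t < 1"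
    and l: "(y \<longlongrightarrow> l) (at_left t)"
    and u: "u \<longlonglongrightarrow> t" "(\<lambda>k. y (u k)) \<longlonglongrightarrow> c"
  shows "c = y t \<or> c = l"
proof (rule ccontr)
  assume "\<not> (c = y t \<or> c = l)"
  define r where "r = min (dist c (y t)) (dist c l) / 2"
  have r: "r > 0" using \<open>\<not> (c = y t \<or> c = l)\<close> by (auto simp: r_def)
  have "(y \<longlongrightarrow> y t) (at_right t)" using y t by (auto simp: cadlag01_def)
  then have "eventually (\<lambda>s. dist (y s) (y t) < r) (at_right t)" using r by (rule tendstoD)
  then obtain b where b: "b > t" "\<And>s. t < s \<Longrightarrow> s < b \<Longrightarrow> dist (y s) (y t) < r"
    by (auto simp: eventually_at_right_field)
  have "eventually (\<lambda>s. dist (y s) l < r) (at_left t)" using l r by (rule tendstoD)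
  then obtain a where a: "a < t" "\<And>s. a < s \<Longrightarrow> s < t \<Longrightarrow> dist (y s) l < r"
    by (auto simp: eventually_at_left_field)
  have "eventually (\<lambda>k. a < u k) sequentially" "eventually (\<lambda>k. u k < b) sequentially"
    "eventually (\<lambda>k. dist (y (u k)) c < r) sequentially"
    using order_tendstoD[OF u(1)] a(1) b(1) tendstoD[OF u(2) r] by auto
  then have "eventually (\<lambda>k. a < u k \<and> u k < b \<and> dist (y (u k)) c < r) sequentially"
    by (simp add: eventually_conj)
  then obtain k where k: "a < u k" "u k < b" "dist (y (u k)) c < r"
    by (auto dest: eventually_happens)
  have "dist (y (u k)) (y t) < r \<or> dist (y (u k)) l < r"
    using a(2)[of "u k"] b(2)[of "u k"] k r by (cases "u k" t rule: linorder_cases) auto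
  moreover have "dist c (y t) \<le> dist (y (u k)) c + dist (y (u k)) (y t)"
    "dist c l \<le> dist (y (u k)) c + dist (y (u k)) l"
    by (rule dist_triangle3)+
  moreover have "2 * r \<le> dist c (y t)" "2 * r \<le> dist c l" by (auto simp: r_def)
  ultimately show False using k(3) by linarith
qed

lemma skorokhod_dist_zero_imp_eq:
  assumes x: "x \<in> cadlag01" and y: "y \<in> cadlag01" and z: "skorokhod_dist x y = 0"
  shows "x = y"
proof -
  have "\<exists>l\<in>time_changes. \<forall>t\<in>{0..1}. \<bar>l t - t\<bar> \<le> 1 / real (Suc k) \<and> \<bar>x t - y (l t)\<bar> \<le> 1 / real (Suc k)"
    for k
  proof -
    have "skorokhod_dist x y < 1 / real (Suc k)" using z by simp
    then have "skorokhod_close x y (1 / real (Suc k))"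
      unfolding skorokhod_dist_less_iff[OF x y] using skorokhod_close_mono less_imp_le by metis
    then show ?thesis by (simp add: skorokhod_close_def)
  qed
  then obtain L where L: "\<And>k. L k \<in> time_changes"
      and L1: "\<And>k t. t \<in> {0..1} \<Longrightarrow> \<bar>L k t - t\<bar> \<le> 1 / real (Suc k)"
      and L2: "\<And>k t. t \<in> {0..1} \<Longrightarrow> \<bar>x t - y (L k t)\<bar> \<le> 1 / real (Suc k)"
    by metis
  have inv0: "(\<lambda>k. 1 / real (Suc k)) \<longlonglongrightarrow> 0"
    using LIMSEQ_inverse_real_of_nat by (simp add: inverse_eq_divide)
  have lim1: "(\<lambda>k. L k t) \<longlonglongrightarrow> t" if "t \<in> {0..1}" for t
  proof -
    have "(\<lambda>k. L k t - t) \<longlonglongrightarrow> 0"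
      by (rule tendsto_rabs_zero_cancel, rule tendsto_sandwich[OF _ _ tendsto_const inv0])
         (use L1[OF that] in auto)
    then show ?thesis by (simp add: LIM_zero_iff)
  qed
  have lim2: "(\<lambda>k. y (L k t)) \<longlonglongrightarrow> x t" if "t \<in> {0..1}" for t
  proof -
    have "(\<lambda>k. y (L k t) - x t) \<longlonglongrightarrow> 0"
      by (rule tendsto_rabs_zero_cancel, rule tendsto_sandwich[OF _ _ tendsto_const inv0])
         (use L2[OF that] in \<open>auto simp: abs_minus_commute\<close>)
    then show ?thesis by (simp add: LIM_zero_iff)
  qed
  have "x t = y t" if t: "t \<in> {0..<1}" for t
  proof -
    have "(x \<longlongrightarrow> y t) (at_right t)"
    proof (rule tendstoI)
      fix e :: real assume e: "e > 0"
      have "(y \<longlongrightarrow> y t) (at_right t)" using y t by (auto simp: cadlag01_def)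
      then have "eventually (\<lambda>s. dist (y s) (y t) < e/2) (at_right t)"
        by (rule tendstoD) (use e in simp)
      then obtain b where b: "b > t" "\<And>s. t < s \<Longrightarrow> s < b \<Longrightarrow> dist (y s) (y t) < e/2"
        by (auto simp: eventually_at_right_field)
      have "dist (x s) (y t) < e" if s: "t < s" "s < min b 1" for s
      proof -
        obtain l where l: "(y \<longlongrightarrow> l) (at_left s)" using y s t by (force simp: cadlag01_def)
        have "x s = y s \<or> x s = l"
          by (rule cadlag01_limit_values[OF y _ _ l lim1 lim2]) (use s t in auto)
        moreover have "dist l (y t) \<le> e/2"
        proof (rule tendsto_upperbound)
          show "((\<lambda>v. dist (y v) (y t)) \<longlongrightarrow> dist l (y t)) (at_left s)"
            by (intro tendsto_intros l)
          show "eventually (\<lambda>v. dist (y v) (y t) \<le> e/2) (at_left s)"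
            using b(2) s by (auto simp: eventually_at_left_field intro!: exI[of _ t] less_imp_le)
        qed simp
        ultimately show ?thesis using b(2)[of s] s e by auto
      qed
      then show "eventually (\<lambda>s. dist (x s) (y t) < e) (at_right t)"
        using b(1) t by (auto simp: eventually_at_right_field intro!: exI[of _ "min b 1"])
    qed
    moreover have "(x \<longlongrightarrow> x t) (at_right t)" using x t by (auto simp: cadlag01_def)
    ultimately show ?thesis by (metis tendsto_unique trivial_limit_at_right_real)
  qed
  moreover have "x 1 = y 1"
    using lim2[of 1] time_changes_endpoint[OF L] by (simp add: LIMSEQ_const_iff)
  ultimately have "x t = y t" if "t \<in> {0..1}" for t
    using that by (cases "t = 1") auto
  moreover have "x \<in> extensional {0..1}" "y \<in> extensional {0..1}"
    using x y by (auto simp: cadlag01_def)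
  ultimately show ?thesis by (metis extensionalityI)
qed

lemma Metric_space_skorokhod: "Metric_space cadlag01 skorokhod_dist"
proof
  show "0 \<le> skorokhod_dist x y" for x y
  proof (cases "x \<in> cadlag01 \<and> y \<in> cadlag01")
    case True
    then show ?thesis by (blast intro: skorokhod_dist_nonneg)
  qed (auto simp: skorokhod_dist_def)
  show "skorokhod_dist x y = skorokhod_dist y x" for x y
  proof -
    have "skorokhod_close x y = skorokhod_close y x"
      using skorokhod_close_sym by blast
    then show ?thesis by (auto simp: skorokhod_dist_def)
  qed
  show "skorokhod_dist x y = 0 \<longleftrightarrow> x = y" if "x \<in> cadlag01" "y \<in> cadlag01" for x y
  proof
    assume "x = y"
    then have "skorokhod_close x y 0"
      unfolding skorokhod_close_def by (intro bexI[OF _ time_changes_id]) auto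
    then have "skorokhod_dist x y \<le> 0" using that by (intro skorokhod_dist_le) auto
    then show "skorokhod_dist x y = 0" using skorokhod_dist_nonneg[OF that] by simp
  qed (rule skorokhod_dist_zero_imp_eq[OF that])
  show "skorokhod_dist x z \<le> skorokhod_dist x y + skorokhod_dist y z"
    if c: "x \<in> cadlag01" "y \<in> cadlag01" "z \<in> cadlag01" for x y z
  proof (rule field_le_epsilon)
    fix e :: real assume e: "e > 0"
    have "skorokhod_dist x y < skorokhod_dist x y + e/2" using e by simp
    then obtain p where p: "0 < p" "p < skorokhod_dist x y + e/2" "skorokhod_close x y p"
      unfolding skorokhod_dist_less_iff[OF c(1,2)] by auto
    have "skorokhod_dist y z < skorokhod_dist y z + e/2" using e by simp
    then obtain q where q: "0 < q" "q < skorokhod_dist y z + e/2" "skorokhod_close y z q"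
      unfolding skorokhod_dist_less_iff[OF c(2,3)] by auto
    have "skorokhod_dist x z \<le> p + q"
      using p q skorokhod_close_trans[OF p(3) q(3)] c by (intro skorokhod_dist_le) auto
    then show "skorokhod_dist x z \<le> skorokhod_dist x y + skorokhod_dist y z + e"
      using p q by linarith
  qed
qed


subsection \<open>Step paths are random elements of the Skorokhod space\<close>

lemma step_path_cadlag: "step_path n v \<in> cadlag01"
proof (cases "n = 0")
  case True
  have c: "step_path n v s = v 0" if "s \<in> {0..1}" for s
    using that True by (simp add: step_path_def)
  have "(step_path n v \<longlongrightarrow> v 0) (at_right t)" if "t \<in> {0..<1}" for t
    using that c by (intro tendsto_eventually) (auto simp: eventually_at_right_field intro!: exI[of _ 1])
  moreover have "(step_path n v \<longlongrightarrow> v 0) (at_left t)" if "t \<in> {0<..1}" for t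
    using that c by (intro tendsto_eventually) (auto simp: eventually_at_left_field intro!: exI[of _ 0])
  ultimately show ?thesis
    using c unfolding cadlag01_def by (fastforce simp: step_path_def)
next
  case False
  then have n: "real n > 0" by simp
  have "(step_path n v \<longlongrightarrow> step_path n v t) (at_right t)" if t: "t \<in> {0..<1}" for t
  proof (rule tendsto_eventually)
    let ?b = "min 1 ((of_int \<lfloor>real n * t\<rfloor> + 1) / real n)"
    have "t < ?b" using t n floor_correct[of "real n * t"]
      by (auto simp: pos_less_divide_eq mult.commute)
    moreover have "step_path n v s = step_path n v t" if s: "t < s" "s < ?b" for s
    proof -
      have "real n * t \<le> real n * s" using s n by (intro mult_left_mono) auto
      moreover have "real n * s < of_int \<lfloor>real n * t\<rfloor> + 1"
        using s n by (auto simp: pos_less_divide_eq mult.commute)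
      ultimately have "\<lfloor>real n * s\<rfloor> = \<lfloor>real n * t\<rfloor>"
        using of_int_floor_le[of "real n * t"] by (intro floor_unique) linarith+
      then show ?thesis using s t by (simp add: step_path_def)
    qed
    ultimately show "eventually (\<lambda>s. step_path n v s = step_path n v t) (at_right t)"
      unfolding eventually_at_right_field by blast
  qed
  moreover have "\<exists>l. (step_path n v \<longlongrightarrow> l) (at_left t)" if t: "t \<in> {0<..1}" for t
  proof (intro exI tendsto_eventually)
    let ?b = "max 0 ((of_int \<lceil>real n * t\<rceil> - 1) / real n)"
    have "?b < t" using t n ceiling_correct[of "real n * t"]
      by (auto simp: pos_divide_less_eq mult.commute)
    moreover have "step_path n v s = v (nat (\<lceil>real n * t\<rceil> - 1))" if s: "?b < s" "s < t" for s
    proof -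
      have "real n * s < real n * t" using s n by (intro mult_strict_left_mono) auto
      moreover have "of_int \<lceil>real n * t\<rceil> - 1 < real n * s"
        using s n by (auto simp: pos_divide_less_eq mult.commute)
      ultimately have "\<lfloor>real n * s\<rfloor> = \<lceil>real n * t\<rceil> - 1"
        using ceiling_correct[of "real n * t"] by (intro floor_unique; simp only: of_int_diff of_int_1; linarith)
      then show ?thesis using s t by (simp add: step_path_def)
    qed
    ultimately show "eventually (\<lambda>s. step_path n v s = v (nat (\<lceil>real n * t\<rceil> - 1))) (at_left t)"
      unfolding eventually_at_left_field by blast
  qed
  ultimately show ?thesis
    unfolding cadlag01_def by (auto simp: step_path_def)
qed

lemma step_path_close:
  assumes "\<And>k. k \<le> n \<Longrightarrow> \<bar>v k - w k\<bar> \<le> r" "0 \<le> r"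
  shows "skorokhod_close (step_path n v) (step_path n w) r"
proof -
  have "nat \<lfloor>real n * t\<rfloor> \<le> n" if "t \<in> {0..1}" for t
  proof -
    have "real n * t \<le> real n" using that by (simp add: mult_left_le)
    then show ?thesis by linarith
  qed
  then show ?thesis
    using assms unfolding skorokhod_close_def
    by (intro bexI[OF _ time_changes_id]) (auto simp: step_path_def)
qed

lemma space_skorokhod_borel: "space skorokhod_borel = cadlag01"
  and sets_skorokhod_borel:
    "sets skorokhod_borel = sigma_sets cadlag01 {U. openin skorokhod_topology U}"
proof -
  have "{U. openin skorokhod_topology U} \<subseteq> Pow cadlag01"
    using openin_subset
    by (fastforce simp: skorokhod_topology_def Metric_space.topspace_mtopology[OF Metric_space_skorokhod])
  then show "space skorokhod_borel = cadlag01"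
    "sets skorokhod_borel = sigma_sets cadlag01 {U. openin skorokhod_topology U}"
    by (simp_all add: skorokhod_borel_def)
qed

lemma open_step_path_vimage:
  assumes U: "openin skorokhod_topology U"
  shows "open {v. step_path n v \<in> U}"
proof (subst open_subopen, intro ballI)
  fix v assume "v \<in> {v. step_path n v \<in> U}"
  then obtain r where r: "r > 0"
      "Metric_space.mball cadlag01 skorokhod_dist (step_path n v) r \<subseteq> U"
    using U Metric_space.openin_mtopology[OF Metric_space_skorokhod]
    unfolding skorokhod_topology_def by blast
  let ?V = "{w :: nat \<Rightarrow> real. \<forall>k\<in>{..n}. w k \<in> ball (v k) (r / 2)}"
  have "?V = Pi\<^sub>E UNIV (\<lambda>k. if k \<le> n then ball (v k) (r / 2) else UNIV)"
    by (auto simp: PiE_def Pi_def split: if_splits)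
  moreover have "finite {k. (if k \<le> n then ball (v k) (r / 2) else UNIV) \<noteq> UNIV}"
    by (rule finite_subset[of _ "{..n}"]) auto
  ultimately have "open ?V" by (auto intro!: open_PiE)
  moreover have "v \<in> ?V" using r by simp
  moreover have "step_path n w \<in> U" if "w \<in> ?V" for w
  proof -
    have "skorokhod_close (step_path n v) (step_path n w) (r / 2)"
      using that r(1) by (intro step_path_close) (auto simp: dist_real_def less_imp_le)
    then have "skorokhod_dist (step_path n v) (step_path n w) \<le> r / 2"
      using r(1) by (intro skorokhod_dist_le step_path_cadlag) auto
    then show ?thesis
      using r step_path_cadlag
      by (auto simp: Metric_space.in_mball[OF Metric_space_skorokhod])
  qed
  ultimately show "\<exists>T. open T \<and> v \<in> T \<and> T \<subseteq> {v. step_path n v \<in> U}" by blast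
qed

lemma measurable_step_path:
  assumes "\<And>k. X k \<in> borel_measurable M"
  shows "(\<lambda>\<omega>. step_path n (\<lambda>k. X k \<omega>)) \<in> measurable M skorokhod_borel"
proof (rule measurable_sigma_sets[OF sets_skorokhod_borel])
  show "{U. openin skorokhod_topology U} \<subseteq> Pow cadlag01"
    using openin_subset
    by (fastforce simp: skorokhod_topology_def Metric_space.topspace_mtopology[OF Metric_space_skorokhod])
  show "(\<lambda>\<omega>. step_path n (\<lambda>k. X k \<omega>)) \<in> space M \<rightarrow> cadlag01"
    by (auto intro: step_path_cadlag)
  fix U assume "U \<in> {U. openin skorokhod_topology U}"
  then have "{v. step_path n v \<in> U} \<in> sets borel" using open_step_path_vimage by auto
  moreover have "(\<lambda>\<omega> k. X k \<omega>) \<in> borel_measurable M"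
    using assms by (rule measurable_coordinatewise_then_product)
  ultimately have "(\<lambda>\<omega> k. X k \<omega>) -` {v. step_path n v \<in> U} \<inter> space M \<in> sets M"
    by (rule measurable_sets[rotated])
  then show "(\<lambda>\<omega>. step_path n (\<lambda>k. X k \<omega>)) -` U \<inter> space M \<in> sets M"
    by (simp add: vimage_def)
qed

end

theory Submission
  imports Defs "HOL-Real_Asymp.Real_Asymp"
begin

text \<open>
  Take independent coordinates \<open>\<omega> j\<close> with a symmetric law of variance \<open>1\<close>, the shift, and \<open>e \<omega> = \<omega> 0\<close>.
  The point is the choice of the filtration: the past \<open>F i\<close> knows the absolute values of all coordinates and
  the signs of those up to \<open>i\<close>. The coordinates are still martingale differences, but under the conditional
  law given \<open>F 0\<close> only the signs of the future coordinates are random.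

  The partial sums of the weights are \<open>b l = 1 / ln\<^sup>2 (l + 3)\<close>, so that
  \<open>S n = b 0 \<omega>(n - 1) + b 1 \<omega>(n - 2) + \<dots> + b (n - 2) \<omega> 1 + E(S n | F 0)\<close>. Because \<open>b\<close> tends to \<open>0\<close> slowly,
  the variance of \<open>S n\<close> is of order \<open>n / ln\<^sup>4 n\<close> and that of \<open>E(S n | F 0)\<close> is \<open>O(n / ln\<^sup>5 n)\<close>; the central limit
  theorem is the one for weighted sums of i.i.d. variables.

  The law of the coordinates has a tail so heavy that, with probability at least \<open>1/2\<close>, one of the first
  \<open>2\<^sup>k\<close> coordinates is much larger than the standard deviation of \<open>S n\<close> for all \<open>n \<le> 2\<^sup>k\<close>. Reversing the
  sign of such a coordinate \<open>\<omega> j\<close> moves \<open>S (j + 1)\<close> by \<open>2 b 0 \<omega> j\<close>, so one of the two signs makes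
  \<open>S (j + 1)\<close> too large. Hence the conditional laws of \<open>S n\<close>, and the maxima of the paths, normalized by the
  standard deviation, are not tight.
\<close>

text \<open>With the natural filtration of the coordinates, the part of \<open>S n\<close> after
  position 0 would be independent of \<open>F 0\<close> and so would inherit the annealed central
  limit theorem under almost every conditional law. Putting all absolute values into the past lets
  the conditional law see a large coordinate in advance. A central limit theorem can coexist with
  maxima that are not tight because a coordinate has the full weight \<open>b 0\<close> at one time
  only, just after it enters; afterwards its weight decreases to 0. At a fixed time a large recent
  coordinate is improbable, but over all times up to 2^k each coordinate has its turn. The condition
  \<open>\<sigma> n\<close> = o(sqrt n) is what makes room for this: the maximum of n independent
  copies of a variable with finite variance is o(sqrt n) in probability, so it can exceed multiples
  of \<open>\<sigma> n\<close> only if \<open>\<sigma> n\<close> is of smaller order than sqrt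
  n.\<close>

lemma tendsto_suminf_dominated:
  fixes g :: "nat \<Rightarrow> nat \<Rightarrow> real"
  assumes "\<And>i. (\<lambda>n. g n i) \<longlonglongrightarrow> l i" "\<And>n i. \<bar>g n i\<bar> \<le> w i" "summable w"
  shows "(\<lambda>n. \<Sum>i. g n i) \<longlonglongrightarrow> (\<Sum>i. l i)"
proof -
  have w: "integrable (count_space UNIV) w"
    using assms(3) order_trans[OF abs_ge_zero assms(2)]
    by (simp add: integrable_count_space_nat_iff)
  have *: "AE i in count_space UNIV. (\<lambda>n. g n i) \<longlonglongrightarrow> l i"
    "\<And>n. AE i in count_space UNIV. norm (g n i) \<le> w i"
    using assms by simp_all
  have **: "integrable (count_space UNIV) l" "\<And>n. integrable (count_space UNIV) (g n)"
    "(\<lambda>n. integral\<^sup>L (count_space UNIV) (g n)) \<longlonglongrightarrow> integral\<^sup>L (count_space UNIV) l"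
    using integrable_dominated_convergence[OF _ _ w *] integrable_dominated_convergence2[OF _ _ w *]
      integral_dominated_convergence[OF _ _ w *] by simp_all
  show ?thesis
    using **(3) unfolding integral_count_space_nat[OF **(1)] integral_count_space_nat[OF **(2)] .
qed

lemma summable_square_coeff:
  fixes c :: "nat \<Rightarrow> real"
  assumes "summable (\<lambda>l. \<bar>c l\<bar>)"
  shows "summable (\<lambda>l. (c l)\<^sup>2)"
proof -
  have "eventually (\<lambda>l. \<bar>c l\<bar> < 1) sequentially"
    using summable_LIMSEQ_zero[OF assms] by (rule order_tendstoD) simp
  then have "eventually (\<lambda>l. norm ((c l)\<^sup>2) \<le> \<bar>c l\<bar>) sequentially"
  proof eventually_elim
    case (elim l)
    then have "\<bar>c l\<bar> * \<bar>c l\<bar> \<le> 1 * \<bar>c l\<bar>" by (intro mult_right_mono) auto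
    then show ?case by (simp add: power2_eq_square)
  qed
  then show ?thesis by (rule summable_comparison_test_ev) (rule assms)
qed

lemma summable_shift_coeff:
  fixes c :: "nat \<Rightarrow> real"
  shows "summable (\<lambda>l. \<bar>c l\<bar>) \<Longrightarrow> summable (\<lambda>l. \<bar>c (l + r)\<bar>)"
  by (rule summable_ignore_initial_segment)

lemma L2_norm_cong_AE:
  fixes g h :: "'a \<Rightarrow> real"
  assumes "g \<in> borel_measurable M" "h \<in> borel_measurable M" "AE \<omega> in M. g \<omega> = h \<omega>"
  shows "L2_norm M g = L2_norm M h"
proof -
  have "(\<integral>\<omega>. (g \<omega>)\<^sup>2 \<partial>M) = (\<integral>\<omega>. (h \<omega>)\<^sup>2 \<partial>M)"
    using assms by (intro integral_cong_AE) (auto elim: eventually_mono)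
  then show ?thesis by (simp add: L2_norm_def)
qed

text \<open>The tightness criteria below range over all real K; passing to \<open>max K 1\<close>
  gives a positive constant.\<close>

lemma max_1_pos: "0 < max K (1::real)"
  by simp

text \<open>The preimage of a finite-dimensional box is the box of the preimages, and boxes
  determine the product measure. The map may vary with the coordinate: it serves for sign changes at
  selected positions and for the exclusive or with a fixed pattern of coins.\<close>

lemma distr_PiM_pointwise:
  fixes N :: "'b measure" and g :: "'i \<Rightarrow> 'b \<Rightarrow> 'b"
  assumes N: "prob_space N" and g: "\<And>i. g i \<in> measurable N N" "\<And>i. distr N N (g i) = N"
  shows "distr (PiM UNIV (\<lambda>_. N)) (PiM UNIV (\<lambda>_. N)) (\<lambda>\<omega> i. g i (\<omega> i)) = PiM UNIV (\<lambda>_. N)"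
proof -
  interpret product_prob_space "\<lambda>_. N" UNIV by (rule product_prob_spaceI) (rule N)
  have m: "(\<lambda>\<omega> i. g i (\<omega> i)) \<in> measurable (PiM UNIV (\<lambda>_. N)) (PiM UNIV (\<lambda>_. N))"
    using g(1) by (intro measurable_PiM_single') (auto simp: space_PiM PiE_iff dest: measurable_space)
  show ?thesis
  proof (rule PiM_eq)
    fix J and E :: "'i \<Rightarrow> 'b set"
    assume J: "finite J" and E: "\<And>j. j \<in> J \<Longrightarrow> E j \<in> sets N"
    let ?g = "\<lambda>\<omega> i. g i (\<omega> i)"
    let ?E' = "\<lambda>j. g j -` E j \<inter> space N"
    have "emeasure (distr (PiM UNIV (\<lambda>_. N)) (PiM UNIV (\<lambda>_. N)) ?g) (prod_emb UNIV (\<lambda>_. N) J (Pi\<^sub>E J E))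
        = emeasure (PiM UNIV (\<lambda>_. N)) (?g -` prod_emb UNIV (\<lambda>_. N) J (Pi\<^sub>E J E) \<inter> space (PiM UNIV (\<lambda>_. N)))"
      using J E m by (intro emeasure_distr sets_PiM_I) auto
    also have "?g -` prod_emb UNIV (\<lambda>_. N) J (Pi\<^sub>E J E) \<inter> space (PiM UNIV (\<lambda>_. N))
        = prod_emb UNIV (\<lambda>_. N) J (Pi\<^sub>E J ?E')"
      using g(1) by (auto simp: prod_emb_def space_PiM PiE_iff extensional_def dest: measurable_space)
    also have "emeasure (PiM UNIV (\<lambda>_. N)) \<dots> = (\<Prod>j\<in>J. emeasure N (?E' j))"
      using J E g(1) by (intro emeasure_PiM_emb) auto
    also have "\<dots> = (\<Prod>j\<in>J. emeasure N (E j))"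
    proof (rule prod.cong[OF refl])
      fix j assume "j \<in> J"
      then have "emeasure (distr N N (g j)) (E j) = emeasure N (?E' j)"
        using g(1) E by (intro emeasure_distr) auto
      then show "emeasure N (?E' j) = emeasure N (E j)" by (simp add: g(2))
    qed
    finally show "emeasure (distr (PiM UNIV (\<lambda>_. N)) (PiM UNIV (\<lambda>_. N)) ?g) (prod_emb UNIV (\<lambda>_. N) J (Pi\<^sub>E J E))
        = (\<Prod>j\<in>J. emeasure N (E j))" .
  qed simp
qed

section \<open>Two-sided sequences, the shift and sign changes\<close>

definition left_shift :: "(int \<Rightarrow> real) \<Rightarrow> int \<Rightarrow> real" where
  "left_shift \<omega> = (\<lambda>j. \<omega> (j + 1))"

definition flip :: "(int \<Rightarrow> bool) \<Rightarrow> (int \<Rightarrow> real) \<Rightarrow> int \<Rightarrow> real" where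
  "flip s \<omega> = (\<lambda>j. if s j then - \<omega> j else \<omega> j)"

lemma flip_apply: "flip s \<omega> j = (if s j then - \<omega> j else \<omega> j)"
  by (simp add: flip_def)

text \<open>Sign changes form a group under exclusive or; the same operation acts on the coins
  below.\<close>

lemma flip_flip: "flip s (flip t \<omega>) = flip (\<lambda>j. s j \<noteq> t j) \<omega>"
  by (auto simp: flip_def)

lemma left_shift_flip: "left_shift (flip s \<omega>) = flip (\<lambda>j. s (j + 1)) (left_shift \<omega>)"
  by (auto simp: flip_def left_shift_def)

lemma bij_left_shift: "bij left_shift"
  by (rule bij_betw_byWitness[where f' = "\<lambda>\<omega> j. \<omega> (j - 1)"]) (auto simp: left_shift_def)

lemma inv_left_shift: "inv left_shift = (\<lambda>\<omega> j. \<omega> (j - 1))"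
  by (rule inv_equality) (auto simp: left_shift_def)

lemma left_shift_funpow: "(left_shift ^^ n) \<omega> = (\<lambda>j. \<omega> (j + int n))"
  by (induction n) (auto simp: left_shift_def algebra_simps)

lemma inv_left_shift_funpow: "(inv left_shift ^^ n) \<omega> = (\<lambda>j. \<omega> (j - int n))"
  by (induction n) (auto simp: inv_left_shift algebra_simps)

locale symmetric_sequence =
  fixes \<nu> :: "real measure"
  assumes prob_\<nu>: "prob_space \<nu>" and sets_\<nu> [measurable_cong]: "sets \<nu> = sets borel"
    and symmetric_\<nu>: "distr \<nu> borel uminus = \<nu>"
begin

lemma space_\<nu> [simp]: "space \<nu> = UNIV"
  using sets_eq_imp_space_eq[OF sets_\<nu>] by simp

definition M :: "(int \<Rightarrow> real) measure" where
  "M = PiM UNIV (\<lambda>_. \<nu>)"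

sublocale product: product_prob_space "\<lambda>_::int. \<nu>" UNIV
  by (rule product_prob_spaceI) (rule prob_\<nu>)

sublocale prob_space M
  unfolding M_def by (rule product.P.prob_space_axioms)

lemma space_M [simp]: "space M = UNIV"
  by (simp add: M_def space_PiM)

lemma sets_M [measurable_cong]: "sets M = sets (PiM UNIV (\<lambda>_::int. borel))"
  unfolding M_def by (intro sets_PiM_cong) (auto simp: sets_\<nu>)

lemma measurable_coordinate [measurable]: "(\<lambda>\<omega>. \<omega> j) \<in> borel_measurable M"
  by measurable

lemma measurable_into_M:
  assumes "\<And>j. (\<lambda>x. g x j) \<in> borel_measurable N"
  shows "g \<in> measurable N M"
  unfolding measurable_cong_sets[OF refl sets_M]
  using assms by (intro measurable_PiM_single') (auto simp: space_PiM)

lemma distr_coordinate: "distr M borel (\<lambda>\<omega>. \<omega> j) = \<nu>"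
proof -
  have "distr M borel (\<lambda>\<omega>. \<omega> j) = distr M \<nu> (\<lambda>\<omega>. \<omega> j)"
    by (rule distr_cong) (simp_all add: sets_\<nu>)
  then show ?thesis using product.PiM_component[of j] by (simp add: M_def)
qed

lemma integral_coordinate:
  fixes g :: "real \<Rightarrow> real"
  assumes "g \<in> borel_measurable borel"
  shows "(\<integral>\<omega>. g (\<omega> j) \<partial>M) = (\<integral>x. g x \<partial>\<nu>)"
  using integral_distr[of "\<lambda>\<omega>. \<omega> j" M borel g] assms by (simp add: distr_coordinate)

lemma integrable_coordinate:
  fixes g :: "real \<Rightarrow> real"
  assumes "g \<in> borel_measurable borel" "integrable \<nu> g"
  shows "integrable M (\<lambda>\<omega>. g (\<omega> j))"
  using integrable_distr_eq[of "\<lambda>\<omega>. \<omega> j" M borel g] assms by (simp add: distr_coordinate)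

lemma indep_coordinates: "indep_vars (\<lambda>_. borel) (\<lambda>j \<omega>. \<omega> j) I"
proof (cases "I = {}")
  case False
  then show ?thesis
  proof (subst indep_vars_iff_distr_eq_PiM')
    have "distr M (PiM I (\<lambda>_. borel)) (\<lambda>\<omega>. restrict \<omega> I) = distr M (PiM I (\<lambda>_. \<nu>)) (\<lambda>\<omega>. restrict \<omega> I)"
      by (intro distr_cong sets_PiM_cong) (auto simp: sets_\<nu>)
    also have "\<dots> = PiM I (\<lambda>_. \<nu>)"
      unfolding M_def using distr_PiM_reindex[of UNIV "\<lambda>_. \<nu>" "\<lambda>i. i" I] prob_\<nu> by simp
    finally show "distr M (PiM I (\<lambda>_. borel)) (\<lambda>\<omega>. \<lambda>i\<in>I. \<omega> i) = PiM I (\<lambda>i. distr M borel (\<lambda>\<omega>. \<omega> i))"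
      by (simp add: distr_coordinate)
  qed auto
qed (simp add: indep_vars_def indep_sets_def)

subsection \<open>The shift\<close>

lemma measurable_left_shift [measurable]: "left_shift \<in> measurable M M"
  by (rule measurable_into_M) (simp add: left_shift_def)

lemma measurable_inv_left_shift [measurable]: "inv left_shift \<in> measurable M M"
  by (rule measurable_into_M) (simp add: inv_left_shift)

lemma distr_left_shift: "distr M M left_shift = M"
proof -
  have "(\<lambda>\<omega>. \<lambda>n\<in>UNIV. \<omega> (n + 1)) = left_shift" by (auto simp: left_shift_def fun_eq_iff)
  then show ?thesis
    using distr_PiM_reindex[of UNIV "\<lambda>_. \<nu>" "\<lambda>j::int. j + 1" UNIV] prob_\<nu>
    by (simp add: M_def[symmetric])
qed

lemma automorphism_left_shift: "automorphism M left_shift"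
  using bij_left_shift by (simp add: automorphism_def distr_left_shift)

lemma distr_left_shift_funpow: "distr M M (left_shift ^^ n) = M"
proof (induction n)
  case (Suc n)
  have [measurable]: "(left_shift ^^ n) \<in> measurable M M" by (induction n) auto
  have "distr M M (left_shift ^^ Suc n) = distr (distr M M (left_shift ^^ n)) M left_shift"
    by (simp add: distr_distr)
  then show ?case unfolding Suc distr_left_shift .
qed (simp add: id_def distr_id2)

lemma measurable_left_shift_funpow [measurable]: "(left_shift ^^ n) \<in> measurable M M"
  by (induction n) auto

lemma measure_left_shift_funpow:
  assumes "B \<in> sets M"
  shows "prob ((left_shift ^^ n) -` B) = prob B"
  using measure_distr[OF measurable_left_shift_funpow assms, of n] by (simp add: distr_left_shift_funpow)

section \<open>Mixing and ergodicity of the shift\<close>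

definition cylinders :: "(int \<Rightarrow> real) set set" where
  "cylinders = {{\<omega>. \<forall>j\<in>J. \<omega> j \<in> E j} | J E. finite J \<and> (\<forall>j\<in>J. E j \<in> sets borel)}"

lemma sets_M_cylinders: "sets M = sigma_sets UNIV cylinders"
proof (rule antisym)
  have 1: "{{f \<in> UNIV. f i \<in> A} |(i::int) A. i \<in> UNIV \<and> A \<in> sets borel} \<subseteq> cylinders"
  proof safe
    fix i :: int and A :: "real set" assume A: "A \<in> sets borel"
    show "{f \<in> UNIV. f i \<in> A} \<in> cylinders"
      unfolding cylinders_def using A
      by (auto intro!: exI[of _ "{i}"] exI[of _ "\<lambda>_. A"])
  qed
  have 2: "sets M = sigma_sets UNIV {{f \<in> UNIV. f i \<in> A} |(i::int) A. i \<in> UNIV \<and> A \<in> sets borel}"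
    unfolding sets_M sets_PiM_single by simp
  show "sets M \<subseteq> sigma_sets UNIV cylinders"
    unfolding 2 by (rule sigma_sets_mono'[OF 1])
next
  have "C \<in> sets M" if cyl: "C \<in> cylinders" for C
  proof -
    obtain J E where C: "C = {\<omega>. \<forall>j\<in>J. \<omega> j \<in> E j}" "finite J" and E: "\<And>j. j \<in> J \<Longrightarrow> E j \<in> sets borel"
      using cyl unfolding cylinders_def by blast
    have "{\<omega> \<in> space M. \<omega> j \<in> E j} \<in> sets M" if "j \<in> J" for j
    proof -
      have "{\<omega> \<in> space M. \<omega> j \<in> E j} = (\<lambda>\<omega>. \<omega> j) -` E j \<inter> space M" by auto
      then show ?thesis using measurable_sets[OF measurable_coordinate, of "E j"] E[OF that] by simp
    qed
    then have "{\<omega> \<in> space M. \<forall>j\<in>J. \<omega> j \<in> E j} \<in> sets M"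
      using C(2) by (intro sets.sets_Collect_finite_All)
    then show ?thesis by (simp add: C)
  qed
  then show "sigma_sets UNIV cylinders \<subseteq> sets M"
    using sets.sigma_sets_subset[of cylinders M] by (simp add: subset_iff)
qed

lemma Int_stable_cylinders: "Int_stable cylinders"
proof (rule Int_stableI)
  fix A B assume "A \<in> cylinders" "B \<in> cylinders"
  then obtain J E K H where A: "A = {\<omega>. \<forall>j\<in>J. \<omega> j \<in> E j}" "finite J" "\<And>j. j \<in> J \<Longrightarrow> E j \<in> sets borel"
    and B: "B = {\<omega>. \<forall>j\<in>K. \<omega> j \<in> H j}" "finite K" "\<And>j. j \<in> K \<Longrightarrow> H j \<in> sets borel"
    unfolding cylinders_def by blast
  have "A \<inter> B = {\<omega>. \<forall>j\<in>J \<union> K. \<omega> j \<in> (if j \<in> J then E j else UNIV) \<inter> (if j \<in> K then H j else UNIV)}"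
    by (auto simp: A B)
  then show "A \<inter> B \<in> cylinders"
    unfolding cylinders_def using A B
    by (auto intro!: exI[of _ "J \<union> K"] exI[of _ "\<lambda>j. (if j \<in> J then E j else UNIV) \<inter> (if j \<in> K then H j else UNIV)"])
qed

lemma prob_cylinder:
  assumes "finite J" "\<And>j. j \<in> J \<Longrightarrow> E j \<in> sets borel"
  shows "prob {\<omega>. \<forall>j\<in>J. \<omega> j \<in> E j} = (\<Prod>j\<in>J. measure \<nu> (E j))"
proof -
  have "emeasure M {\<omega>. \<forall>j\<in>J. \<omega> j \<in> E j} = (\<Prod>j\<in>J. emeasure \<nu> (E j))"
    using product.emeasure_PiM_Collect[of J E] assms by (simp add: M_def space_PiM sets_\<nu>)
  also have "\<dots> = ennreal (\<Prod>j\<in>J. measure \<nu> (E j))"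
    by (simp add: product.M.emeasure_eq_measure prod_ennreal measure_nonneg)
  finally show ?thesis
    by (simp add: emeasure_eq_measure measure_nonneg prod_nonneg)
qed

text \<open>Once K shifted by n lies entirely to the right of J, the two events depend on disjoint
  sets of coordinates and are independent, so the sequence is eventually constant.\<close>

lemma mixing_cylinders:
  assumes "A \<in> cylinders" "B \<in> cylinders"
  shows "(\<lambda>n. prob (A \<inter> (left_shift ^^ n) -` B)) \<longlonglongrightarrow> prob A * prob B"
proof -
  obtain J E K H where A: "A = {\<omega>. \<forall>j\<in>J. \<omega> j \<in> E j}" "finite J" "\<And>j. j \<in> J \<Longrightarrow> E j \<in> sets borel"
    and B: "B = {\<omega>. \<forall>j\<in>K. \<omega> j \<in> H j}" "finite K" "\<And>j. j \<in> K \<Longrightarrow> H j \<in> sets borel"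
    using assms unfolding cylinders_def by blast
  have eq: "prob (A \<inter> (left_shift ^^ n) -` B) = prob A * prob B" if n: "\<forall>j\<in>J. \<forall>k\<in>K. j < k + int n" for n
  proof -
    let ?K = "(\<lambda>k. k + int n) ` K"
    have disj: "J \<inter> ?K = {}" using n by fastforce
    let ?E = "\<lambda>j. if j \<in> J then E j else H (j - int n)"
    have fn: "k + int n \<notin> J" if "k \<in> K" for k using n that by fastforce
    have "A \<inter> (left_shift ^^ n) -` B = {\<omega>. \<forall>j\<in>J \<union> ?K. \<omega> j \<in> ?E j}"
      using fn by (auto simp: A B left_shift_funpow ball_Un)
    also have "prob \<dots> = (\<Prod>j\<in>J \<union> ?K. measure \<nu> (?E j))"
      using A B by (intro prob_cylinder) auto
    also have "\<dots> = (\<Prod>j\<in>J. measure \<nu> (?E j)) * (\<Prod>j\<in>?K. measure \<nu> (?E j))"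
      using A B disj by (intro prod.union_disjoint) auto
    also have "(\<Prod>j\<in>?K. measure \<nu> (?E j)) = (\<Prod>k\<in>K. measure \<nu> (?E (k + int n)))"
      by (subst prod.reindex) (auto simp: inj_on_def)
    also have "\<dots> = (\<Prod>k\<in>K. measure \<nu> (H k))"
      by (intro prod.cong) (auto simp: fn)
    finally show ?thesis using A B by (simp add: prob_cylinder)
  qed
  obtain a where a: "\<forall>j\<in>J. j \<le> a" by (meson A(2) bdd_above.E bdd_above_finite)
  obtain b where b: "\<forall>k\<in>K. b \<le> k" by (meson B(2) bdd_below.E bdd_below_finite)
  show ?thesis
  proof (rule tendsto_eventually, rule eventually_sequentiallyI)
    fix n assume "nat (a - b + 1) \<le> n"
    then have "\<forall>j\<in>J. \<forall>k\<in>K. j < k + int n" using a b by force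
    then show "prob (A \<inter> (left_shift ^^ n) -` B) = prob A * prob B" by (rule eq)
  qed
qed

lemma vimage_left_shift_funpow_sets [intro]:
  assumes "C \<in> sets M"
  shows "(left_shift ^^ n) -` C \<in> sets M"
  using measurable_sets[OF measurable_left_shift_funpow assms, of n] by simp

text \<open>Dynkin's induction for the generating family of cylinders, which is stable under
  intersection. The empty set is itself a cylinder, so it needs no case of its own.\<close>

lemma cylinder_induct [consumes 1, case_names cylinder compl union]:
  assumes "A \<in> sets M" "\<And>A. A \<in> cylinders \<Longrightarrow> P A"
    "\<And>A. A \<in> sets M \<Longrightarrow> P A \<Longrightarrow> P (UNIV - A)"
    "\<And>A. disjoint_family A \<Longrightarrow> range A \<subseteq> sets M \<Longrightarrow> (\<And>i::nat. P (A i)) \<Longrightarrow> P (\<Union>i. A i)"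
  shows "P A"
proof -
  have *: "cylinders \<subseteq> Pow UNIV" "A \<in> sigma_sets UNIV cylinders"
    using assms(1) by (simp_all add: sets_M_cylinders)
  show ?thesis
  proof (rule sigma_sets_induct_disjoint[OF Int_stable_cylinders *, of P])
    have "{\<omega>::int \<Rightarrow> real. \<forall>j\<in>{0}. \<omega> j \<in> {}} \<in> cylinders"
      unfolding cylinders_def by (intro CollectI exI[of _ "{0::int}"] exI[of _ "\<lambda>_. {}"]) auto
    then show "P {}" using assms(2) by force
  qed (use assms(2-4) in \<open>auto simp: sets_M_cylinders\<close>)
qed

text \<open>The two events are freed from being cylinders one after the other: first A with a
  cylinder B held fixed, then B with an arbitrary A.\<close>

lemma mixing:
  assumes "A \<in> sets M" "B \<in> sets M"
  shows "(\<lambda>n. prob (A \<inter> (left_shift ^^ n) -` B)) \<longlonglongrightarrow> prob A * prob B"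
proof -
  have cyl: "C \<in> sets M" if "C \<in> cylinders" for C using that by (simp add: sets_M_cylinders)
  have 1: "(\<lambda>n. prob (A \<inter> (left_shift ^^ n) -` B)) \<longlonglongrightarrow> prob A * prob B"
    if A: "A \<in> sets M" and B: "B \<in> cylinders" for A B
    using A
  proof (induction rule: cylinder_induct)
    case (cylinder A)
    then show ?case by (intro mixing_cylinders B)
  next
    case (compl A)
    have sB: "B \<in> sets M" by (rule cyl) (rule B)
    have "prob ((UNIV - A) \<inter> (left_shift ^^ n) -` B) = prob B - prob (A \<inter> (left_shift ^^ n) -` B)" for n
    proof -
      have "(UNIV - A) \<inter> (left_shift ^^ n) -` B = (left_shift ^^ n) -` B - (left_shift ^^ n) -` B \<inter> A" by auto
      then show ?thesis
        using finite_measure_Diff'[of "(left_shift ^^ n) -` B" A] compl(1) sB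
        by (simp add: vimage_left_shift_funpow_sets measure_left_shift_funpow Int_commute Diff_Int)
    qed
    moreover have "prob (UNIV - A) = 1 - prob A"
      using prob_compl[OF compl(1)] by simp
    moreover have "(\<lambda>n. prob B - prob (A \<inter> (left_shift ^^ n) -` B)) \<longlonglongrightarrow> prob B - prob A * prob B"
      by (intro tendsto_intros compl)
    ultimately show ?case by (simp only: left_diff_distrib mult_1_left)
  next
    case (union A)
    have "prob ((\<Union>i. A i) \<inter> (left_shift ^^ n) -` B) = (\<Sum>i. prob (A i \<inter> (left_shift ^^ n) -` B))" for n
    proof -
      have "(\<lambda>i. prob (A i \<inter> (left_shift ^^ n) -` B)) sums prob (\<Union>i. A i \<inter> (left_shift ^^ n) -` B)"
        using union(1,2) cyl[OF B]
        by (intro finite_measure_UNION) (auto simp: disjoint_family_on_def)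
      then show ?thesis by (simp add: sums_iff)
    qed
    moreover have A: "(\<lambda>i. prob (A i)) sums prob (\<Union>i. A i)"
      by (rule finite_measure_UNION[OF union(2,1)])
    then have "prob (\<Union>i. A i) * prob B = (\<Sum>i. prob (A i) * prob B)"
      using sums_mult2[OF A, of "prob B"] by (simp add: sums_iff)
    \<comment> \<open>The limit in n passes through the countable union by dominated convergence for
      series; the majorant \<open>prob (A i)\<close> does not depend on n.\<close>
    moreover have "(\<lambda>n. \<Sum>i. prob (A i \<inter> (left_shift ^^ n) -` B)) \<longlonglongrightarrow> (\<Sum>i. prob (A i) * prob B)"
    proof (rule tendsto_suminf_dominated[where w = "\<lambda>i. prob (A i)"])
      show "summable (\<lambda>i. prob (A i))" using A by (simp add: sums_iff)
      show "\<bar>prob (A i \<inter> (left_shift ^^ n) -` B)\<bar> \<le> prob (A i)" for n i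
        using union(2) by (auto intro!: finite_measure_mono)
    qed (rule union)
    ultimately show ?case by simp
  qed
  show ?thesis
    using assms(2)
  proof (induction rule: cylinder_induct)
    case (cylinder B)
    then show ?case using assms(1) by (intro 1)
  next
    case (compl B)
    have "prob (A \<inter> (left_shift ^^ n) -` (UNIV - B)) = prob A - prob (A \<inter> (left_shift ^^ n) -` B)" for n
    proof -
      have "A \<inter> (left_shift ^^ n) -` (UNIV - B) = A - (left_shift ^^ n) -` B" by auto
      then show ?thesis
        using finite_measure_Diff'[of A "(left_shift ^^ n) -` B"] assms(1) compl(1)
        by (simp add: vimage_left_shift_funpow_sets)
    qed
    moreover have "prob (UNIV - B) = 1 - prob B"
      using prob_compl[OF compl(1)] by simp
    moreover have "(\<lambda>n. prob A - prob (A \<inter> (left_shift ^^ n) -` B)) \<longlonglongrightarrow> prob A - prob A * prob B"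
      by (intro tendsto_intros compl)
    ultimately show ?case by (simp only: right_diff_distrib mult_1_right)
  next
    case (union B)
    have "prob (A \<inter> (left_shift ^^ n) -` (\<Union>i. B i)) = (\<Sum>i. prob (A \<inter> (left_shift ^^ n) -` B i))" for n
    proof -
      have "(\<lambda>i. prob (A \<inter> (left_shift ^^ n) -` B i)) sums prob (\<Union>i. A \<inter> (left_shift ^^ n) -` B i)"
        using union(1,2) assms(1)
        by (intro finite_measure_UNION) (auto simp: disjoint_family_on_def)
      then show ?thesis by (simp add: sums_iff vimage_UN)
    qed
    moreover have B: "(\<lambda>i. prob (B i)) sums prob (\<Union>i. B i)"
      by (rule finite_measure_UNION[OF union(2,1)])
    then have "prob A * prob (\<Union>i. B i) = (\<Sum>i. prob A * prob (B i))"
      using sums_mult[OF B, of "prob A"] by (simp add: sums_iff)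
    \<comment> \<open>Here the majorant \<open>prob (B i)\<close> is independent of n because the
      shift preserves the measure.\<close>
    moreover have "(\<lambda>n. \<Sum>i. prob (A \<inter> (left_shift ^^ n) -` B i)) \<longlonglongrightarrow> (\<Sum>i. prob A * prob (B i))"
    proof (rule tendsto_suminf_dominated[where w = "\<lambda>i. prob (B i)"])
      show "summable (\<lambda>i. prob (B i))" using B by (simp add: sums_iff)
      show "\<bar>prob (A \<inter> (left_shift ^^ n) -` B i)\<bar> \<le> prob (B i)" for n i
      proof -
        have Bi: "B i \<in> sets M" using union(2) by auto
        have "prob (A \<inter> (left_shift ^^ n) -` B i) \<le> prob ((left_shift ^^ n) -` B i)"
          using Bi by (intro finite_measure_mono) auto
        then show ?thesis by (simp add: measure_left_shift_funpow[OF Bi])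
      qed
    qed (rule union)
    ultimately show ?case by simp
  qed
qed

text \<open>Mixing of an invariant event with itself gives
  \<open>prob A = prob A * prob A\<close>.\<close>

lemma ergodic_left_shift: "ergodic M left_shift"
  unfolding ergodic_def
proof (intro ballI impI)
  fix A assume A: "A \<in> sets M" "left_shift -` A \<inter> space M = A"
  have "(left_shift ^^ n) -` A = A" for n
  proof (induction n)
    case (Suc n)
    have "(left_shift ^^ Suc n) -` A = (left_shift ^^ n) -` (left_shift -` A)" by (simp only: funpow.simps vimage_comp)
    then show ?case using A(2) Suc by (simp only: Int_UNIV_right space_M)
  qed simp
  then have "(\<lambda>n::nat. prob A) \<longlonglongrightarrow> prob A * prob A"
    using mixing[OF A(1) A(1)] by simp
  then have "prob A = prob A * prob A" by (simp add: LIMSEQ_const_iff)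
  then show "prob A = 0 \<or> prob A = 1" by simp
qed

end

section \<open>Random sign patterns\<close>

definition coins :: "(int \<Rightarrow> bool) measure" where
  "coins = PiM UNIV (\<lambda>_. measure_pmf (pmf_of_set UNIV))"

lemma prob_space_coins: "prob_space coins"
  unfolding coins_def by (intro prob_space_PiM prob_space_measure_pmf)

lemma space_coins [simp]: "space coins = UNIV"
  by (simp add: coins_def space_PiM)

lemma sets_coins [measurable_cong]: "sets coins = sets (PiM UNIV (\<lambda>_::int. count_space UNIV))"
  unfolding coins_def by (intro sets_PiM_cong) auto

lemma measurable_coins_coordinate [measurable]: "(\<lambda>s. s j) \<in> measurable coins (count_space UNIV)"
  by measurable

lemma distr_coins_xor: "distr coins coins (\<lambda>(s :: int \<Rightarrow> bool) j. s j \<noteq> t j) = coins"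
  unfolding coins_def
proof (rule distr_PiM_pointwise)
  have *: "map_pmf (\<lambda>b. b \<noteq> x) (pmf_of_set (UNIV::bool set)) = pmf_of_set UNIV" for x :: bool
    by (rule map_pmf_of_set_bij_betw) (auto simp: bij_betw_def inj_on_def image_iff)
  show "distr (measure_pmf (pmf_of_set UNIV)) (measure_pmf (pmf_of_set UNIV)) (\<lambda>b. b \<noteq> t i)
      = measure_pmf (pmf_of_set UNIV)" for i
  proof -
    have "distr (measure_pmf (pmf_of_set UNIV)) (measure_pmf (pmf_of_set UNIV)) (\<lambda>b. b \<noteq> t i)
        = distr (measure_pmf (pmf_of_set UNIV)) (count_space UNIV) (\<lambda>b. b \<noteq> t i)"
      by (rule distr_cong) simp_all
    also have "\<dots> = measure_pmf (map_pmf (\<lambda>b. b \<noteq> t i) (pmf_of_set UNIV))"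
      by (rule map_pmf_rep_eq[symmetric])
    finally show ?thesis unfolding * .
  qed
qed (auto intro: prob_space_measure_pmf)

text \<open>E and its preimage have the same measure and together cover the space. It will be
  applied with \<psi> reversing a single coin.\<close>

lemma half_le_measure:
  assumes "prob_space P" "\<psi> \<in> measurable P P" "distr P P \<psi> = P"
    "E \<in> sets P" "\<And>x. x \<in> space P \<Longrightarrow> x \<in> E \<or> \<psi> x \<in> E"
  shows "1/2 \<le> measure P E"
proof -
  interpret prob_space P by fact
  have m: "\<psi> -` E \<inter> space P \<in> sets P" using assms by (auto intro: measurable_sets)
  have "space P \<subseteq> E \<union> (\<psi> -` E \<inter> space P)" using assms(5) by auto
  then have "1 \<le> prob (E \<union> (\<psi> -` E \<inter> space P))"
    using finite_measure_mono[of "space P" "E \<union> (\<psi> -` E \<inter> space P)"] m assms(4) prob_space by auto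
  also have "\<dots> \<le> prob E + prob (\<psi> -` E \<inter> space P)"
    using m assms(4) by (intro measure_Un_le)
  also have "prob (\<psi> -` E \<inter> space P) = prob E"
    using measure_distr[OF assms(2,4)] assms(3) by simp
  finally show ?thesis by simp
qed

context symmetric_sequence
begin

subsection \<open>Sign changes\<close>

lemma measurable_flip [measurable]: "flip s \<in> measurable M M"
proof (rule measurable_into_M)
  show "(\<lambda>\<omega>. flip s \<omega> j) \<in> borel_measurable M" for j
    by (cases "s j") (simp_all add: flip_def)
qed

lemma distr_flip: "distr M M (flip s) = M"
proof -
  have 1: "uminus \<in> measurable \<nu> \<nu>"
    unfolding measurable_cong_sets[OF sets_\<nu> sets_\<nu>] by simp
  have 2: "distr \<nu> \<nu> uminus = \<nu>"
    using distr_cong[OF refl sets_\<nu>, of \<nu> uminus uminus] symmetric_\<nu> by simp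
  have "distr (PiM UNIV (\<lambda>_. \<nu>)) (PiM UNIV (\<lambda>_. \<nu>)) (\<lambda>\<omega> j. (if s j then uminus else (\<lambda>x. x)) (\<omega> j))
      = PiM UNIV (\<lambda>_. \<nu>)"
    by (rule distr_PiM_pointwise) (use prob_\<nu> 1 2 in \<open>auto simp: distr_id2\<close>)
  moreover have "(\<lambda>\<omega> j. (if s j then uminus else (\<lambda>x. x)) (\<omega> j)) = flip s"
    by (auto simp: flip_def fun_eq_iff)
  ultimately show ?thesis by (simp add: M_def)
qed

lemma integral_flip:
  fixes g :: "_ \<Rightarrow> real"
  assumes "g \<in> borel_measurable M"
  shows "(\<integral>\<omega>. g (flip s \<omega>) \<partial>M) = (\<integral>\<omega>. g \<omega> \<partial>M)"
  using integral_distr[of "flip s" M M g] assms by (simp add: distr_flip)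

text \<open>This replaces independence in what follows: orthogonality of the coordinates and the
  martingale difference property for the enlarged past both come from reversing one sign.\<close>

lemma integral_odd:
  fixes g :: "_ \<Rightarrow> real"
  assumes "g \<in> borel_measurable M" "\<And>\<omega>. g (flip s \<omega>) = - g \<omega>"
  shows "(\<integral>\<omega>. g \<omega> \<partial>M) = 0"
  using integral_flip[OF assms(1), of s] assms(2) by simp

lemma prob_flip:
  assumes "A \<in> sets M"
  shows "prob (flip s -` A) = prob A"
  using measure_distr[OF measurable_flip assms, of s] by (simp add: distr_flip)

text \<open>The events of \<open>F i\<close> may depend on everything except the signs of the coordinates after \<open>i\<close>.\<close>

definition F :: "int \<Rightarrow> (int \<Rightarrow> real) measure" where
  "F i = sigma UNIV {A \<in> sets M. \<forall>s. (\<forall>j\<le>i. \<not> s j) \<longrightarrow> flip s -` A = A}"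

lemma space_F [simp]: "space (F i) = UNIV"
  by (simp add: F_def)

text \<open>Preimages commute with complements and countable unions, so the invariant events already
  form a sigma-algebra and nothing is added by generating one.\<close>

lemma sets_F: "sets (F i) = {A \<in> sets M. \<forall>s. (\<forall>j\<le>i. \<not> s j) \<longrightarrow> flip s -` A = A}"
proof -
  have "sigma_algebra UNIV {A \<in> sets M. \<forall>s. (\<forall>j\<le>i. \<not> s j) \<longrightarrow> flip s -` A = A}"
    unfolding sigma_algebra_iff2
  proof (intro conjI ballI allI impI)
    fix A assume "A \<in> {A \<in> sets M. \<forall>s. (\<forall>j\<le>i. \<not> s j) \<longrightarrow> flip s -` A = A}"
    then show "UNIV - A \<in> {A \<in> sets M. \<forall>s. (\<forall>j\<le>i. \<not> s j) \<longrightarrow> flip s -` A = A}"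
      using sets.compl_sets[of A M] by (auto simp: vimage_Diff)
  next
    fix A :: "nat \<Rightarrow> _" assume "range A \<subseteq> {A \<in> sets M. \<forall>s. (\<forall>j\<le>i. \<not> s j) \<longrightarrow> flip s -` A = A}"
    then show "(\<Union>n. A n) \<in> {A \<in> sets M. \<forall>s. (\<forall>j\<le>i. \<not> s j) \<longrightarrow> flip s -` A = A}"
      by (auto simp: vimage_UN subset_iff)
  qed auto
  then show ?thesis unfolding F_def by (simp add: sigma_algebra.sigma_sets_eq)
qed

lemma subalgebra_F: "subalgebra M (F i)"
  by (auto simp: subalgebra_def sets_F)

lemma sigma_finite_subalgebra_F: "sigma_finite_subalgebra M (F i)"
  by (intro finite_measure_subalgebra_is_sigma_finite finite_measure_subalgebra.intro
      finite_measure_axioms finite_measure_subalgebra_axioms.intro subalgebra_F)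

text \<open>The level set of h through \<omega> is an event of \<open>F i\<close>, hence invariant.
  The conclusion holds at every point and not merely almost everywhere, which the quenched argument
  needs, since it works with one \<omega> and all its sign changes.\<close>

lemma measurable_F_invariant:
  fixes h :: "_ \<Rightarrow> real"
  assumes "h \<in> borel_measurable (F i)" "\<And>j. j \<le> i \<Longrightarrow> \<not> s j"
  shows "h (flip s \<omega>) = h \<omega>"
proof -
  have "h -` {h \<omega>} \<inter> space (F i) \<in> sets (F i)"
    using assms(1) by (rule measurable_sets) simp
  then have "flip s -` (h -` {h \<omega>}) = h -` {h \<omega>}"
    using assms(2) by (simp add: sets_F)
  then have "\<omega> \<in> flip s -` (h -` {h \<omega>})" by simp
  then show ?thesis by simp
qed

lemma measurable_FI:
  fixes h :: "_ \<Rightarrow> real"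
  assumes "h \<in> borel_measurable M" "\<And>s \<omega>. (\<And>j. j \<le> i \<Longrightarrow> \<not> s j) \<Longrightarrow> h (flip s \<omega>) = h \<omega>"
  shows "h \<in> borel_measurable (F i)"
proof (rule measurableI)
  fix A :: "real set" assume "A \<in> sets borel"
  then have "h -` A \<in> sets M" using measurable_sets[OF assms(1)] by simp
  then show "h -` A \<inter> space (F i) \<in> sets (F i)"
    using assms(2) by (auto simp: sets_F)
qed simp

text \<open>Conjugation by the shift moves the set of positions whose signs may be reversed by
  one.\<close>

lemma stationary_filtration_F: "stationary_filtration M left_shift F"
  unfolding stationary_filtration_def
proof (intro conjI allI)
  show "subalgebra M (F i)" for i by (rule subalgebra_F)
  show "sets (F i) \<subseteq> sets (F (i + 1))" for i
  proof
    fix A assume A: "A \<in> sets (F i)"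
    have "flip s -` A = A" if "\<forall>j\<le>i + 1. \<not> s j" for s
      using A that by (simp add: sets_F)
    then show "A \<in> sets (F (i + 1))" using A by (simp add: sets_F)
  qed
  show "sets (F (i + 1)) = {left_shift -` A \<inter> space M | A. A \<in> sets (F i)}" for i
  proof (rule antisym; rule subsetI)
    fix B assume B: "B \<in> sets (F (i + 1))"
    define A where "A = inv left_shift -` B"
    have "A \<in> sets M"
      using B measurable_sets[OF measurable_inv_left_shift, of B] by (auto simp: sets_F A_def)
    moreover have "flip s -` A = A" if s: "\<forall>j\<le>i. \<not> s j" for s
    proof -
      have "inv left_shift (flip s \<omega>) = flip (\<lambda>j. s (j - 1)) (inv left_shift \<omega>)" for \<omega>
        by (auto simp: inv_left_shift flip_def)
      then have "flip s -` A = inv left_shift -` (flip (\<lambda>j. s (j - 1)) -` B)"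
        by (auto simp: A_def)
      also have "flip (\<lambda>j. s (j - 1)) -` B = B"
        using B s by (auto simp: sets_F)
      finally show ?thesis by (simp add: A_def)
    qed
    moreover have "B = left_shift -` A"
      using bij_left_shift by (simp add: A_def vimage_def bij_is_inj inv_f_f)
    ultimately show "B \<in> {left_shift -` A \<inter> space M | A. A \<in> sets (F i)}"
      by (auto simp: sets_F)
  next
    fix B assume "B \<in> {left_shift -` A \<inter> space M | A. A \<in> sets (F i)}"
    then obtain A where A: "A \<in> sets (F i)" "B = left_shift -` A" by auto
    have "B \<in> sets M"
      using A measurable_sets[OF measurable_left_shift, of A] by (auto simp: sets_F)
    moreover have "flip s -` B = B" if s: "\<forall>j\<le>i + 1. \<not> s j" for s
    proof -
      have "flip s -` B = left_shift -` (flip (\<lambda>j. s (j + 1)) -` A)"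
        by (auto simp: A(2) left_shift_flip)
      also have "flip (\<lambda>j. s (j + 1)) -` A = A"
        using A(1) s by (auto simp: sets_F)
      finally show ?thesis by (simp add: A(2))
    qed
    ultimately show "B \<in> sets (F (i + 1))" by (simp add: sets_F)
  qed
qed

definition flip_future :: "(int \<Rightarrow> bool) \<Rightarrow> (int \<Rightarrow> real) \<Rightarrow> int \<Rightarrow> real" where
  "flip_future s = flip (\<lambda>j. 0 < j \<and> s j)"

text \<open>The compact group of sign changes at positive positions acts on the sequences, and
  \<open>F 0\<close> consists of the events invariant under it. This is the average over the orbit
  of \<omega> with respect to the Haar measure of that group.\<close>

definition future_sign_law :: "(int \<Rightarrow> real) \<Rightarrow> (int \<Rightarrow> real) measure" where
  "future_sign_law \<omega> = distr coins M (\<lambda>s. flip_future s \<omega>)"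

lemma measurable_flip_future_pair [measurable]:
  "(\<lambda>(\<omega>, s). flip_future s \<omega>) \<in> measurable (M \<Otimes>\<^sub>M coins) M"
proof (rule measurable_into_M)
  fix j
  have [measurable]: "(\<lambda>p. snd p j) \<in> measurable (M \<Otimes>\<^sub>M coins) (count_space UNIV)"
    by (rule measurable_compose[OF measurable_snd measurable_coins_coordinate])
  have [measurable]: "(\<lambda>p. fst p j) \<in> borel_measurable (M \<Otimes>\<^sub>M coins)"
    by (rule measurable_compose[OF measurable_fst measurable_coordinate])
  have "(\<lambda>p. if 0 < j \<and> snd p j then - fst p j else fst p j) \<in> borel_measurable (M \<Otimes>\<^sub>M coins)"
    by measurable
  then show "(\<lambda>p. (case p of (\<omega>, s) \<Rightarrow> flip_future s \<omega>) j) \<in> borel_measurable (M \<Otimes>\<^sub>M coins)"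
    by (simp add: flip_future_def flip_def case_prod_unfold)
qed

lemma measurable_flip_future [measurable]: "(\<lambda>s. flip_future s \<omega>) \<in> measurable coins M"
  using measurable_compose[OF measurable_Pair1' measurable_flip_future_pair, of \<omega>] by simp

lemma prob_space_future_sign_law: "prob_space (future_sign_law \<omega>)"
  unfolding future_sign_law_def by (intro prob_space.prob_space_distr prob_space_coins measurable_flip_future)

lemma measure_future_sign_law:
  assumes "A \<in> sets M"
  shows "measure (future_sign_law \<omega>) A = measure coins {s. flip_future s \<omega> \<in> A}"
  unfolding future_sign_law_def
  by (subst measure_distr[OF measurable_flip_future assms]) (simp add: vimage_def)

text \<open>Translation invariance of the coins makes the kernel constant on orbits, hence
  measurable for \<open>F 0\<close>. The averaging identity over an invariant B follows from Fubini,
  since each sign change preserves both \<open>M\<close> and B.\<close>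

lemma regular_cond_prob_future_sign_law: "regular_cond_prob M (F 0) future_sign_law"
  unfolding regular_cond_prob_def
proof (intro conjI ballI)
  interpret C: prob_space coins by (rule prob_space_coins)
  interpret P: pair_prob_space M coins ..
  interpret sigma_finite_subalgebra M "F 0" by (rule sigma_finite_subalgebra_F)
  show "prob_space (future_sign_law \<omega>)" "sets (future_sign_law \<omega>) = sets M" for \<omega>
    by (rule prob_space_future_sign_law) (simp add: future_sign_law_def)
  fix A assume A [measurable]: "A \<in> sets M"
  have eq: "measure (future_sign_law \<omega>) A = (\<integral>s. indicator A (flip_future s \<omega>) \<partial>coins)" for \<omega>
  proof -
    have "{s. flip_future s \<omega> \<in> A} \<in> sets coins"
      using measurable_sets[OF measurable_flip_future A] by (simp add: vimage_def)
    moreover have "indicator A (flip_future s \<omega>) = (indicator {s. flip_future s \<omega> \<in> A} s :: real)" for s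
      by (simp add: indicator_def)
    ultimately show ?thesis by (simp add: measure_future_sign_law)
  qed
  have pm [measurable]: "(\<lambda>(\<omega>, s). indicator A (flip_future s \<omega>) :: real) \<in> borel_measurable (M \<Otimes>\<^sub>M coins)"
    using measurable_compose[OF measurable_flip_future_pair borel_measurable_indicator[OF A]]
    by (simp add: case_prod_unfold)
  show meas: "(\<lambda>\<omega>. measure (future_sign_law \<omega>) A) \<in> borel_measurable (F 0)"
  proof (rule measurable_FI)
    show "(\<lambda>\<omega>. measure (future_sign_law \<omega>) A) \<in> borel_measurable M"
      unfolding eq by (intro C.borel_measurable_lebesgue_integral pm)
    fix t :: "int \<Rightarrow> bool" and \<omega> :: "int \<Rightarrow> real" assume t: "\<And>j. j \<le> 0 \<Longrightarrow> \<not> t j"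
    let ?x = "\<lambda>(s :: int \<Rightarrow> bool) j. s j \<noteq> t j"
    have x: "?x \<in> measurable coins coins"
      unfolding measurable_cong_sets[OF refl sets_coins]
      by (intro measurable_PiM_single') (auto simp: space_PiM)
    have "flip_future s (flip t \<omega>) = flip_future (?x s) \<omega>" for s
    proof -
      \<comment> \<open>At positions up to 0 both sides are false, because t reverses no sign
        there.\<close>
      have "(\<lambda>j. (0 < j \<and> s j) \<noteq> t j) = (\<lambda>j. 0 < j \<and> ?x s j)"
        using t by (metis not_less)
      then show ?thesis unfolding flip_future_def flip_flip by simp
    qed
    then have "future_sign_law (flip t \<omega>) = distr coins M (\<lambda>s. flip_future (?x s) \<omega>)"
      by (simp add: future_sign_law_def)
    also have "\<dots> = distr (distr coins coins ?x) M (\<lambda>s. flip_future s \<omega>)"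
      by (subst distr_distr[OF _ x]) (simp_all add: comp_def)
    also have "\<dots> = future_sign_law \<omega>"
      unfolding distr_coins_xor future_sign_law_def ..
    finally show "measure (future_sign_law (flip t \<omega>)) A = measure (future_sign_law \<omega>) A" by simp
  qed
  have "AE \<omega> in M. real_cond_exp M (F 0) (indicator A) \<omega> = measure (future_sign_law \<omega>) A"
  proof (rule real_cond_exp_charact)
    show "integrable M (indicator A :: _ \<Rightarrow> real)"
      by (rule integrable_real_indicator) (simp_all add: A emeasure_eq_measure)
    have m': "(\<lambda>\<omega>. measure (future_sign_law \<omega>) A) \<in> borel_measurable M"
      using meas measurable_from_subalg[OF subalgebra_F] by blast
    then show "integrable M (\<lambda>\<omega>. measure (future_sign_law \<omega>) A)"
      using prob_space.prob_le_1[OF prob_space_future_sign_law]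
      by (intro integrable_const_bound[where B = 1]) auto
    show "(\<lambda>\<omega>. measure (future_sign_law \<omega>) A) \<in> borel_measurable (F 0)" by (rule meas)
    fix B assume B: "B \<in> sets (F 0)"
    then have BM [measurable]: "B \<in> sets M" by (simp add: sets_F)
    \<comment> \<open>Since B does not separate the points of an orbit, its indicator can be moved
      inside the integral over the coins.\<close>
    have inv: "flip_future s \<omega> \<in> B \<longleftrightarrow> \<omega> \<in> B" for s \<omega>
      using B unfolding flip_future_def by (auto simp: sets_F vimage_def set_eq_iff)
    have "(\<integral>\<omega>\<in>B. measure (future_sign_law \<omega>) A \<partial>M)
        = (\<integral>\<omega>. (\<integral>s. indicator (A \<inter> B) (flip_future s \<omega>) \<partial>coins) \<partial>M)"
      unfolding set_lebesgue_integral_def eq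
      by (intro Bochner_Integration.integral_cong refl) (simp add: indicator_inter_arith inv indicator_def)
    \<comment> \<open>With the order exchanged, the inner integral is taken for a fixed sign
      pattern, where the flip preserves \<open>M\<close>.\<close>
    also have "\<dots> = (\<integral>s. (\<integral>\<omega>. indicator (A \<inter> B) (flip_future s \<omega>) \<partial>M) \<partial>coins)"
    proof (rule P.Fubini_integral[symmetric])
      have "(\<lambda>(\<omega>, s). indicator (A \<inter> B) (flip_future s \<omega>) :: real) \<in> borel_measurable (M \<Otimes>\<^sub>M coins)"
        using measurable_compose[OF measurable_flip_future_pair borel_measurable_indicator[OF sets.Int[OF A BM]]]
        by (simp add: case_prod_unfold)
      then show "integrable (M \<Otimes>\<^sub>M coins) (\<lambda>(\<omega>, s). indicator (A \<inter> B) (flip_future s \<omega>) :: real)"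
        by (intro P.integrable_const_bound[where B = 1]) (auto simp: indicator_def)
    qed
    also have "\<dots> = (\<integral>s. prob (A \<inter> B) \<partial>coins)"
    proof (rule Bochner_Integration.integral_cong[OF refl])
      fix s
      have "(\<integral>\<omega>. indicat_real (A \<inter> B) (flip_future s \<omega>) \<partial>M) = (\<integral>\<omega>. indicat_real (A \<inter> B) \<omega> \<partial>M)"
        unfolding flip_future_def
        by (rule integral_flip) simp
      then show "(\<integral>\<omega>. indicat_real (A \<inter> B) (flip_future s \<omega>) \<partial>M) = prob (A \<inter> B)" by simp
    qed
    also have "\<dots> = prob (A \<inter> B)" using C.prob_space by simp
    also have "\<dots> = (\<integral>\<omega>\<in>B. indicator A \<omega> \<partial>M)"
      unfolding set_lebesgue_integral_def by (simp add: indicator_inter_arith[symmetric] Int_commute)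
    finally show "(\<integral>\<omega>\<in>B. indicator A \<omega> \<partial>M) = (\<integral>\<omega>\<in>B. measure (future_sign_law \<omega>) A \<partial>M)" by simp
  qed
  then show "AE \<omega> in M. measure (future_sign_law \<omega>) A = real_cond_exp M (F 0) (indicator A) \<omega>"
    by (auto elim: eventually_mono)
qed

end

locale unit_variance_sequence = symmetric_sequence +
  assumes integrable_square: "integrable \<nu> (\<lambda>x. x\<^sup>2)" and variance_1: "(\<integral>x. x\<^sup>2 \<partial>\<nu>) = 1"
begin

lemma integrable_square_coordinate: "integrable M (\<lambda>\<omega>. (\<omega> j)\<^sup>2)"
  using integrable_square by (intro integrable_coordinate) auto

lemma integral_square_coordinate: "(\<integral>\<omega>. (\<omega> j)\<^sup>2 \<partial>M) = 1"
  using variance_1 by (subst integral_coordinate) auto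

lemma integrable_product_coordinates: "integrable M (\<lambda>\<omega>. \<omega> i * \<omega> j)"
proof (rule Bochner_Integration.integrable_bound)
  show "integrable M (\<lambda>\<omega>. (\<omega> i)\<^sup>2 + (\<omega> j)\<^sup>2)"
    by (intro Bochner_Integration.integrable_add integrable_square_coordinate)
  have "\<bar>x * y\<bar> \<le> x\<^sup>2 + y\<^sup>2" for x y :: real
  proof -
    have "0 \<le> (\<bar>x\<bar> - \<bar>y\<bar>)\<^sup>2" by simp
    then have "2 * \<bar>x * y\<bar> \<le> x\<^sup>2 + y\<^sup>2" by (simp add: power2_diff abs_mult)
    then show ?thesis by (smt (verit) abs_ge_zero)
  qed
  then show "AE \<omega> in M. norm (\<omega> i * \<omega> j) \<le> norm ((\<omega> i)\<^sup>2 + (\<omega> j)\<^sup>2)"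
    by simp
qed measurable

lemma integral_product_coordinates: "(\<integral>\<omega>. \<omega> i * \<omega> j \<partial>M) = (if i = j then 1 else 0)"
proof (cases "i = j")
  case True
  then show ?thesis using integral_square_coordinate[of j] by (simp add: power2_eq_square)
next
  case False
  have "(\<integral>\<omega>. \<omega> i * \<omega> j \<partial>M) = 0"
    by (rule integral_odd[where s = "\<lambda>k. k = i"]) (use False in \<open>auto simp: flip_apply\<close>)
  then show ?thesis using False by simp
qed

lemma integrable_coordinate_id: "integrable M (\<lambda>\<omega>. \<omega> j)"
  by (rule square_integrable_imp_integrable) (simp_all add: integrable_square_coordinate)

subsection \<open>Linear processes\<close>

text \<open>A one-sided moving average whose newest coordinate is at p. Where the series diverges,
  \<open>suminf\<close> has an unspecified value, hence the guards \<open>converges_at\<close> and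
  \<open>good\<close> in pointwise statements.\<close>

definition lin :: "int \<Rightarrow> (nat \<Rightarrow> real) \<Rightarrow> (int \<Rightarrow> real) \<Rightarrow> real" where
  "lin p c \<omega> = (\<Sum>l. c l * \<omega> (p - int l))"

text \<open>Squares make the condition invariant under all sign changes. By |x| \<le> 1 + x^2 it
  implies, for absolutely summable c, absolute convergence of the series in
  \<open>lin\<close>.\<close>

definition converges_at :: "int \<Rightarrow> (nat \<Rightarrow> real) \<Rightarrow> (int \<Rightarrow> real) \<Rightarrow> bool" where
  "converges_at p c \<omega> \<longleftrightarrow> summable (\<lambda>l. \<bar>c l\<bar> * (\<omega> (p - int l))\<^sup>2)"

lemma converges_at_flip [simp]: "converges_at p c (flip s \<omega>) = converges_at p c \<omega>"
proof -
  have "(flip s \<omega> j)\<^sup>2 = (\<omega> j)\<^sup>2" for j by (simp add: flip_def)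
  then show ?thesis by (simp add: converges_at_def)
qed

lemma measurable_lin [measurable]: "lin p c \<in> borel_measurable M"
  unfolding lin_def by measurable

lemma summable_lin:
  assumes "summable (\<lambda>l. \<bar>c l\<bar>)" "converges_at p c \<omega>"
  shows "summable (\<lambda>l. c l * \<omega> (p - int l))"
proof (rule summable_comparison_test')
  show "summable (\<lambda>l. \<bar>c l\<bar> + \<bar>c l\<bar> * (\<omega> (p - int l))\<^sup>2)"
    using assms unfolding converges_at_def by (rule summable_add)
  have x: "\<bar>x\<bar> \<le> 1 + x\<^sup>2" for x :: real
  proof -
    have "0 \<le> (\<bar>x\<bar> - 1)\<^sup>2" by simp
    then have "2 * \<bar>x\<bar> \<le> x\<^sup>2 + 1" by (simp add: power2_diff)
    then show ?thesis by (smt (verit) abs_ge_zero)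
  qed
  show "norm (c l * \<omega> (p - int l)) \<le> \<bar>c l\<bar> + \<bar>c l\<bar> * (\<omega> (p - int l))\<^sup>2" for l
    using mult_left_mono[OF x[of "\<omega> (p - int l)"], of "\<bar>c l\<bar>"] by (simp add: abs_mult algebra_simps)
qed

text \<open>The Cauchy-Schwarz majorant, with weights |c l|, for the squares of all partial sums of
  the series in \<open>lin\<close>; it is the dominating function for the limits below.\<close>

definition square_bound :: "int \<Rightarrow> (nat \<Rightarrow> real) \<Rightarrow> (int \<Rightarrow> real) \<Rightarrow> real" where
  "square_bound p c \<omega> = (\<Sum>l. \<bar>c l\<bar>) * (\<Sum>l. \<bar>c l\<bar> * (\<omega> (p - int l))\<^sup>2)"

text \<open>By monotone convergence and unit variance the series of squares has the finite
  expectation \<Sum> |c l|, so it is finite almost everywhere.\<close>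

lemma AE_converges_at:
  assumes "summable (\<lambda>l. \<bar>c l\<bar>)"
  shows "AE \<omega> in M. converges_at p c \<omega>"
proof -
  have "(\<integral>\<^sup>+\<omega>. (\<Sum>l. ennreal (\<bar>c l\<bar> * (\<omega> (p - int l))\<^sup>2)) \<partial>M)
      = (\<Sum>l. \<integral>\<^sup>+\<omega>. ennreal (\<bar>c l\<bar> * (\<omega> (p - int l))\<^sup>2) \<partial>M)"
    by (intro nn_integral_suminf) measurable
  also have "\<dots> = (\<Sum>l. ennreal \<bar>c l\<bar>)"
  proof (rule suminf_cong)
    fix l
    have "(\<integral>\<^sup>+\<omega>. ennreal (\<bar>c l\<bar> * (\<omega> (p - int l))\<^sup>2) \<partial>M) = ennreal (\<integral>\<omega>. \<bar>c l\<bar> * (\<omega> (p - int l))\<^sup>2 \<partial>M)"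
      by (intro nn_integral_eq_integral) (auto simp: integrable_square_coordinate)
    then show "(\<integral>\<^sup>+\<omega>. ennreal (\<bar>c l\<bar> * (\<omega> (p - int l))\<^sup>2) \<partial>M) = ennreal \<bar>c l\<bar>"
      by (simp add: integral_square_coordinate)
  qed
  also have "\<dots> = ennreal (\<Sum>l. \<bar>c l\<bar>)"
    using assms by (intro suminf_ennreal2) auto
  finally have "(\<integral>\<^sup>+\<omega>. (\<Sum>l. ennreal (\<bar>c l\<bar> * (\<omega> (p - int l))\<^sup>2)) \<partial>M) \<noteq> \<infinity>" by simp
  then have "AE \<omega> in M. (\<Sum>l. ennreal (\<bar>c l\<bar> * (\<omega> (p - int l))\<^sup>2)) \<noteq> \<infinity>"
    by (intro nn_integral_PInf_AE) measurable
  then show ?thesis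
  proof eventually_elim
    case (elim \<omega>)
    then show ?case
      unfolding converges_at_def by (intro summable_suminf_not_top) auto
  qed
qed

lemma integrable_square_bound:
  assumes "summable (\<lambda>l. \<bar>c l\<bar>)"
  shows "integrable M (square_bound p c)"
  unfolding square_bound_def
proof (rule integrable_mult_right, rule integrable_suminf)
  show "integrable M (\<lambda>\<omega>. \<bar>c l\<bar> * (\<omega> (p - int l))\<^sup>2)" for l
    by (simp add: integrable_square_coordinate)
  show "AE \<omega> in M. summable (\<lambda>l. norm (\<bar>c l\<bar> * (\<omega> (p - int l))\<^sup>2))"
    using AE_converges_at[OF assms, of p] by (simp add: converges_at_def abs_mult)
  show "summable (\<lambda>l. \<integral>\<omega>. norm (\<bar>c l\<bar> * (\<omega> (p - int l))\<^sup>2) \<partial>M)"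
    using assms by (simp add: abs_mult integral_square_coordinate)
qed

lemma square_bound_ge_partial:
  assumes "summable (\<lambda>l. \<bar>c l\<bar>)" "converges_at p c \<omega>"
  shows "(\<Sum>l<N. c l * \<omega> (p - int l))\<^sup>2 \<le> square_bound p c \<omega>"
proof -
  let ?x = "\<lambda>l. \<omega> (p - int l)"
  \<comment> \<open>Each coefficient is split as sqrt |c l| times sqrt |c l| times its sign, so that
    both Cauchy-Schwarz factors carry the weight |c l|.\<close>
  have "(\<Sum>l<N. c l * ?x l)\<^sup>2 = (\<Sum>l<N. sqrt \<bar>c l\<bar> * (sqrt \<bar>c l\<bar> * (sgn (c l) * ?x l)))\<^sup>2"
    by (simp add: mult.assoc[symmetric] abs_mult_sgn)
  also have "\<dots> \<le> (\<Sum>l<N. (sqrt \<bar>c l\<bar>)\<^sup>2) * (\<Sum>l<N. (sqrt \<bar>c l\<bar> * (sgn (c l) * ?x l))\<^sup>2)"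
    by (rule Cauchy_Schwarz_ineq_sum)
  also have "(\<Sum>l<N. (sqrt \<bar>c l\<bar> * (sgn (c l) * ?x l))\<^sup>2) = (\<Sum>l<N. \<bar>c l\<bar> * (?x l)\<^sup>2)"
    by (intro sum.cong refl) (auto simp: power_mult_distrib sgn_if)
  also have "(\<Sum>l<N. (sqrt \<bar>c l\<bar>)\<^sup>2) * (\<Sum>l<N. \<bar>c l\<bar> * (?x l)\<^sup>2) \<le> square_bound p c \<omega>"
    unfolding square_bound_def using assms
    by (intro mult_mono) (auto simp: converges_at_def intro!: sum_le_suminf sum_nonneg suminf_nonneg)
  finally show ?thesis .
qed

lemma partial_tendsto_lin:
  assumes "summable (\<lambda>l. \<bar>c l\<bar>)" "converges_at p c \<omega>"
  shows "(\<lambda>N. \<Sum>l<N. c l * \<omega> (p - int l)) \<longlonglongrightarrow> lin p c \<omega>"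
  unfolding lin_def by (rule summable_LIMSEQ[OF summable_lin[OF assms]])

lemma square_bound_ge_lin:
  assumes "summable (\<lambda>l. \<bar>c l\<bar>)" "converges_at p c \<omega>"
  shows "(lin p c \<omega>)\<^sup>2 \<le> square_bound p c \<omega>"
  using tendsto_power[OF partial_tendsto_lin[OF assms], of 2] square_bound_ge_partial[OF assms]
  by (intro LIMSEQ_le_const2) auto

lemma integrable_lin_square:
  assumes "summable (\<lambda>l. \<bar>c l\<bar>)"
  shows "integrable M (\<lambda>\<omega>. (lin p c \<omega>)\<^sup>2)"
proof (rule Bochner_Integration.integrable_bound[OF integrable_square_bound[OF assms, of p]])
  show "AE \<omega> in M. norm ((lin p c \<omega>)\<^sup>2) \<le> norm (square_bound p c \<omega>)"
    using AE_converges_at[OF assms, of p]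
  proof eventually_elim
    case (elim \<omega>)
    then show ?case using square_bound_ge_lin[OF assms elim] by simp
  qed
qed measurable

lemma integrable_lin:
  assumes "summable (\<lambda>l. \<bar>c l\<bar>)"
  shows "integrable M (lin p c)"
  by (rule square_integrable_imp_integrable[OF measurable_lin integrable_lin_square[OF assms]])

lemma integral_partial_square:
  "(\<integral>\<omega>. (\<Sum>l<N. c l * \<omega> (p - int l))\<^sup>2 \<partial>M) = (\<Sum>l<N. (c l)\<^sup>2)"
proof -
  have "(\<integral>\<omega>. (\<Sum>l<N. c l * \<omega> (p - int l))\<^sup>2 \<partial>M)
      = (\<integral>\<omega>. (\<Sum>l<N. \<Sum>k<N. c l * c k * (\<omega> (p - int l) * \<omega> (p - int k))) \<partial>M)"
    by (simp add: power2_eq_square sum_product mult_ac)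
  also have "\<dots> = (\<Sum>l<N. \<Sum>k<N. c l * c k * (\<integral>\<omega>. \<omega> (p - int l) * \<omega> (p - int k) \<partial>M))"
    by (simp add: Bochner_Integration.integral_sum Bochner_Integration.integrable_sum integrable_product_coordinates)
  also have "\<dots> = (\<Sum>l<N. (c l)\<^sup>2)"
    by (intro sum.cong refl) (simp add: integral_product_coordinates power2_eq_square if_distrib sum.delta cong: if_cong)
  finally show ?thesis .
qed

lemma integral_lin_square:
  assumes "summable (\<lambda>l. \<bar>c l\<bar>)"
  shows "(\<integral>\<omega>. (lin p c \<omega>)\<^sup>2 \<partial>M) = (\<Sum>l. (c l)\<^sup>2)"
proof -
  have "(\<lambda>N. \<integral>\<omega>. (\<Sum>l<N. c l * \<omega> (p - int l))\<^sup>2 \<partial>M) \<longlonglongrightarrow> (\<integral>\<omega>. (lin p c \<omega>)\<^sup>2 \<partial>M)"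
  proof (rule integral_dominated_convergence[where w = "square_bound p c"])
    show "AE \<omega> in M. (\<lambda>N. (\<Sum>l<N. c l * \<omega> (p - int l))\<^sup>2) \<longlonglongrightarrow> (lin p c \<omega>)\<^sup>2"
      using AE_converges_at[OF assms, of p]
      by eventually_elim (intro tendsto_power partial_tendsto_lin assms)
    show "AE \<omega> in M. norm ((\<Sum>l<N. c l * \<omega> (p - int l))\<^sup>2) \<le> square_bound p c \<omega>" for N
      using AE_converges_at[OF assms, of p]
      by eventually_elim (simp add: square_bound_ge_partial assms)
  qed (auto simp: integrable_square_bound assms)
  then have "(\<lambda>N. \<Sum>l<N. (c l)\<^sup>2) \<longlonglongrightarrow> (\<integral>\<omega>. (lin p c \<omega>)\<^sup>2 \<partial>M)"
    by (simp add: integral_partial_square)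
  moreover have "(\<lambda>N. \<Sum>l<N. (c l)\<^sup>2) \<longlonglongrightarrow> (\<Sum>l. (c l)\<^sup>2)"
    by (rule summable_LIMSEQ[OF summable_square_coeff[OF assms]])
  ultimately show ?thesis by (rule LIMSEQ_unique)
qed

lemma L2_norm_lin: "summable (\<lambda>l. \<bar>c l\<bar>) \<Longrightarrow> L2_norm M (lin p c) = sqrt (\<Sum>l. (c l)\<^sup>2)"
  by (simp add: L2_norm_def integral_lin_square)

lemma lin_split:
  assumes "summable (\<lambda>l. \<bar>c l\<bar>)" "converges_at p c \<omega>"
  shows "lin p c \<omega> = (\<Sum>l<r. c l * \<omega> (p - int l)) + lin (p - int r) (\<lambda>l. c (l + r)) \<omega>"
  unfolding lin_def using suminf_split_initial_segment[OF summable_lin[OF assms], of r]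
  by (simp add: algebra_simps)

text \<open>The remainder is again a moving average, so its norm is the square root of the tail of
  the series of squared coefficients.\<close>

lemma tendsto_partial_lin_L2:
  assumes "summable (\<lambda>l. \<bar>c l\<bar>)"
  shows "(\<lambda>N. L2_norm M (\<lambda>\<omega>. lin p c \<omega> - (\<Sum>l<N. c l * \<omega> (p - int l)))) \<longlonglongrightarrow> 0"
proof -
  have "L2_norm M (\<lambda>\<omega>. lin p c \<omega> - (\<Sum>l<N. c l * \<omega> (p - int l)))
      = sqrt (\<Sum>l. (c (l + N))\<^sup>2)" for N
  proof -
    have "(\<integral>\<omega>. (lin p c \<omega> - (\<Sum>l<N. c l * \<omega> (p - int l)))\<^sup>2 \<partial>M)
        = (\<integral>\<omega>. (lin (p - int N) (\<lambda>l. c (l + N)) \<omega>)\<^sup>2 \<partial>M)"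
    proof (rule integral_cong_AE)
      show "AE \<omega> in M. (lin p c \<omega> - (\<Sum>l<N. c l * \<omega> (p - int l)))\<^sup>2 = (lin (p - int N) (\<lambda>l. c (l + N)) \<omega>)\<^sup>2"
        using AE_converges_at[OF assms, of p]
        by eventually_elim (simp add: lin_split[OF assms, of p _ N])
    qed measurable
    then show ?thesis
      using integral_lin_square[OF summable_shift_coeff[OF assms], of "p - int N" N] by (simp add: L2_norm_def)
  qed
  moreover have "(\<lambda>N. sqrt (\<Sum>l. (c (l + N))\<^sup>2)) \<longlonglongrightarrow> sqrt 0"
  proof (intro tendsto_real_sqrt)
    have "(\<lambda>N. (\<Sum>l. (c l)\<^sup>2) - (\<Sum>l<N. (c l)\<^sup>2)) \<longlonglongrightarrow> (\<Sum>l. (c l)\<^sup>2) - (\<Sum>l. (c l)\<^sup>2)"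
      by (intro tendsto_intros summable_LIMSEQ summable_square_coeff assms)
    then show "(\<lambda>N. \<Sum>l. (c (l + N))\<^sup>2) \<longlonglongrightarrow> 0"
      using suminf_minus_initial_segment[OF summable_square_coeff[OF assms]] by simp
  qed
  ultimately show ?thesis by simp
qed

lemma measurable_F_lin:
  assumes "p \<le> q"
  shows "lin p c \<in> borel_measurable (F q)"
proof (rule measurable_FI)
  fix s \<omega> assume "\<And>j. j \<le> q \<Longrightarrow> \<not> s j"
  then have "flip s \<omega> (p - int l) = \<omega> (p - int l)" for l
    using assms by (simp add: flip_def)
  then show "lin p c (flip s \<omega>) = lin p c \<omega>" by (simp add: lin_def)
qed (rule measurable_lin)

lemma set_integrable_coordinate:
  assumes "A \<in> sets M"
  shows "set_integrable M A (\<lambda>\<omega>. c * \<omega> j)"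
  unfolding set_integrable_def
  by (intro integrable_mult_indicator assms Bochner_Integration.integrable_mult_right integrable_coordinate_id)

lemma
  assumes "A \<in> sets M"
  shows set_integrable_partial: "set_integrable M A (\<lambda>\<omega>. \<Sum>l<N. c l * \<omega> (p - int l))"
    and set_integral_partial: "(\<integral>\<omega>\<in>A. (\<Sum>l<N. c l * \<omega> (p - int l)) \<partial>M) = (\<Sum>l<N. c l * (\<integral>\<omega>\<in>A. \<omega> (p - int l) \<partial>M))"
proof -
  have i: "integrable M (\<lambda>\<omega>. indicat_real A \<omega> *\<^sub>R (c l * \<omega> (p - int l)))" for l
    using set_integrable_coordinate[OF assms] by (simp add: set_integrable_def)
  show "set_integrable M A (\<lambda>\<omega>. \<Sum>l<N. c l * \<omega> (p - int l))"
    unfolding set_integrable_def scaleR_sum_right by (intro Bochner_Integration.integrable_sum i)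
  have "(\<integral>\<omega>\<in>A. (\<Sum>l<N. c l * \<omega> (p - int l)) \<partial>M) = (\<Sum>l<N. \<integral>\<omega>\<in>A. c l * \<omega> (p - int l) \<partial>M)"
    unfolding set_lebesgue_integral_def scaleR_sum_right by (intro Bochner_Integration.integral_sum i)
  then show "(\<integral>\<omega>\<in>A. (\<Sum>l<N. c l * \<omega> (p - int l)) \<partial>M) = (\<Sum>l<N. c l * (\<integral>\<omega>\<in>A. \<omega> (p - int l) \<partial>M))"
    by simp
qed

text \<open>The martingale difference property for the enlarged past: reversing the sign at j alone
  fixes A and changes the sign of the integrand.\<close>

lemma set_integral_coordinate_zero:
  assumes "A \<in> sets (F q)" "q < j"
  shows "(\<integral>\<omega>\<in>A. \<omega> j \<partial>M) = 0"
  unfolding set_lebesgue_integral_def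
proof (rule integral_odd[where s = "\<lambda>k. k = j"])
  have A: "A \<in> sets M" using assms by (simp add: sets_F)
  then show "(\<lambda>\<omega>. indicator A \<omega> *\<^sub>R \<omega> j) \<in> borel_measurable M" by measurable
  have "flip (\<lambda>k. k = j) -` A = A"
    using assms by (auto simp: sets_F)
  then have "indicator A (flip (\<lambda>k. k = j) \<omega>) = (indicator A \<omega> :: real)" for \<omega>
    by (metis indicator_vimage)
  then show "indicator A (flip (\<lambda>k. k = j) \<omega>) *\<^sub>R flip (\<lambda>k. k = j) \<omega> j = - (indicator A \<omega> *\<^sub>R \<omega> j)" for \<omega>
    by (simp add: flip_apply)
qed

lemma set_integral_lin:
  assumes "summable (\<lambda>l. \<bar>c l\<bar>)" "A \<in> sets (F (p - int r))"
  shows "(\<integral>\<omega>\<in>A. lin p c \<omega> \<partial>M) = (\<integral>\<omega>\<in>A. lin (p - int r) (\<lambda>l. c (l + r)) \<omega> \<partial>M)"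
proof -
  have A [measurable]: "A \<in> sets M" using assms(2) by (simp add: sets_F)
  have "(\<integral>\<omega>\<in>A. lin p c \<omega> \<partial>M) = (\<integral>\<omega>\<in>A. (\<Sum>l<r. c l * \<omega> (p - int l)) + lin (p - int r) (\<lambda>l. c (l + r)) \<omega> \<partial>M)"
    unfolding set_lebesgue_integral_def
  proof (rule integral_cong_AE)
    show "AE \<omega> in M. indicat_real A \<omega> *\<^sub>R lin p c \<omega>
        = indicat_real A \<omega> *\<^sub>R ((\<Sum>l<r. c l * \<omega> (p - int l)) + lin (p - int r) (\<lambda>l. c (l + r)) \<omega>)"
      using AE_converges_at[OF assms(1), of p]
      by eventually_elim (simp add: lin_split[OF assms(1), of p _ r])
  qed measurable
  also have "\<dots> = (\<integral>\<omega>\<in>A. (\<Sum>l<r. c l * \<omega> (p - int l)) \<partial>M)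
      + (\<integral>\<omega>\<in>A. lin (p - int r) (\<lambda>l. c (l + r)) \<omega> \<partial>M)"
  proof (rule set_integral_add)
    show "set_integrable M A (\<lambda>\<omega>. \<Sum>l<r. c l * \<omega> (p - int l))"
      by (rule set_integrable_partial[OF A])
    show "set_integrable M A (lin (p - int r) (\<lambda>l. c (l + r)))"
      unfolding set_integrable_def using integrable_lin[OF summable_shift_coeff[OF assms(1)]] A
      by (rule integrable_mult_indicator[rotated])
  qed
  also have "(\<integral>\<omega>\<in>A. (\<Sum>l<r. c l * \<omega> (p - int l)) \<partial>M) = (\<Sum>l<r. c l * (\<integral>\<omega>\<in>A. \<omega> (p - int l) \<partial>M))"
    by (rule set_integral_partial[OF A])
  also have "\<dots> = 0"
    using assms(2) by (intro sum.neutral) (auto intro!: set_integral_coordinate_zero)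
  finally show ?thesis by simp
qed

text \<open>The r newest terms lie after the conditioning position and average to 0 on its events;
  the remaining series is measurable there.\<close>

lemma cond_exp_lin:
  assumes "summable (\<lambda>l. \<bar>c l\<bar>)"
  shows "AE \<omega> in M. real_cond_exp M (F (p - int r)) (lin p c) \<omega> = lin (p - int r) (\<lambda>l. c (l + r)) \<omega>"
proof -
  interpret sigma_finite_subalgebra M "F (p - int r)" by (rule sigma_finite_subalgebra_F)
  show ?thesis
    by (rule real_cond_exp_charact)
       (auto simp: set_integral_lin assms integrable_lin summable_shift_coeff measurable_F_lin)
qed

lemma sets_tail_algebra: "sets (tail_algebra M F) = (\<Inter>i. sets (F i))"
proof -
  have "sigma_sets UNIV (\<Inter>i. sets (F i)) \<subseteq> sets (F i)" for i
    using sets.sigma_sets_subset[of "\<Inter>i. sets (F i)" "F i"] by auto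
  moreover have "sets (tail_algebra M F) = sigma_sets UNIV (\<Inter>i. sets (F i))"
    unfolding tail_algebra_def by simp
  ultimately show ?thesis by auto
qed

text \<open>The tail contains the absolute values of all coordinates, so it is in general not
  trivial and no zero-one law applies. But a tail event is invariant under the reversal of each
  single sign, so every finite partial sum integrates to 0 over it, and dominated convergence gives
  the series.\<close>

lemma cond_exp_lin_tail:
  assumes "summable (\<lambda>l. \<bar>c l\<bar>)"
  shows "AE \<omega> in M. real_cond_exp M (tail_algebra M F) (lin p c) \<omega> = 0"
proof -
  have "subalgebra M (tail_algebra M F)"
    unfolding subalgebra_def sets_tail_algebra by (auto simp: tail_algebra_def sets_F)
  then interpret finite_measure_subalgebra M "tail_algebra M F" by unfold_locales
  show ?thesis
  proof (rule real_cond_exp_charact)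
    fix A assume "A \<in> sets (tail_algebra M F)"
    then have A: "A \<in> sets (F i)" for i by (simp add: sets_tail_algebra)
    then have AM [measurable]: "A \<in> sets M" by (simp add: sets_F)
    have "(\<lambda>N. \<integral>\<omega>. indicator A \<omega> *\<^sub>R (\<Sum>l<N. c l * \<omega> (p - int l)) \<partial>M) \<longlonglongrightarrow> (\<integral>\<omega>. indicator A \<omega> *\<^sub>R lin p c \<omega> \<partial>M)"
    proof (rule integral_dominated_convergence[where w = "\<lambda>\<omega>. 1 + square_bound p c \<omega>"])
      show "integrable M (\<lambda>\<omega>. 1 + square_bound p c \<omega>)"
        using integrable_square_bound[OF assms] by simp
      show "AE \<omega> in M. (\<lambda>N. indicat_real A \<omega> *\<^sub>R (\<Sum>l<N. c l * \<omega> (p - int l))) \<longlonglongrightarrow> indicat_real A \<omega> *\<^sub>R lin p c \<omega>"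
        using AE_converges_at[OF assms, of p]
        by eventually_elim (intro tendsto_scaleR tendsto_const partial_tendsto_lin assms)
      show "AE \<omega> in M. norm (indicat_real A \<omega> *\<^sub>R (\<Sum>l<N. c l * \<omega> (p - int l))) \<le> 1 + square_bound p c \<omega>" for N
        using AE_converges_at[OF assms, of p]
      proof eventually_elim
        case (elim \<omega>)
        let ?x = "\<Sum>l<N. c l * \<omega> (p - int l)"
        have "0 \<le> (\<bar>?x\<bar> - 1)\<^sup>2" by simp
        then have "2 * \<bar>?x\<bar> \<le> ?x\<^sup>2 + 1" by (simp add: power2_diff)
        then have "\<bar>?x\<bar> \<le> 1 + ?x\<^sup>2" by (smt (verit) abs_ge_zero)
        then show ?case
          using square_bound_ge_partial[OF assms elim, of N] zero_le_power2[of ?x]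
          by (auto simp: indicator_def)
      qed
    qed measurable
    moreover have "(\<integral>\<omega>. indicator A \<omega> *\<^sub>R (\<Sum>l<N. c l * \<omega> (p - int l)) \<partial>M) = 0" for N
    proof -
      have "(\<integral>\<omega>\<in>A. (\<Sum>l<N. c l * \<omega> (p - int l)) \<partial>M) = (\<Sum>l<N. c l * (\<integral>\<omega>\<in>A. \<omega> (p - int l) \<partial>M))"
        by (rule set_integral_partial[OF AM])
      also have "\<dots> = 0"
        \<comment> \<open>Any position below all those in the partial sum would do;
          \<open>p - int N\<close> is one of them.\<close>
        using A by (intro sum.neutral) (auto intro!: set_integral_coordinate_zero[of A "p - int N"])
      finally show ?thesis by (simp add: set_lebesgue_integral_def)
    qed
    ultimately show "(\<integral>\<omega>\<in>A. lin p c \<omega> \<partial>M) = (\<integral>\<omega>\<in>A. 0 \<partial>M)"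
      by (simp add: set_lebesgue_integral_def LIMSEQ_const_iff)
  qed (auto simp: integrable_lin assms)
qed

lemma coordinate_L2_ominus: "(\<lambda>\<omega>. \<omega> i) \<in> L2_ominus M (F i) (F (i - 1))"
  unfolding L2_ominus_def
proof (intro CollectI conjI ballI)
  show "(\<lambda>\<omega>. \<omega> i) \<in> L2_on M (F i)"
    unfolding L2_on_def using integrable_square_coordinate
    by (auto intro!: measurable_FI simp: flip_apply)
  fix k assume k: "k \<in> L2_on M (F (i - 1))"
  then have "k \<in> borel_measurable M" by (auto simp: L2_on_def intro: measurable_from_subalg[OF subalgebra_F])
  then show "(\<integral>\<omega>. \<omega> i * k \<omega> \<partial>M) = 0"
    using measurable_F_invariant[of k "i - 1" "\<lambda>j. j = i"] k
    by (intro integral_odd[where s = "\<lambda>j. j = i"]) (auto simp: flip_apply L2_on_def)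
qed

end

section \<open>Coefficients of the partial sums\<close>

locale decreasing_weights = unit_variance_sequence +
  fixes b :: "nat \<Rightarrow> real"
  assumes decseq_b: "decseq b" and b_tendsto_0: "b \<longlonglongrightarrow> 0" and b_0_pos: "0 < b 0"
begin

lemma b_nonneg: "0 \<le> b n"
  using decseq_ge[OF decseq_b b_tendsto_0] .

lemma b_mono: "m \<le> n \<Longrightarrow> b n \<le> b m"
  using decseq_b by (rule decseqD)

text \<open>The weights are the increments of \<open>0, b 0, b 1, \<dots>\<close>, so that their partial sums are the \<open>b n\<close>.\<close>

definition B :: "nat \<Rightarrow> real" where
  "B n = (case n of 0 \<Rightarrow> 0 | Suc k \<Rightarrow> b k)"

definition a :: "nat \<Rightarrow> real" where
  "a i = B (Suc i) - B i"

text \<open>The coefficient of the coordinate at n - 1 - l in \<open>S n\<close>. The subtraction in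
  \<open>Suc l - n\<close> is truncated: for l < n it gives \<open>B 0 = 0\<close>, and the
  coefficient is \<open>b l\<close>.\<close>

definition c :: "nat \<Rightarrow> nat \<Rightarrow> real" where
  "c n l = B (Suc l) - B (Suc l - n)"

text \<open>In the variance of \<open>S n\<close>, \<open>V n\<close> is the share of the positions
  0 to n - 1 and \<open>W n\<close> that of the negative ones. Position 0 is known to
  \<open>F 0\<close>, which causes the off-by-one between \<open>V n\<close> and the variance of
  \<open>S n - ES n\<close>.\<close>

definition V :: "nat \<Rightarrow> real" where
  "V n = (\<Sum>l<n. (b l)\<^sup>2)"

definition W :: "nat \<Rightarrow> real" where
  "W n = (\<Sum>l. (b l - b (l + n))\<^sup>2)"

lemma c_0: "c 0 l = 0"
  by (simp add: c_def)

lemma c_Suc: "c (Suc n) l = a l + (case l of 0 \<Rightarrow> 0 | Suc k \<Rightarrow> c n k)"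
  by (simp add: c_def a_def B_def split: nat.split)

lemma c_less: "l < n \<Longrightarrow> c n l = b l"
  by (simp add: c_def B_def)

lemma c_ge: "c n (l + n) = b (l + n) - b l"
  by (simp add: c_def B_def Suc_diff_le)

text \<open>All coefficients after the first have the same sign, so the absolute series telescopes.
  This is also the Hannan condition, since \<open>P_0\<close> of the i-th term has norm |a
  i|.\<close>

lemma summable_a: "summable (\<lambda>l. \<bar>a l\<bar>)"
proof -
  have "summable (\<lambda>l. b l - b (Suc l))"
    using telescope_summable'[OF b_tendsto_0] .
  moreover have "\<bar>a (Suc l)\<bar> = b l - b (Suc l)" for l
    using b_mono[of l "Suc l"] by (simp add: a_def B_def)
  ultimately show ?thesis by (subst summable_Suc_iff[symmetric]) simp
qed

lemma summable_c: "summable (\<lambda>l. \<bar>c n l\<bar>)"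
proof (induction n)
  case (Suc n)
  have "summable (\<lambda>l. \<bar>case l of 0 \<Rightarrow> 0 | Suc k \<Rightarrow> c n k\<bar>)"
    using Suc by (subst summable_Suc_iff[symmetric]) simp
  then have "summable (\<lambda>l. \<bar>a l\<bar> + \<bar>case l of 0 \<Rightarrow> 0 | Suc k \<Rightarrow> c n k\<bar>)"
    by (intro summable_add summable_a)
  then show ?case
    by (rule summable_comparison_test'[where N = 0]) (simp add: c_Suc abs_triangle_ineq)
qed (simp add: c_0)

lemma summable_W: "summable (\<lambda>l. (b l - b (l + n))\<^sup>2)"
  using summable_square_coeff[OF summable_shift_coeff[OF summable_c[of n], of n]]
  by (simp add: c_ge power2_commute)

lemma W_nonneg: "0 \<le> W n"
  unfolding W_def using summable_W by (rule suminf_nonneg) simp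

lemma V_nonneg: "0 \<le> V n"
  by (simp add: V_def sum_nonneg)

lemma V_mono: "m \<le> n \<Longrightarrow> V m \<le> V n"
  unfolding V_def by (rule sum_mono2) auto

lemma V_pos: "0 < n \<Longrightarrow> 0 < V n"
  using member_le_sum[of 0 "{..<n}" "\<lambda>l. (b l)\<^sup>2"] less_le_trans[OF zero_less_power[OF b_0_pos, of 2]]
  by (simp add: V_def)

lemma sum_c_square: "(\<Sum>l. (c n l)\<^sup>2) = V n + W n"
proof -
  have "(\<Sum>l. (c n l)\<^sup>2) = (\<Sum>l. (c n (l + n))\<^sup>2) + (\<Sum>l<n. (c n l)\<^sup>2)"
    by (rule suminf_split_initial_segment[OF summable_square_coeff[OF summable_c]])
  then show ?thesis by (simp add: V_def W_def c_ge c_less power2_commute)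
qed

text \<open>Since \<open>b l\<close> decreases, \<open>(b l - b (l + n))\<^sup>2 \<le> (b l)\<^sup>2 - (b (l + n))\<^sup>2\<close>, and the right-hand side telescopes.\<close>

lemma W_le_V: "W n \<le> V n"
  unfolding W_def
proof (rule suminf_le_const[OF summable_W])
  fix N
  have sq: "(x - y)\<^sup>2 \<le> x\<^sup>2 - y\<^sup>2" if "0 \<le> y" "y \<le> x" for x y :: real
    using mult_left_mono[OF that(2,1)] by (simp add: power2_eq_square algebra_simps)
  have "(\<Sum>l<N. (b l - b (l + n))\<^sup>2) \<le> (\<Sum>l<N. (b l)\<^sup>2 - (b (l + n))\<^sup>2)"
    by (intro sum_mono sq b_nonneg b_mono) simp
  also have "\<dots> = V N - (\<Sum>l<N. (b (l + n))\<^sup>2)"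
    by (simp add: V_def sum_subtractf)
  also have "(\<Sum>l<N. (b (l + n))\<^sup>2) = V (n + N) - V n"
  proof -
    have "V (n + N) = V n + (\<Sum>l<N. (b (l + n))\<^sup>2)"
      unfolding V_def by (induction N) (simp_all add: add.commute)
    then show ?thesis by simp
  qed
  also have "V N - (V (n + N) - V n) \<le> V n"
    using V_mono[of N "n + N"] by simp
  finally show "(\<Sum>l<N. (b l - b (l + n))\<^sup>2) \<le> V n" .
qed

text \<open>The first m weights are bounded by \<open>b 0\<close> and the others by
  \<open>b m\<close>; for m near sqrt n this is sharp enough when b decays logarithmically.\<close>

lemma V_le: "m \<le> n \<Longrightarrow> V n \<le> real m * (b 0)\<^sup>2 + real n * (b m)\<^sup>2"
proof -
  assume "m \<le> n"
  then have "V n = (\<Sum>l<m. (b l)\<^sup>2) + (\<Sum>l=m..<n. (b l)\<^sup>2)"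
    unfolding V_def by (metis atLeast0LessThan sum.atLeastLessThan_concat zero_le)
  also have "(\<Sum>l<m. (b l)\<^sup>2) \<le> (\<Sum>l<m. (b 0)\<^sup>2)"
    by (intro sum_mono power_mono b_mono b_nonneg) simp
  also have "(\<Sum>l=m..<n. (b l)\<^sup>2) \<le> (\<Sum>l=m..<n. (b m)\<^sup>2)"
    by (intro sum_mono power_mono b_mono b_nonneg) simp
  also have "\<dots> \<le> real n * (b m)\<^sup>2"
    by (simp add: mult_right_mono)
  finally show ?thesis by simp
qed

lemma V_ge: "real n * (b n)\<^sup>2 \<le> V n"
proof -
  have "(\<Sum>l<n. (b n)\<^sup>2) \<le> V n"
    unfolding V_def by (intro sum_mono power_mono b_mono b_nonneg) simp
  then show ?thesis by simp
qed

subsection \<open>The process and its partial sums\<close>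

definition f :: "(int \<Rightarrow> real) \<Rightarrow> real" where
  "f = lin 0 a"

definition S :: "nat \<Rightarrow> (int \<Rightarrow> real) \<Rightarrow> real" where
  "S = partial_sum left_shift f"

text \<open>A set of full measure that is invariant under sign changes. The identities for
  \<open>S n\<close> must hold at every point of the orbit of a given \<omega>, because the orbit
  may be a null set for \<open>M\<close>.\<close>

definition good :: "(int \<Rightarrow> real) \<Rightarrow> bool" where
  "good \<omega> \<longleftrightarrow> (\<forall>p. converges_at p a \<omega>)"

text \<open>The contribution of the positions 1 to n - 1, whose signs are unknown to
  \<open>F 0\<close>.\<close>

definition D :: "nat \<Rightarrow> (int \<Rightarrow> real) \<Rightarrow> real" where
  "D n \<omega> = (\<Sum>l<n - 1. b l * \<omega> (int (n - 1) - int l))"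

text \<open>The contribution of the positions up to 0: an explicit version of the conditional
  expectation of \<open>S n\<close> given \<open>F 0\<close>, whereas \<open>ES n\<close> is the
  version chosen by \<open>real_cond_exp\<close>.\<close>

definition Q :: "nat \<Rightarrow> (int \<Rightarrow> real) \<Rightarrow> real" where
  "Q n = lin 0 (\<lambda>l. c n (l + (n - 1)))"

lemma AE_good: "AE \<omega> in M. good \<omega>"
  unfolding good_def AE_all_countable using AE_converges_at[OF summable_a] by blast

lemma good_flip [simp]: "good (flip s \<omega>) = good \<omega>"
  by (simp add: good_def)

lemma f_left_shift: "f ((left_shift ^^ k) \<omega>) = lin (int k) a \<omega>"
  by (simp add: f_def lin_def left_shift_funpow algebra_simps)

lemma S_eq: "S n \<omega> = (\<Sum>k<n. lin (int k) a \<omega>)"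
  by (simp add: S_def partial_sum_def f_left_shift)

lemma measurable_f [measurable]: "f \<in> borel_measurable M"
  by (simp add: f_def)

lemma measurable_S [measurable]: "S n \<in> borel_measurable M"
  unfolding S_eq[abs_def] by measurable

lemma measurable_D [measurable]: "D n \<in> borel_measurable M"
  unfolding D_def[abs_def] by measurable

lemma measurable_Q [measurable]: "Q n \<in> borel_measurable M"
  unfolding Q_def by measurable

lemma measurable_F_Q: "Q n \<in> borel_measurable (F 0)"
  unfolding Q_def by (rule measurable_F_lin) simp

text \<open>By induction with \<open>c_Suc\<close>: adding a summand moves the newest position by
  one. The position is written \<open>int n - 1\<close>, which is -1 for n = 0, so that the
  induction is uniform.\<close>

lemma c_sums_S:
  assumes "good \<omega>"
  shows "(\<lambda>l. c n l * \<omega> (int n - 1 - int l)) sums S n \<omega>"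
proof (induction n)
  case 0
  then show ?case by (simp add: c_0 S_eq)
next
  case (Suc n)
  have "(\<lambda>l. a l * \<omega> (int n - int l)) sums lin (int n) a \<omega>"
    unfolding lin_def using assms summable_a by (intro summable_sums summable_lin) (auto simp: good_def)
  moreover have "(\<lambda>l. (case l of 0 \<Rightarrow> 0 | Suc k \<Rightarrow> c n k) * \<omega> (int n - int l)) sums S n \<omega>"
  proof (rule sums_Suc_imp)
    have "int n - int (Suc l) = int n - 1 - int l" for l by simp
    then show "(\<lambda>l. (case Suc l of 0 \<Rightarrow> 0 | Suc k \<Rightarrow> c n k) * \<omega> (int n - int (Suc l))) sums S n \<omega>"
      using Suc by (simp only: nat.case)
  qed simp
  ultimately have "(\<lambda>l. a l * \<omega> (int n - int l) + (case l of 0 \<Rightarrow> 0 | Suc k \<Rightarrow> c n k) * \<omega> (int n - int l))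
      sums (lin (int n) a \<omega> + S n \<omega>)"
    by (rule sums_add)
  moreover have "S (Suc n) \<omega> = lin (int n) a \<omega> + S n \<omega>" by (simp add: S_eq)
  moreover have "int (Suc n) - 1 - int l = int n - int l" for l by simp
  ultimately show ?case by (simp only: c_Suc distrib_right)
qed

lemma S_eq_lin:
  assumes "good \<omega>"
  shows "S n \<omega> = lin (int (n - 1)) (c n) \<omega>"
proof (cases "n = 0")
  case True
  then show ?thesis by (simp add: S_eq lin_def c_0)
next
  case False
  then have e: "int n - 1 = int (n - 1)" by simp
  show ?thesis
    using sums_unique[OF c_sums_S[OF assms, of n]] unfolding e lin_def .
qed

lemma S_eq_D_Q:
  assumes "good \<omega>"
  shows "S n \<omega> = D n \<omega> + Q n \<omega>"
proof (cases "n = 0")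
  case True
  then show ?thesis by (simp add: S_eq D_def Q_def lin_def c_0)
next
  case False
  then have e: "int n - 1 = int (n - 1)" by simp
  have s: "(\<lambda>l. c n l * \<omega> (int (n - 1) - int l)) sums S n \<omega>"
    using c_sums_S[OF assms, of n] unfolding e .
  have "S n \<omega> = (\<Sum>l. c n (l + (n - 1)) * \<omega> (int (n - 1) - int (l + (n - 1))))
      + (\<Sum>l<n - 1. c n l * \<omega> (int (n - 1) - int l))"
    unfolding sums_unique[OF s] by (rule suminf_split_initial_segment[OF sums_summable[OF s]])
  also have "(\<Sum>l<n - 1. c n l * \<omega> (int (n - 1) - int l)) = D n \<omega>"
    unfolding D_def by (intro sum.cong) (auto simp: c_less)
  also have "(\<Sum>l. c n (l + (n - 1)) * \<omega> (int (n - 1) - int (l + (n - 1)))) = Q n \<omega>"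
    by (simp add: Q_def lin_def)
  finally show ?thesis by simp
qed

lemma AE_S_eq_lin: "AE \<omega> in M. S n \<omega> = lin (int (n - 1)) (c n) \<omega>"
  using AE_good by eventually_elim (rule S_eq_lin)

lemma AE_S_eq_D_Q: "AE \<omega> in M. S n \<omega> = D n \<omega> + Q n \<omega>"
  using AE_good by eventually_elim (rule S_eq_D_Q)

definition ES :: "nat \<Rightarrow> (int \<Rightarrow> real) \<Rightarrow> real" where
  "ES n = real_cond_exp M (F 0) (S n)"

lemma measurable_F_ES [measurable]: "ES n \<in> borel_measurable (F 0)"
  unfolding ES_def by (rule borel_measurable_cond_exp)

lemma measurable_ES [measurable]: "ES n \<in> borel_measurable M"
  unfolding ES_def by (rule borel_measurable_cond_exp2)

lemma AE_ES: "AE \<omega> in M. ES n \<omega> = Q n \<omega>"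
proof -
  interpret sigma_finite_subalgebra M "F 0" by (rule sigma_finite_subalgebra_F)
  have "AE \<omega> in M. real_cond_exp M (F 0) (S n) \<omega> = real_cond_exp M (F 0) (lin (int (n - 1)) (c n)) \<omega>"
    by (rule real_cond_exp_cong[OF AE_S_eq_lin]) measurable
  with cond_exp_lin[OF summable_c, of "int (n - 1)" "n - 1" n] show ?thesis
    unfolding ES_def by eventually_elim (simp add: Q_def)
qed

text \<open>The conditional expectations at 0 and at -1 differ in the single term at position 0. The
  times appear as \<open>int i - int i\<close> and \<open>int i - int (Suc i)\<close> to fit
  \<open>cond_exp_lin\<close>.\<close>

lemma AE_proj0: "AE \<omega> in M. proj0 M F (\<lambda>x. f ((left_shift ^^ i) x)) \<omega> = a i * \<omega> 0"
proof -
  have f: "(\<lambda>x. f ((left_shift ^^ i) x)) = lin (int i) a" by (rule ext) (rule f_left_shift)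
  have "AE \<omega> in M. real_cond_exp M (F (int i - int i)) (lin (int i) a) \<omega> = lin (int i - int i) (\<lambda>l. a (l + i)) \<omega>"
    "AE \<omega> in M. real_cond_exp M (F (int i - int (Suc i))) (lin (int i) a) \<omega> = lin (int i - int (Suc i)) (\<lambda>l. a (l + Suc i)) \<omega>"
    by (rule cond_exp_lin[OF summable_a])+
  moreover have "AE \<omega> in M. converges_at 0 (\<lambda>l. a (l + i)) \<omega>"
    by (rule AE_converges_at[OF summable_shift_coeff[OF summable_a]])
  ultimately show ?thesis
  proof eventually_elim
    case (elim \<omega>)
    then show ?case
      using lin_split[OF summable_shift_coeff[OF summable_a] elim(3), of 1]
      by (simp add: proj0_def f)
  qed
qed

lemma L2_norm_S: "L2_norm M (S n) = sqrt (V n + W n)"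
  using L2_norm_cong_AE[OF measurable_S measurable_lin AE_S_eq_lin]
  by (simp add: L2_norm_lin summable_c sum_c_square)

lemma L2_norm_ES: "L2_norm M (ES (Suc n)) = sqrt ((b n)\<^sup>2 + W (Suc n))"
proof -
  have "L2_norm M (ES (Suc n)) = L2_norm M (lin 0 (\<lambda>l. c (Suc n) (l + n)))"
    by (rule L2_norm_cong_AE) (use AE_ES[of "Suc n"] in \<open>auto simp: Q_def\<close>)
  also have "\<dots> = sqrt (\<Sum>l. (c (Suc n) (l + n))\<^sup>2)"
    by (rule L2_norm_lin[OF summable_shift_coeff[OF summable_c]])
  also have "(\<Sum>l. (c (Suc n) (l + n))\<^sup>2) = (\<Sum>l. (c (Suc n) (Suc l + n))\<^sup>2) + (c (Suc n) n)\<^sup>2"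
    using suminf_split_head[OF summable_square_coeff[OF summable_shift_coeff[OF summable_c]], of "Suc n" n]
    by simp
  also have "(\<lambda>l. (c (Suc n) (Suc l + n))\<^sup>2) = (\<lambda>l. (b l - b (l + Suc n))\<^sup>2)"
    using c_ge[of "Suc n"] by (simp add: power2_commute)
  finally show ?thesis by (simp add: W_def c_less add.commute)
qed

lemma L2_norm_S_minus_ES: "L2_norm M (\<lambda>\<omega>. S n \<omega> - ES n \<omega>) = sqrt (V (n - 1))"
proof -
  have "AE \<omega> in M. S n \<omega> - ES n \<omega> = D n \<omega>"
    using AE_S_eq_D_Q[of n] AE_ES[of n] by eventually_elim simp
  then have "L2_norm M (\<lambda>\<omega>. S n \<omega> - ES n \<omega>) = L2_norm M (D n)"
    by (intro L2_norm_cong_AE) measurable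
  then show ?thesis
    using integral_partial_square[where p = "int (n - 1)" and c = b and N = "n - 1"] by (simp add: L2_norm_def D_def V_def)
qed

lemma L2_norm_proj0: "L2_norm M (proj0 M F (\<lambda>x. f ((left_shift ^^ i) x))) = \<bar>a i\<bar>"
proof -
  have [measurable]: "proj0 M F g \<in> borel_measurable M" for g
    unfolding proj0_def[abs_def] by measurable
  have "L2_norm M (proj0 M F (\<lambda>x. f ((left_shift ^^ i) x))) = L2_norm M (\<lambda>\<omega>. a i * \<omega> 0)"
    by (rule L2_norm_cong_AE[OF _ _ AE_proj0]) measurable
  then show ?thesis by (simp add: L2_norm_def power_mult_distrib integral_square_coordinate)
qed

lemma hannan_f: "hannan M left_shift F f"
  using summable_a by (simp add: hannan_def L2_norm_proj0)

lemma adapted_regular_f: "adapted_regular M F f"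
  unfolding adapted_regular_def f_def
  using cond_exp_lin_tail[OF summable_a] by (simp add: measurable_F_lin)

lemma f_L2: "f \<in> L2_on M M"
  by (simp add: L2_on_def f_def integrable_lin_square summable_a)

lemma is_linear_process_f: "is_linear_process M left_shift (\<lambda>\<omega>. \<omega> 0) a f"
  using tendsto_partial_lin_L2[OF summable_a, of 0]
  by (simp add: is_linear_process_def inv_left_shift_funpow f_def)

end

section \<open>Characteristic functions and the central limit theorem\<close>

lemma abs_exp_minus_linear_le:
  fixes y :: real
  assumes "0 \<le> y"
  shows "\<bar>exp (- y) - (1 - y)\<bar> \<le> y\<^sup>2"
proof -
  \<comment> \<open>The product equals 1 + y^3. Together with 1 + y \<le> exp y it gives exp (-y)
    \<le> 1 - y + y^2.\<close>
  have "1 \<le> (1 - y + y\<^sup>2) * (1 + y)"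
    using assms by (simp add: algebra_simps power2_eq_square)
  also have "\<dots> \<le> (1 - y + y\<^sup>2) * exp y"
  proof (rule mult_left_mono)
    show "1 + y \<le> exp y" by (rule exp_ge_add_one_self)
    have "0 \<le> (1 - y / 2)\<^sup>2 + 3 / 4 * y\<^sup>2" by simp
    then show "0 \<le> 1 - y + y\<^sup>2" by (simp add: power2_eq_square algebra_simps)
  qed
  finally have "exp (- y) \<le> 1 - y + y\<^sup>2"
    by (simp add: exp_minus field_simps)
  moreover have "1 - y \<le> exp (- y)"
    using exp_ge_add_one_self[of "- y"] by simp
  ultimately show ?thesis by (simp add: abs_le_iff)
qed

lemma cmod_iexp_diff_le: "cmod (iexp x - iexp y) \<le> \<bar>x - y\<bar>"
proof -
  have "cmod (iexp (x - y) - 1) \<le> \<bar>x - y\<bar>"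
    using iexp_approx1[of "x - y" 0] by simp
  moreover have "iexp x - iexp y = iexp y * (iexp (x - y) - 1)"
    by (simp add: algebra_simps exp_add[symmetric])
  ultimately show ?thesis
    by (simp add: norm_mult)
qed

lemma (in prob_space) expectation_abs_le_L2_norm:
  fixes X :: "'a \<Rightarrow> real"
  assumes [measurable]: "X \<in> borel_measurable M" and sq: "integrable M (\<lambda>x. (X x)\<^sup>2)"
  shows "expectation (\<lambda>x. \<bar>X x\<bar>) \<le> L2_norm M X"
proof -
  have i: "integrable M (\<lambda>x. \<bar>X x\<bar>)"
    using square_integrable_imp_integrable[OF assms] by simp
  have "0 \<le> variance (\<lambda>x. \<bar>X x\<bar>)" by (rule variance_positive)
  also have "\<dots> = expectation (\<lambda>x. (X x)\<^sup>2) - (expectation (\<lambda>x. \<bar>X x\<bar>))\<^sup>2"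
    using variance_eq[OF i] sq by simp
  finally show ?thesis
    unfolding L2_norm_def by (intro real_le_rsqrt) simp
qed

text \<open>This takes the place of Slutsky's theorem: a perturbation tending to 0 in L2 does not
  affect the limit of the characteristic functions.\<close>

lemma (in prob_space) cmod_char_diff_le:
  fixes X Y :: "'a \<Rightarrow> real"
  assumes [measurable]: "X \<in> borel_measurable M" "Y \<in> borel_measurable M"
    and sq: "integrable M (\<lambda>x. (X x - Y x)\<^sup>2)"
  shows "cmod (char (distr M borel X) t - char (distr M borel Y) t) \<le> \<bar>t\<bar> * L2_norm M (\<lambda>x. X x - Y x)"
proof -
  have int: "integrable M (\<lambda>x. iexp (t * Z x))" if [measurable]: "Z \<in> borel_measurable M" for Z
    by (intro integrable_const_bound[where B = 1]) auto
  have "char (distr M borel X) t - char (distr M borel Y) t = (\<integral>x. iexp (t * X x) - iexp (t * Y x) \<partial>M)"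
  proof -
    have "char (distr M borel X) t - char (distr M borel Y) t = (\<integral>x. iexp (t * X x) \<partial>M) - (\<integral>x. iexp (t * Y x) \<partial>M)"
      by (simp add: char_def integral_distr)
    also have "\<dots> = (\<integral>x. iexp (t * X x) - iexp (t * Y x) \<partial>M)"
      by (rule Bochner_Integration.integral_diff[symmetric]) (rule int, measurable)+
    finally show ?thesis .
  qed
  also have "cmod \<dots> \<le> (\<integral>x. cmod (iexp (t * X x) - iexp (t * Y x)) \<partial>M)"
    by (rule integral_norm_bound)
  also have "\<dots> \<le> (\<integral>x. \<bar>t\<bar> * \<bar>X x - Y x\<bar> \<partial>M)"
  proof (rule integral_mono)
    show "integrable M (\<lambda>x. cmod (iexp (t * X x) - iexp (t * Y x)))"
      by (intro integrable_norm Bochner_Integration.integrable_diff int) measurable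
    have "integrable M (\<lambda>x. X x - Y x)"
      by (rule square_integrable_imp_integrable[OF _ sq]) measurable
    then show "integrable M (\<lambda>x. \<bar>t\<bar> * \<bar>X x - Y x\<bar>)" by simp
    show "cmod (iexp (t * X x) - iexp (t * Y x)) \<le> \<bar>t\<bar> * \<bar>X x - Y x\<bar>" for x
      using cmod_iexp_diff_le[of "t * X x" "t * Y x"] by (simp add: right_diff_distrib[symmetric] abs_mult)
  qed
  also have "\<dots> \<le> \<bar>t\<bar> * L2_norm M (\<lambda>x. X x - Y x)"
    using expectation_abs_le_L2_norm[OF _ sq] by (simp add: mult_left_mono)
  finally show ?thesis .
qed

context unit_variance_sequence
begin

lemma real_distribution_\<nu>: "real_distribution \<nu>"
  using prob_\<nu> by (simp add: real_distribution_def real_distribution_axioms_def sets_\<nu>)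

lemma char_weighted_sum:
  "char (distr M borel (\<lambda>\<omega>. \<Sum>l<m. w l * \<omega> (int m - int l))) t = (\<Prod>l<m. char \<nu> (t * w l))"
proof -
  define w' where "w' j = w (nat (int m - j))" for j
  let ?h = "\<lambda>l. int m - int l"
  have h: "inj_on ?h {..<m}" by (auto simp: inj_on_def)
  have e1: "(\<lambda>\<omega> :: int \<Rightarrow> real. \<Sum>l<m. w l * \<omega> (?h l)) = (\<lambda>\<omega>. \<Sum>j\<in>?h ` {..<m}. w' j * \<omega> j)"
    unfolding sum.reindex[OF h] comp_def by (simp add: w'_def)
  have e2: "char (distr M borel (\<lambda>\<omega>. \<Sum>j\<in>?h ` {..<m}. w' j * \<omega> j)) t
      = (\<Prod>j\<in>?h ` {..<m}. char (distr M borel (\<lambda>\<omega>. w' j * \<omega> j)) t)"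
  proof (rule char_distr_sum)
    have "(\<lambda>x. w' j * x) \<in> borel_measurable borel" for j by simp
    then show "indep_vars (\<lambda>_. borel) (\<lambda>j \<omega>. w' j * \<omega> j) (?h ` {..<m})"
      by (rule indep_vars_compose2[OF indep_coordinates])
  qed
  have e3: "char (distr M borel (\<lambda>\<omega>. w' j * \<omega> j)) t = char \<nu> (t * w' j)" for j
  proof -
    have "char (distr M borel (\<lambda>\<omega>. w' j * \<omega> j)) t = (\<integral>\<omega>. iexp (t * (w' j * \<omega> j)) \<partial>M)"
      by (simp add: char_def integral_distr)
    also have "\<dots> = (\<integral>x. iexp (t * (w' j * x)) \<partial>distr M borel (\<lambda>\<omega>. \<omega> j))"
      by (simp add: integral_distr)
    finally show ?thesis by (simp add: distr_coordinate char_def mult.assoc)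
  qed
  have "(\<Prod>j\<in>?h ` {..<m}. char \<nu> (t * w' j)) = (\<Prod>l<m. char \<nu> (t * w l))"
    unfolding prod.reindex[OF h] comp_def by (simp add: w'_def)
  then show ?thesis unfolding e1 e2 e3 .
qed

text \<open>A Lindeberg-type error: the first summand is the Taylor remainder of the characteristic
  function, the second that of the Gaussian factor. The minimum with 6 x^2 provides a majorant, so
  the error tends to 0 with u although only second moments are finite.\<close>

definition char_error :: "real \<Rightarrow> real" where
  "char_error u = (\<integral>x. min (6 * x\<^sup>2) (u * \<bar>x\<bar> ^ 3) \<partial>\<nu>) / 6 + u\<^sup>2 / 4"

lemma measurable_min_cube: "(\<lambda>x. min (6 * x\<^sup>2) (u * \<bar>x\<bar> ^ 3)) \<in> borel_measurable \<nu>"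
  unfolding measurable_cong_sets[OF sets_\<nu> refl]
  by (intro borel_measurable_continuous_onI continuous_intros)

lemma integrable_min_cube: "integrable \<nu> (\<lambda>x. min (6 * x\<^sup>2) (\<bar>u\<bar> * \<bar>x\<bar> ^ 3))"
proof (rule Bochner_Integration.integrable_bound)
  show "integrable \<nu> (\<lambda>x. 6 * x\<^sup>2)" using integrable_square by simp
qed (rule measurable_min_cube, auto simp: min_def)

lemma integral_id_\<nu>: "integrable \<nu> (\<lambda>x. x)" "(\<integral>x. x \<partial>\<nu>) = 0"
proof -
  show "integrable \<nu> (\<lambda>x. x)"
  proof (rule product.M.square_integrable_imp_integrable)
    show "(\<lambda>x. x) \<in> borel_measurable \<nu>"
      unfolding measurable_cong_sets[OF sets_\<nu> refl] by simp
  qed (rule integrable_square)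
  have "(\<integral>x. x \<partial>distr \<nu> borel uminus) = (\<integral>x. - x \<partial>\<nu>)"
    by (rule integral_distr) (simp_all add: measurable_cong_sets[OF sets_\<nu> refl])
  then have "(\<integral>x. x \<partial>\<nu>) = - (\<integral>x. x \<partial>\<nu>)"
    unfolding symmetric_\<nu> by simp
  then show "(\<integral>x. x \<partial>\<nu>) = 0" by simp
qed

lemma char_normal_approx:
  assumes "\<bar>u\<bar> \<le> U"
  shows "cmod (char \<nu> u - exp (- (u\<^sup>2 / 2))) \<le> u\<^sup>2 * char_error U"
proof -
  interpret \<nu>: real_distribution \<nu> by (rule real_distribution_\<nu>)
  have "cmod (char \<nu> u - (1 - u\<^sup>2 * 1 / 2)) \<le> (u\<^sup>2 / 6) * (\<integral>x. min (6 * x\<^sup>2) (\<bar>u\<bar> * \<bar>x\<bar> ^ 3) \<partial>\<nu>)"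
    using integral_id_\<nu> integrable_square variance_1
    by (intro \<nu>.char_approx3) auto
  also have "\<dots> \<le> (u\<^sup>2 / 6) * (\<integral>x. min (6 * x\<^sup>2) (U * \<bar>x\<bar> ^ 3) \<partial>\<nu>)"
  proof (intro mult_left_mono integral_mono)
    show "integrable \<nu> (\<lambda>x. min (6 * x\<^sup>2) (U * \<bar>x\<bar> ^ 3))"
      using integrable_min_cube[of U] assms by simp
    show "min (6 * x\<^sup>2) (\<bar>u\<bar> * \<bar>x\<bar> ^ 3) \<le> min (6 * x\<^sup>2) (U * \<bar>x\<bar> ^ 3)" for x
      using assms by (intro min.mono mult_right_mono) auto
  qed (use integrable_min_cube in auto)
  finally have 1: "cmod (char \<nu> u - (1 - u\<^sup>2 / 2)) \<le> u\<^sup>2 * ((\<integral>x. min (6 * x\<^sup>2) (U * \<bar>x\<bar> ^ 3) \<partial>\<nu>) / 6)"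
    by simp
  have "cmod (complex_of_real (1 - u\<^sup>2 / 2) - complex_of_real (exp (- (u\<^sup>2 / 2)))) = \<bar>exp (- (u\<^sup>2 / 2)) - (1 - u\<^sup>2 / 2)\<bar>"
    unfolding of_real_diff[symmetric] norm_of_real by simp
  also have "\<dots> \<le> (u\<^sup>2 / 2)\<^sup>2" by (rule abs_exp_minus_linear_le) simp
  also have "\<dots> = u\<^sup>2 * (u\<^sup>2 / 4)" by (simp add: power2_eq_square)
  also have "\<dots> \<le> u\<^sup>2 * (U\<^sup>2 / 4)"
    using power_mono[OF assms, of 2] by (intro mult_left_mono) auto
  finally have 2: "cmod (complex_of_real (1 - u\<^sup>2 / 2) - complex_of_real (exp (- (u\<^sup>2 / 2)))) \<le> u\<^sup>2 * (U\<^sup>2 / 4)" .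
  have "cmod (char \<nu> u - exp (- (u\<^sup>2 / 2))) \<le> cmod (char \<nu> u - (1 - u\<^sup>2 / 2))
      + cmod (complex_of_real (1 - u\<^sup>2 / 2) - complex_of_real (exp (- (u\<^sup>2 / 2))))"
    using norm_triangle_ineq[of "char \<nu> u - (1 - u\<^sup>2 / 2)" "complex_of_real (1 - u\<^sup>2 / 2) - complex_of_real (exp (- (u\<^sup>2 / 2)))"]
    by (simp add: exp_of_real[symmetric])
  then show ?thesis
    using 1 2 by (simp add: char_error_def distrib_left)
qed

lemma char_error_tendsto:
  assumes "u \<longlonglongrightarrow> 0" "\<And>n. 0 \<le> u n"
  shows "(\<lambda>n. char_error (u n)) \<longlonglongrightarrow> 0"
proof -
  have "(\<lambda>n. \<integral>x. min (6 * x\<^sup>2) (u n * \<bar>x\<bar> ^ 3) \<partial>\<nu>) \<longlonglongrightarrow> (\<integral>x. min (6 * x\<^sup>2) (0 * \<bar>x\<bar> ^ 3) \<partial>\<nu>)"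
  proof (rule integral_dominated_convergence[where w = "\<lambda>x. 6 * x\<^sup>2"])
    show "AE x in \<nu>. (\<lambda>n. min (6 * x\<^sup>2) (u n * \<bar>x\<bar> ^ 3)) \<longlonglongrightarrow> min (6 * x\<^sup>2) (0 * \<bar>x\<bar> ^ 3)"
      by (intro AE_I2 tendsto_min tendsto_mult tendsto_const assms)
    show "AE x in \<nu>. norm (min (6 * x\<^sup>2) (u n * \<bar>x\<bar> ^ 3)) \<le> 6 * x\<^sup>2" for n
      using assms(2)[of n] by (intro AE_I2) (auto simp: min_def)
  qed (rule measurable_min_cube, rule measurable_min_cube, use integrable_square in simp)
  then have "(\<lambda>n. char_error (u n)) \<longlonglongrightarrow> (\<integral>x. min (6 * x\<^sup>2) (0 * \<bar>x\<bar> ^ 3) \<partial>\<nu>) / 6 + 0\<^sup>2 / 4"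
    unfolding char_error_def by (intro tendsto_intros assms) auto
  then show ?thesis by simp
qed

end

section \<open>Norms of the partial sums and the annealed limit\<close>

locale slow_weights = decreasing_weights +
  assumes V_at_top: "filterlim V at_top sequentially"
    and V_over_n: "(\<lambda>n. V n / real n) \<longlonglongrightarrow> 0"
    and W_over_V: "(\<lambda>n. W n / V n) \<longlonglongrightarrow> 0"
    and summable_ES: "summable (\<lambda>n. sqrt ((b n)\<^sup>2 + W (Suc n)) / real (Suc n) powr (3/2))"
begin

definition \<sigma> :: "nat \<Rightarrow> real" where
  "\<sigma> n = L2_norm M (S n)"

lemma \<sigma>_eq: "\<sigma> n = sqrt (V n + W n)"
  by (simp add: \<sigma>_def L2_norm_S)

lemma \<sigma>_pos: "0 < n \<Longrightarrow> 0 < \<sigma> n"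
  using V_pos[of n] W_nonneg[of n] by (simp add: \<sigma>_eq)

lemma maxwell_woodroofe_f: "maxwell_woodroofe M left_shift F f"
  using summable_ES L2_norm_ES by (simp add: maxwell_woodroofe_def ES_def S_def)

lemma \<sigma>_at_top: "filterlim \<sigma> at_top sequentially"
proof (rule filterlim_at_top_mono)
  show "filterlim (\<lambda>n. sqrt (V n)) at_top sequentially"
    by (rule filterlim_compose[OF sqrt_at_top V_at_top])
qed (simp add: \<sigma>_eq W_nonneg)

lemma \<sigma>_over_sqrt: "(\<lambda>n. \<sigma> n / sqrt (real n)) \<longlonglongrightarrow> 0"
proof (rule tendsto_sandwich[OF _ _ tendsto_const])
  have "(\<lambda>n. sqrt (2 * (V n / real n))) \<longlonglongrightarrow> sqrt (2 * 0)"
    by (intro tendsto_intros V_over_n)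
  then show "(\<lambda>n. sqrt (2 * (V n / real n))) \<longlonglongrightarrow> 0" by simp
  show "eventually (\<lambda>n. \<sigma> n / sqrt (real n) \<le> sqrt (2 * (V n / real n))) sequentially"
  proof (intro always_eventually allI)
    fix n
    have "(V n + W n) / real n \<le> 2 * (V n / real n)"
      using divide_right_mono[of "V n + W n" "2 * V n" "real n"] W_le_V[of n] by simp
    then show "\<sigma> n / sqrt (real n) \<le> sqrt (2 * (V n / real n))"
      unfolding \<sigma>_eq real_sqrt_divide[symmetric] by (rule real_sqrt_le_mono)
  qed
qed (simp add: \<sigma>_eq V_nonneg W_nonneg)

lemma const_over_V: "(\<lambda>n. x / V n) \<longlonglongrightarrow> 0"
  by (rule tendsto_divide_0[OF tendsto_const filterlim_at_top_imp_at_infinity[OF V_at_top]])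

lemma L2_norm_ES_over_\<sigma>: "(\<lambda>n. L2_norm M (ES n) / \<sigma> n) \<longlonglongrightarrow> 0"
proof (rule tendsto_sandwich[OF _ _ tendsto_const])
  have "(\<lambda>n. sqrt ((b 0)\<^sup>2 / V n + W n / V n)) \<longlonglongrightarrow> sqrt (0 + 0)"
    by (intro tendsto_intros const_over_V W_over_V)
  then show "(\<lambda>n. sqrt ((b 0)\<^sup>2 / V n + W n / V n)) \<longlonglongrightarrow> 0" by simp
  show "eventually (\<lambda>n. L2_norm M (ES n) / \<sigma> n \<le> sqrt ((b 0)\<^sup>2 / V n + W n / V n)) sequentially"
  proof (rule eventually_sequentiallyI[of 1])
    fix n :: nat assume "1 \<le> n"
    then obtain m where n: "n = Suc m" by (cases n) auto
    have "(b m)\<^sup>2 + W n \<le> (b 0)\<^sup>2 + W n"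
      using b_mono[of 0 m] b_nonneg[of m] by (simp add: power_mono)
    then have "((b m)\<^sup>2 + W n) / (V n + W n) \<le> ((b 0)\<^sup>2 + W n) / V n"
      using V_pos[of n] W_nonneg[of n] n by (intro frac_le) auto
    then show "L2_norm M (ES n) / \<sigma> n \<le> sqrt ((b 0)\<^sup>2 / V n + W n / V n)"
      by (simp add: n \<sigma>_eq L2_norm_ES real_sqrt_divide[symmetric] add_divide_distrib)
  qed
  show "eventually (\<lambda>n. 0 \<le> L2_norm M (ES n) / \<sigma> n) sequentially"
    by (simp add: L2_norm_def \<sigma>_def)
qed

lemma V_minus_over: "(\<lambda>n. V (n - 1) / (\<sigma> n)\<^sup>2) \<longlonglongrightarrow> 1"
proof (rule Lim_transform_eventually)
  have "(\<lambda>n. b (n - 1)) \<longlonglongrightarrow> 0"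
    by (rule LIMSEQ_imp_Suc) (simp add: b_tendsto_0)
  then have b: "(\<lambda>n. (b (n - 1))\<^sup>2 * (1 / V n)) \<longlonglongrightarrow> 0\<^sup>2 * 0"
    by (intro tendsto_mult tendsto_power const_over_V)
  have "(\<lambda>n. (1 - (b (n - 1))\<^sup>2 * (1 / V n)) / (1 + W n / V n)) \<longlonglongrightarrow> (1 - 0\<^sup>2 * 0) / (1 + 0)"
    by (rule tendsto_divide[OF tendsto_diff[OF tendsto_const b] tendsto_add[OF tendsto_const W_over_V]]) simp
  then show "(\<lambda>n. (1 - (b (n - 1))\<^sup>2 * (1 / V n)) / (1 + W n / V n)) \<longlonglongrightarrow> 1" by simp
  show "eventually (\<lambda>n. (1 - (b (n - 1))\<^sup>2 * (1 / V n)) / (1 + W n / V n) = V (n - 1) / (\<sigma> n)\<^sup>2) sequentially"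
  proof (rule eventually_sequentiallyI[of 1])
    fix n :: nat assume "1 \<le> n"
    then have "V n = V (n - 1) + (b (n - 1))\<^sup>2"
      unfolding V_def by (cases n) auto
    moreover have "0 < V n" "0 < V n + W n"
      using \<open>1 \<le> n\<close> V_pos[of n] W_nonneg[of n] by auto
    moreover from this have "(1 - (b (n - 1))\<^sup>2 * (1 / V n)) / (1 + W n / V n) = (V n - (b (n - 1))\<^sup>2) / (V n + W n)"
      by (simp add: divide_simps)
    ultimately show "(1 - (b (n - 1))\<^sup>2 * (1 / V n)) / (1 + W n / V n) = V (n - 1) / (\<sigma> n)\<^sup>2"
      by (simp add: \<sigma>_eq)
  qed
qed

lemma \<sigma>'_over_\<sigma>: "(\<lambda>n. L2_norm M (\<lambda>x. S n x - ES n x) / \<sigma> n) \<longlonglongrightarrow> 1"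
proof -
  have "(\<lambda>n. sqrt (V (n - 1) / (\<sigma> n)\<^sup>2)) \<longlonglongrightarrow> sqrt 1"
    by (rule tendsto_real_sqrt[OF V_minus_over])
  moreover have "sqrt (V (n - 1) / (\<sigma> n)\<^sup>2) = L2_norm M (\<lambda>x. S n x - ES n x) / \<sigma> n" for n
    by (simp add: L2_norm_S_minus_ES real_sqrt_divide \<sigma>_eq V_nonneg W_nonneg)
  ultimately show ?thesis by simp
qed

text \<open>The factors have modulus at most 1, so the products differ by at most the sum of the
  differences of the factors. Their arguments are bounded by \<open>U n\<close>, which tends to 0
  because \<open>\<sigma> n\<close> diverges, while their squares sum to at most t^2.\<close>

lemma char_D_tendsto: "(\<lambda>n. char (distr M borel (\<lambda>\<omega>. D n \<omega> / \<sigma> n)) t) \<longlonglongrightarrow> exp (- (t\<^sup>2 / 2))"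
proof -
  define w where "w n l = b l / \<sigma> n" for n l
  define U where "U n = \<bar>t\<bar> * b 0 / \<sigma> n" for n
  define r where "r n = V (n - 1) / (\<sigma> n)\<^sup>2" for n
  have \<sigma>0: "0 \<le> \<sigma> n" for n by (simp add: \<sigma>_def L2_norm_def)
  have r_le: "r n \<le> 1" for n
  proof (cases "n = 0")
    case False
    then have "V (n - 1) \<le> (\<sigma> n)\<^sup>2"
      using V_mono[of "n - 1" n] W_nonneg[of n] V_nonneg[of n] by (simp add: \<sigma>_eq)
    then show ?thesis using False \<sigma>_pos[of n] by (simp add: r_def)
  qed (simp add: r_def \<sigma>_def L2_norm_S V_def W_def)
  have sum_w: "(\<Sum>l<n - 1. (t * w n l)\<^sup>2) = t\<^sup>2 * r n" for n
    by (simp add: w_def r_def V_def power_mult_distrib power_divide sum_distrib_left sum_divide_distrib)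
  have eq: "char (distr M borel (\<lambda>\<omega>. D n \<omega> / \<sigma> n)) t = (\<Prod>l<n - 1. char \<nu> (t * w n l))" for n
  proof -
    have "(\<lambda>\<omega>. D n \<omega> / \<sigma> n) = (\<lambda>\<omega>. \<Sum>l<n - 1. w n l * \<omega> (int (n - 1) - int l))"
      by (simp add: D_def w_def sum_divide_distrib fun_eq_iff)
    then show ?thesis by (simp only: char_weighted_sum)
  qed
  have U: "U \<longlonglongrightarrow> 0"
    unfolding U_def by (rule tendsto_divide_0[OF tendsto_const filterlim_at_top_imp_at_infinity[OF \<sigma>_at_top]])
  have bound: "cmod ((\<Prod>l<n - 1. char \<nu> (t * w n l)) - exp (- (t\<^sup>2 / 2 * r n))) \<le> t\<^sup>2 * char_error (U n)" for n
  proof -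
    interpret \<nu>: real_distribution \<nu> by (rule real_distribution_\<nu>)
    have "complex_of_real (exp (- (t\<^sup>2 / 2 * r n))) = (\<Prod>l<n - 1. complex_of_real (exp (- ((t * w n l)\<^sup>2 / 2))))"
      unfolding of_real_prod[symmetric] exp_sum[OF finite_lessThan, symmetric]
      by (simp add: sum_negf sum_divide_distrib[symmetric] sum_w del: One_nat_def)
    then have "cmod ((\<Prod>l<n - 1. char \<nu> (t * w n l)) - exp (- (t\<^sup>2 / 2 * r n)))
        = cmod ((\<Prod>l<n - 1. char \<nu> (t * w n l)) - (\<Prod>l<n - 1. complex_of_real (exp (- ((t * w n l)\<^sup>2 / 2)))))"
      by (simp add: exp_of_real)
    also have "\<dots> \<le> (\<Sum>l<n - 1. cmod (char \<nu> (t * w n l) - complex_of_real (exp (- ((t * w n l)\<^sup>2 / 2)))))"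
      by (intro norm_prod_diff \<nu>.cmod_char_le_1) simp
    also have "\<dots> \<le> (\<Sum>l<n - 1. (t * w n l)\<^sup>2 * char_error (U n))"
    proof (rule sum_mono)
      fix l
      have "\<bar>t * w n l\<bar> \<le> U n"
        unfolding w_def U_def using b_mono[of 0 l] b_nonneg[of l] \<sigma>0[of n]
        by (simp add: abs_mult mult_left_mono divide_right_mono)
      from char_normal_approx[OF this]
      show "cmod (char \<nu> (t * w n l) - complex_of_real (exp (- ((t * w n l)\<^sup>2 / 2)))) \<le> (t * w n l)\<^sup>2 * char_error (U n)"
        by (simp add: exp_of_real)
    qed
    also have "\<dots> = t\<^sup>2 * r n * char_error (U n)"
      by (simp only: sum_distrib_right[symmetric] sum_w)
    also have "\<dots> \<le> t\<^sup>2 * 1 * char_error (U n)"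
    proof (intro mult_right_mono mult_left_mono r_le)
      have "0 \<le> U n" using b_nonneg \<sigma>0 by (simp add: U_def)
      then show "0 \<le> char_error (U n)"
        unfolding char_error_def by (intro add_nonneg_nonneg divide_nonneg_nonneg integral_nonneg) auto
    qed simp
    finally show ?thesis by simp
  qed
  have "0 \<le> U n" for n using b_nonneg \<sigma>0 by (simp add: U_def)
  then have "(\<lambda>n. t\<^sup>2 * char_error (U n)) \<longlonglongrightarrow> t\<^sup>2 * 0"
    by (intro tendsto_mult tendsto_const char_error_tendsto U)
  then have "(\<lambda>n. t\<^sup>2 * char_error (U n)) \<longlonglongrightarrow> 0" by simp
  then have "(\<lambda>n. (\<Prod>l<n - 1. char \<nu> (t * w n l)) - exp (- (t\<^sup>2 / 2 * r n))) \<longlonglongrightarrow> 0"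
    by (rule Lim_null_comparison[OF always_eventually[OF allI[OF bound]]])
  then have 1: "(\<lambda>n. (\<Prod>l<n - 1. char \<nu> (t * w n l)) - complex_of_real (exp (- (t\<^sup>2 / 2 * r n)))) \<longlonglongrightarrow> 0"
    by (simp add: exp_of_real)
  have 2: "(\<lambda>n. complex_of_real (exp (- (t\<^sup>2 / 2 * r n)))) \<longlonglongrightarrow> complex_of_real (exp (- (t\<^sup>2 / 2 * 1)))"
    using V_minus_over unfolding r_def by (intro tendsto_intros)
  show ?thesis
    unfolding eq using Lim_transform[OF 2 1] by (simp add: exp_of_real[symmetric])
qed

lemma clt_S: "clt M (\<lambda>n x. S n x / \<sigma> n)"
  unfolding clt_def
proof (rule levy_continuity)
  show "real_distribution (distr M borel (\<lambda>x. S n x / \<sigma> n))" for n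
    by (rule real_distribution_distr) measurable
  show "real_distribution std_normal_distribution" by (rule real_dist_normal_dist)
  fix t :: real
  have "cmod (char (distr M borel (\<lambda>x. S n x / \<sigma> n)) t - char (distr M borel (\<lambda>x. D n x / \<sigma> n)) t)
      \<le> \<bar>t\<bar> * (L2_norm M (ES n) / \<sigma> n)" for n
  proof -
    have ae: "AE x in M. S n x / \<sigma> n - D n x / \<sigma> n = Q n x / \<sigma> n"
      using AE_S_eq_D_Q[of n] by eventually_elim (simp add: diff_divide_distrib[symmetric])
    have "integrable M (\<lambda>x. (Q n x / \<sigma> n)\<^sup>2)"
      unfolding power_divide Q_def
      by (intro integrable_divide integrable_lin_square summable_shift_coeff summable_c)
    moreover have "integrable M (\<lambda>x. (S n x / \<sigma> n - D n x / \<sigma> n)\<^sup>2) \<longleftrightarrow> integrable M (\<lambda>x. (Q n x / \<sigma> n)\<^sup>2)"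
      by (rule integrable_cong_AE) (measurable, use ae in \<open>auto elim: eventually_mono\<close>)
    ultimately have "cmod (char (distr M borel (\<lambda>x. S n x / \<sigma> n)) t - char (distr M borel (\<lambda>x. D n x / \<sigma> n)) t)
        \<le> \<bar>t\<bar> * L2_norm M (\<lambda>x. S n x / \<sigma> n - D n x / \<sigma> n)"
      by (intro cmod_char_diff_le) auto
    also have "L2_norm M (\<lambda>x. S n x / \<sigma> n - D n x / \<sigma> n) = L2_norm M (\<lambda>x. Q n x / \<sigma> n)"
      by (rule L2_norm_cong_AE[OF _ _ ae]) measurable
    also have "\<dots> = L2_norm M (Q n) / \<sigma> n"
      by (simp add: L2_norm_def power_divide real_sqrt_divide \<sigma>_def)
    also have "L2_norm M (Q n) = L2_norm M (ES n)"
      by (rule L2_norm_cong_AE) (use AE_ES[of n] in \<open>auto elim: eventually_mono\<close>)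
    finally show ?thesis .
  qed
  moreover have "(\<lambda>n. \<bar>t\<bar> * (L2_norm M (ES n) / \<sigma> n)) \<longlonglongrightarrow> 0"
    using tendsto_mult[OF tendsto_const L2_norm_ES_over_\<sigma>, of "\<bar>t\<bar>"] by simp
  ultimately have "(\<lambda>n. char (distr M borel (\<lambda>x. S n x / \<sigma> n)) t - char (distr M borel (\<lambda>x. D n x / \<sigma> n)) t) \<longlonglongrightarrow> 0"
    by (rule Lim_null_comparison[OF always_eventually[OF allI]])
  then have "(\<lambda>n. char (distr M borel (\<lambda>x. S n x / \<sigma> n)) t) \<longlonglongrightarrow> exp (- (t\<^sup>2 / 2))"
    by (rule Lim_transform[OF char_D_tendsto])
  then show "(\<lambda>n. char (distr M borel (\<lambda>x. S n x / \<sigma> n)) t) \<longlonglongrightarrow> char std_normal_distribution t"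
    by (simp add: char_std_normal_distribution)
qed

end

section \<open>Loss of tightness contradicts convergence in law\<close>

definition clip :: "real \<Rightarrow> real" where
  "clip y = min 1 (max 0 y)"

lemma clip_bounds: "0 \<le> clip y" "clip y \<le> 1"
  by (auto simp: clip_def)

lemma isCont_clip: "isCont clip x"
proof -
  have "continuous_on UNIV clip"
    unfolding clip_def[abs_def] by (intro continuous_intros)
  then show ?thesis by (simp add: continuous_on_eq_continuous_at)
qed

lemma measurable_clip [measurable]: "clip \<in> borel_measurable borel"
  unfolding clip_def[abs_def] by (intro borel_measurable_continuous_onI continuous_intros)

lemma integral_clip_tendsto_0:
  fixes g :: "'a \<Rightarrow> real"
  assumes "prob_space P" and g: "g \<in> borel_measurable P"
  shows "(\<lambda>K. \<integral>x. clip (g x - real K) \<partial>P) \<longlonglongrightarrow> 0"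
proof -
  interpret prob_space P by fact
  have "(\<lambda>K. \<integral>x. clip (g x - real K) \<partial>P) \<longlonglongrightarrow> (\<integral>x. 0 \<partial>P)"
  proof (rule integral_dominated_convergence[where w = "\<lambda>_. 1"])
    show "AE x in P. (\<lambda>K. clip (g x - real K)) \<longlonglongrightarrow> 0"
    proof (rule AE_I2)
      fix x
      obtain n :: nat where n: "g x \<le> real n" using real_arch_simple by blast
      have "eventually (\<lambda>K. clip (g x - real K) = 0) sequentially"
      proof (rule eventually_sequentiallyI)
        fix K assume "n \<le> K"
        then have "real n \<le> real K" by simp
        then show "clip (g x - real K) = 0" using n by (simp add: clip_def)
      qed
      then show "(\<lambda>K. clip (g x - real K)) \<longlonglongrightarrow> 0" by (rule tendsto_eventually)
    qed
    show "AE x in P. norm (clip (g x - real K)) \<le> 1" for K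
      using clip_bounds by simp
    show "(\<lambda>x. clip (g x - real K)) \<in> borel_measurable P" for K
      using g by measurable
  qed auto
  then show ?thesis by simp
qed

text \<open>\<open>clip (g x - K)\<close> is a continuous substitute for the indicator of a large
  value: it is 0 up to K and 1 from K + 1 on, so weak convergence applies to it.\<close>

lemma measure_le_integral_clip:
  fixes g :: "'a \<Rightarrow> real"
  assumes "prob_space P" and g [measurable]: "g \<in> borel_measurable P"
    and E: "E \<in> sets P" "\<And>x. x \<in> E \<Longrightarrow> K + 1 \<le> g x"
  shows "measure P E \<le> (\<integral>x. clip (g x - K) \<partial>P)"
proof -
  interpret prob_space P by fact
  have "(\<integral>x. indicator E x \<partial>P) \<le> (\<integral>x. clip (g x - K) \<partial>P)"
  proof (rule integral_mono)
    show "integrable P (indicator E :: 'a \<Rightarrow> real)"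
      using E by (intro integrable_real_indicator) (simp_all add: emeasure_eq_measure)
    show "integrable P (\<lambda>x. clip (g x - K))"
      using clip_bounds by (intro integrable_const_bound[where B = 1]) auto
    show "indicator E x \<le> clip (g x - K)" for x
      using E(2)[of x] clip_bounds by (auto simp: indicator_def clip_def)
  qed
  then show ?thesis using E(1) sets.sets_into_space[OF E(1)] by (simp add: Int_absorb2)
qed

text \<open>Choose K so that the normal law gives the clipped functional an integral below 1/2. Weak
  convergence carries this bound to all large n, against the probability 1/2 that recurs for
  arbitrarily large n.\<close>

lemma not_clt_if_not_tight:
  assumes P: "prob_space P" and Y: "\<And>n. Y n \<in> borel_measurable P"
    and large: "\<And>K n0. \<exists>n\<ge>n0. 1/2 \<le> measure P {x \<in> space P. K \<le> \<bar>Y n x\<bar>}"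
  shows "\<not> clt P Y"
proof
  assume "clt P Y"
  then have wc: "weak_conv_m (\<lambda>n. distr P borel (Y n)) std_normal_distribution"
    by (simp add: clt_def)
  interpret prob_space P by (rule P)
  interpret N: real_distribution std_normal_distribution by (rule real_dist_normal_dist)
  have "(\<lambda>K. \<integral>x. clip (\<bar>x\<bar> - real K) \<partial>std_normal_distribution) \<longlonglongrightarrow> 0"
    by (rule integral_clip_tendsto_0) (auto intro: N.prob_space_axioms)
  then have "eventually (\<lambda>K. (\<integral>x. clip (\<bar>x\<bar> - real K) \<partial>std_normal_distribution) < 1/2) sequentially"
    by (rule order_tendstoD) simp
  then obtain K :: nat where K: "(\<integral>x. clip (\<bar>x\<bar> - real K) \<partial>std_normal_distribution) < 1/2"
    by (auto simp: eventually_sequentially)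
  have "(\<lambda>n. \<integral>x. clip (\<bar>x\<bar> - real K) \<partial>distr P borel (Y n)) \<longlonglongrightarrow> (\<integral>x. clip (\<bar>x\<bar> - real K) \<partial>std_normal_distribution)"
  proof (rule weak_conv_imp_integral_bdd_continuous_conv[OF _ _ wc])
    show "real_distribution (distr P borel (Y n))" for n
      by (rule real_distribution_distr) (rule Y)
    show "isCont (\<lambda>x. clip (\<bar>x\<bar> - real K)) x" for x
      by (rule isCont_o2[OF _ isCont_clip]) (intro continuous_intros)
    show "norm (clip (\<bar>x\<bar> - real K)) \<le> 1" for x
      using clip_bounds by simp
  qed (rule real_dist_normal_dist)
  then have "eventually (\<lambda>n. (\<integral>x. clip (\<bar>x\<bar> - real K) \<partial>distr P borel (Y n)) < 1/2) sequentially"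
    using K by (rule order_tendstoD)
  then obtain n0 where n0: "\<And>n. n0 \<le> n \<Longrightarrow> (\<integral>x. clip (\<bar>x\<bar> - real K) \<partial>distr P borel (Y n)) < 1/2"
    by (auto simp: eventually_sequentially)
  obtain n where n: "n0 \<le> n" "1/2 \<le> prob {x \<in> space P. real K + 1 \<le> \<bar>Y n x\<bar>}"
    using large by blast
  have "prob {x \<in> space P. real K + 1 \<le> \<bar>Y n x\<bar>} \<le> (\<integral>x. clip (\<bar>Y n x\<bar> - real K) \<partial>P)"
    by (rule measure_le_integral_clip[OF P]) (use Y in auto)
  also have "\<dots> = (\<integral>x. clip (\<bar>x\<bar> - real K) \<partial>distr P borel (Y n))"
    using Y by (subst integral_distr) auto
  finally show False using n n0[OF n(1)] by linarith
qed

subsection \<open>The supremum on the Skorokhod space\<close>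

definition path_sup :: "(real \<Rightarrow> real) \<Rightarrow> real" where
  "path_sup x = (SUP t\<in>{0..1}. \<bar>x t\<bar>)"

lemma path_sup_upper:
  assumes "x \<in> cadlag01" "t \<in> {0..1}"
  shows "\<bar>x t\<bar> \<le> path_sup x"
proof -
  obtain C where "\<And>t. t \<in> {0..1} \<Longrightarrow> \<bar>x t\<bar> \<le> C" using cadlag01_bounded[OF assms(1)] by blast
  then have "bdd_above ((\<lambda>t. \<bar>x t\<bar>) ` {0..1})" by (intro bdd_aboveI2)
  then show ?thesis unfolding path_sup_def using assms(2) by (rule cSUP_upper[rotated])
qed

lemma path_sup_close:
  assumes "y \<in> cadlag01" "skorokhod_close x y r"
  shows "path_sup x \<le> path_sup y + r"
proof -
  obtain l where l: "l \<in> time_changes" "\<And>t. t \<in> {0..1} \<Longrightarrow> \<bar>x t - y (l t)\<bar> \<le> r"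
    using assms(2) by (auto simp: skorokhod_close_def)
  have "\<bar>x t\<bar> \<le> path_sup y + r" if "t \<in> {0..1}" for t
    using l(2)[OF that] path_sup_upper[OF assms(1) time_changes_mem[OF l(1) that]] by linarith
  then show ?thesis unfolding path_sup_def by (intro cSUP_least) auto
qed

text \<open>A time change only permutes the values of a path, so the supremum is 1-Lipschitz for the
  Skorokhod distance.\<close>

lemma continuous_path_sup: "continuous_map skorokhod_topology euclideanreal path_sup"
proof -
  have "\<exists>\<delta>>0. \<forall>y. y \<in> cadlag01 \<and> skorokhod_dist x y < \<delta> \<longrightarrow> dist (path_sup x) (path_sup y) < \<epsilon>"
    if x: "x \<in> cadlag01" and e: "0 < \<epsilon>" for x \<epsilon>
  proof (intro exI[of _ \<epsilon>] conjI allI impI e)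
    fix y assume y: "y \<in> cadlag01 \<and> skorokhod_dist x y < \<epsilon>"
    then obtain r where "0 < r" "r < \<epsilon>" "skorokhod_close x y r"
      using skorokhod_dist_less_iff[OF x, of y \<epsilon>] by auto
    then show "dist (path_sup x) (path_sup y) < \<epsilon>"
      using path_sup_close[of y x r] path_sup_close[of x y r] skorokhod_close_sym[of x y r] x y
      by (simp add: dist_real_def abs_less_iff)
  qed
  then have "continuous_map (Metric_space.mtopology cadlag01 skorokhod_dist) (Metric_space.mtopology UNIV dist) path_sup"
    using Metric_space.metric_continuous_map[OF Metric_space_skorokhod Met_TC.Metric_space_axioms, of path_sup]
    by auto
  then show ?thesis by (simp add: skorokhod_topology_def mtopology_is_euclidean)
qed

lemma measurable_path_sup: "path_sup \<in> borel_measurable skorokhod_borel"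
proof (rule borel_measurableI)
  fix U :: "real set" assume "open U"
  then have "openin skorokhod_topology {x \<in> topspace skorokhod_topology. path_sup x \<in> U}"
    by (intro openin_continuous_map_preimage[OF continuous_path_sup]) simp
  moreover have "topspace skorokhod_topology = cadlag01"
    by (simp add: skorokhod_topology_def Metric_space.topspace_mtopology[OF Metric_space_skorokhod])
  moreover have "path_sup -` U \<inter> space skorokhod_borel = {x \<in> cadlag01. path_sup x \<in> U}"
    by (auto simp: space_skorokhod_borel)
  ultimately show "path_sup -` U \<inter> space skorokhod_borel \<in> sets skorokhod_borel"
    by (simp add: sets_skorokhod_borel)
qed

lemma path_sup_step_path:
  assumes "i \<le> n" "0 < n"
  shows "\<bar>v i\<bar> \<le> path_sup (step_path n v)"
proof -
  have t: "real i / real n \<in> {0..1}" using assms by simp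
  have "step_path n v (real i / real n) = v i"
    using t assms by (simp add: step_path_def)
  then show ?thesis using path_sup_upper[OF step_path_cadlag t, of n v] by simp
qed

lemma not_converges_in_law_D_if_not_tight:
  assumes "prob_space P" and X: "\<And>n k. X n k \<in> borel_measurable P" and N: "wiener_law N"
    and large: "\<And>K n0. \<exists>n\<ge>n0. 0 < n \<and> 1/4 \<le> measure P {x \<in> space P. \<exists>i\<le>n. K \<le> \<bar>X n i x\<bar>}"
  shows "\<not> converges_in_law_D P (\<lambda>n \<omega>. step_path n (\<lambda>k. X n k \<omega>)) N"
proof
  assume conv: "converges_in_law_D P (\<lambda>n \<omega>. step_path n (\<lambda>k. X n k \<omega>)) N"
  interpret prob_space P by fact
  have N': "prob_space N" "sets N = sets skorokhod_borel" using N by (auto simp: wiener_law_def)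
  have mN: "path_sup \<in> borel_measurable N"
    using measurable_path_sup measurable_cong_sets[OF N'(2) refl] by blast
  have "(\<lambda>K. \<integral>x. clip (path_sup x - real K) \<partial>N) \<longlonglongrightarrow> 0"
    by (rule integral_clip_tendsto_0[OF N'(1) mN])
  then have "eventually (\<lambda>K. (\<integral>x. clip (path_sup x - real K) \<partial>N) < 1/4) sequentially"
    by (rule order_tendstoD) simp
  then obtain K :: nat where K: "(\<integral>x. clip (path_sup x - real K) \<partial>N) < 1/4"
    by (auto simp: eventually_sequentially)
  have "continuous_map euclideanreal euclideanreal (\<lambda>y. clip (y - real K))"
    unfolding clip_def by (simp add: continuous_map_iff_continuous2) (intro continuous_intros)
  then have "continuous_map skorokhod_topology euclideanreal (\<lambda>x. clip (path_sup x - real K))"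
    by (rule continuous_map_compose[OF continuous_path_sup, unfolded comp_def])
  moreover have "bounded ((\<lambda>x. clip (path_sup x - real K)) ` cadlag01)"
    using clip_bounds by (intro boundedI[of _ 1]) auto
  ultimately have "(\<lambda>n. \<integral>\<omega>. clip (path_sup (step_path n (\<lambda>k. X n k \<omega>)) - real K) \<partial>P) \<longlonglongrightarrow> (\<integral>x. clip (path_sup x - real K) \<partial>N)"
    using conv by (auto simp: converges_in_law_D_def)
  then have "eventually (\<lambda>n. (\<integral>\<omega>. clip (path_sup (step_path n (\<lambda>k. X n k \<omega>)) - real K) \<partial>P) < 1/4) sequentially"
    using K by (rule order_tendstoD)
  then obtain n0 where n0: "\<And>n. n0 \<le> n \<Longrightarrow> (\<integral>\<omega>. clip (path_sup (step_path n (\<lambda>k. X n k \<omega>)) - real K) \<partial>P) < 1/4"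
    by (auto simp: eventually_sequentially)
  obtain n where n: "n0 \<le> n" "0 < n" "1/4 \<le> prob {x \<in> space P. \<exists>i\<le>n. real K + 1 \<le> \<bar>X n i x\<bar>}"
    using large by blast
  have "prob {x \<in> space P. \<exists>i\<le>n. real K + 1 \<le> \<bar>X n i x\<bar>} \<le> (\<integral>\<omega>. clip (path_sup (step_path n (\<lambda>k. X n k \<omega>)) - real K) \<partial>P)"
  proof (rule measure_le_integral_clip)
    show "(\<lambda>\<omega>. path_sup (step_path n (\<lambda>k. X n k \<omega>))) \<in> borel_measurable P"
      by (rule measurable_compose[OF measurable_step_path measurable_path_sup]) (rule X)
    have [measurable]: "X n i \<in> borel_measurable P" for i by (rule X)
    have "{x \<in> space P. real K + 1 \<le> \<bar>X n i x\<bar>} \<in> sets P" for i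
      by measurable
    then have "{x \<in> space P. \<exists>i\<in>{..n}. real K + 1 \<le> \<bar>X n i x\<bar>} \<in> sets P"
      by (rule sets.sets_Collect_finite_Ex) simp
    then show "{x \<in> space P. \<exists>i\<le>n. real K + 1 \<le> \<bar>X n i x\<bar>} \<in> sets P"
      by (simp add: Bex_def)
    fix x assume "x \<in> {x \<in> space P. \<exists>i\<le>n. real K + 1 \<le> \<bar>X n i x\<bar>}"
    then obtain i where "i \<le> n" "real K + 1 \<le> \<bar>X n i x\<bar>" by auto
    then show "real K + 1 \<le> path_sup (step_path n (\<lambda>k. X n k x))"
      using path_sup_step_path[of i n "\<lambda>k. X n k x"] n(2) by linarith
  qed (rule prob_space_axioms)
  then show False using n n0[OF n(1)] by linarith
qed

section \<open>Large coordinates\<close>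

locale heavy_tailed = slow_weights +
  fixes w :: "nat \<Rightarrow> real"
  assumes tail: "(1/2) ^ Suc k \<le> measure \<nu> {x. w k \<le> \<bar>x\<bar>}"
    and w_nonneg: "0 \<le> w k"
    and w_large: "filterlim (\<lambda>k. (w k)\<^sup>2 / V (2 ^ Suc k + 1)) at_top sequentially"
begin

text \<open>Positions start at 1, where the signs become random under
  \<open>future_sign_law\<close>. There are 2^Suc k of them, matching the tail bound, so on average
  at least one coordinate is large.\<close>

definition big :: "nat \<Rightarrow> (int \<Rightarrow> real) set" where
  "big k = {\<omega>. \<exists>j\<in>{1..2 ^ Suc k}. w k \<le> \<bar>\<omega> j\<bar>}"

text \<open>The range of n extends to 2^Suc k + 1 because the coordinate j is tested at time j +
  1.\<close>

lemma eventually_w_large: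
  assumes "0 < K"
  shows "eventually (\<lambda>k. \<forall>n\<le>2 ^ Suc k + 1. K * \<sigma> n \<le> b 0 * w k) sequentially"
proof -
  \<comment> \<open>The factor 2 pays for the bound of \<open>V n + W n\<close> by
    \<open>2 * V n\<close>.\<close>
  have "eventually (\<lambda>k. 2 * K\<^sup>2 / (b 0)\<^sup>2 \<le> (w k)\<^sup>2 / V (2 ^ Suc k + 1)) sequentially"
    using w_large by (simp add: filterlim_at_top)
  then show ?thesis
  proof eventually_elim
    case (elim k)
    show ?case
    proof (intro allI impI)
      fix n :: nat assume n: "n \<le> 2 ^ Suc k + 1"
      let ?V = "V (2 ^ Suc k + 1)"
      have V: "0 < ?V" by (rule V_pos) simp
      have "(K * \<sigma> n)\<^sup>2 = K\<^sup>2 * (V n + W n)"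
        by (simp add: power_mult_distrib \<sigma>_eq V_nonneg W_nonneg)
      also have "\<dots> \<le> K\<^sup>2 * (2 * ?V)"
        using W_le_V[of n] V_mono[OF n] by (intro mult_left_mono) auto
      also have "\<dots> \<le> (b 0 * w k)\<^sup>2"
        using elim V b_0_pos by (simp add: field_simps power_mult_distrib)
      finally show "K * \<sigma> n \<le> b 0 * w k"
        using b_0_pos w_nonneg[of k] by (intro power2_le_imp_le[of "K * \<sigma> n"]) simp_all
    qed
  qed
qed

text \<open>The case n = 1 of the previous bound, with K chosen so that
  \<open>K * \<sigma> 1\<close> is \<open>b 0 * (\<bar>x\<bar> + 1)\<close>.\<close>

lemma eventually_w_gt: "eventually (\<lambda>k. x < w k) sequentially"
proof -
  define K where "K = b 0 * (\<bar>x\<bar> + 1) / \<sigma> 1"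
  have \<sigma>1: "0 < \<sigma> 1" by (rule \<sigma>_pos) simp
  then have "0 < K" using b_0_pos by (simp add: K_def)
  from eventually_w_large[OF this] show ?thesis
  proof eventually_elim
    case (elim k)
    then have "K * \<sigma> 1 \<le> b 0 * w k" by simp
    then have "b 0 * (\<bar>x\<bar> + 1) \<le> b 0 * w k" using \<sigma>1 by (simp add: K_def)
    then show ?case using b_0_pos by simp
  qed
qed

lemma sets_coordinate_large: "{\<omega>. w k \<le> \<bar>\<omega> j\<bar>} \<in> sets M"
proof -
  have "{\<omega> \<in> space M. w k \<le> \<bar>\<omega> j\<bar>} \<in> sets M" by measurable
  then show ?thesis by simp
qed

lemma sets_big: "big k \<in> sets M"
proof -
  have "big k = (\<Union>j\<in>{1..2 ^ Suc k}. {\<omega>. w k \<le> \<bar>\<omega> j\<bar>})" by (auto simp: big_def)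
  also have "\<dots> \<in> sets M" by (intro sets.finite_UN sets_coordinate_large) simp
  finally show ?thesis .
qed

text \<open>With N = 2^Suc k, independence bounds the probability of no large coordinate by (1 -
  1/N)^N \<le> exp (-1) \<le> 1/2.\<close>

lemma prob_big: "1/2 \<le> prob (big k)"
proof -
  define N :: nat where "N = 2 ^ Suc k"
  have N: "0 < real N" by (simp add: N_def)
  have sm: "{x. \<bar>x\<bar> < w k} \<in> sets borel" by measurable
  have cm: "UNIV - {x. w k \<le> \<bar>x\<bar>} = {x. \<bar>x\<bar> < w k}" by auto
  have "{x. w k \<le> \<bar>x\<bar>} \<in> sets \<nu>" unfolding sets_\<nu> by measurable
  then have "measure \<nu> {x. \<bar>x\<bar> < w k} = 1 - measure \<nu> {x. w k \<le> \<bar>x\<bar>}"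
    using product.M.prob_compl[of "{x. w k \<le> \<bar>x\<bar>}"] by (simp add: cm)
  also have "\<dots> \<le> 1 - 1 / real N"
    using tail[of k] by (simp add: N_def power_divide)
  also have "\<dots> \<le> exp (- (1 / real N))"
    using exp_ge_add_one_self[of "- (1 / real N)"] by simp
  finally have p: "measure \<nu> {x. \<bar>x\<bar> < w k} \<le> exp (- (1 / real N))" .
  have "UNIV - big k = {\<omega>. \<forall>j\<in>{1..2 ^ Suc k}. \<omega> j \<in> {x. \<bar>x\<bar> < w k}}"
    by (auto simp: big_def not_le)
  then have "prob (UNIV - big k) = measure \<nu> {x. \<bar>x\<bar> < w k} ^ card {1..2 ^ Suc k :: int}"
    using prob_cylinder[of "{1..2 ^ Suc k}" "\<lambda>_. {x. \<bar>x\<bar> < w k}"] sm by simp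
  also have "card {1..2 ^ Suc k :: int} = N"
    by (simp add: N_def nat_power_eq nat_mult_distrib)
  also have "measure \<nu> {x. \<bar>x\<bar> < w k} ^ N \<le> exp (- (1 / real N)) ^ N"
    by (intro power_mono p measure_nonneg)
  also have "\<dots> = exp (- 1)"
    using N by (simp add: exp_of_nat_mult[symmetric])
  also have "\<dots> \<le> 1 / 2"
    using exp_ge_add_one_self[of 1] by (simp add: exp_minus field_simps)
  finally show ?thesis
    using prob_compl[OF sets_big[of k]] by simp
qed

text \<open>Continuity from above is enough: any positive probability refutes an almost sure
  statement, so no Borel-Cantelli argument is made.\<close>

lemma prob_limsup_big: "1/2 \<le> prob (\<Inter>n. \<Union>k\<in>{n..}. big k)"
proof -
  have "(\<lambda>n. prob (\<Union>k\<in>{n..}. big k)) \<longlonglongrightarrow> prob (\<Inter>n. \<Union>k\<in>{n..}. big k)"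
  proof (rule finite_Lim_measure_decseq)
    show "decseq (\<lambda>n. \<Union>k\<in>{n..}. big k)" by (intro decseq_SucI UN_mono) auto
  qed (auto simp: sets_big intro!: sets.countable_UN')
  moreover have "1/2 \<le> prob (\<Union>k\<in>{n..}. big k)" for n
  proof -
    have "prob (big n) \<le> prob (\<Union>k\<in>{n..}. big k)"
      by (rule finite_measure_mono) (auto simp: sets_big intro!: sets.countable_UN')
    then show ?thesis using prob_big[of n] by linarith
  qed
  ultimately show ?thesis by (intro LIMSEQ_le_const) auto
qed

text \<open>At time j + 1 the coordinate j is the newest one and carries the weight
  \<open>b 0\<close>.\<close>

lemma D_flip_one:
  assumes "1 \<le> j" "n = nat j + 1"
  shows "D n (flip (\<lambda>i. i = j) \<omega>) = D n \<omega> - 2 * b 0 * \<omega> j"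
proof -
  obtain m where m: "n - 1 = Suc m" "j = int (Suc m)"
    using assms by (intro that[of "nat j - 1"]) auto
  have "D n (flip (\<lambda>i. i = j) \<omega>) = b 0 * - \<omega> j + (\<Sum>l<m. b (Suc l) * \<omega> (int (Suc m) - int (Suc l)))"
    unfolding D_def m(1) sum.lessThan_Suc_shift by (simp add: flip_apply m(2))
  moreover have "D n \<omega> = b 0 * \<omega> j + (\<Sum>l<m. b (Suc l) * \<omega> (int (Suc m) - int (Suc l)))"
    unfolding D_def m(1) sum.lessThan_Suc_shift by (simp add: m(2))
  ultimately show ?thesis by simp
qed

subsection \<open>Failure of the quenched central limit theorem\<close>

text \<open>For large k the finitely many coordinates up to n0 are all below \<open>w k\<close>, so
  the large coordinate provided by \<open>big k\<close> lies beyond n0.\<close>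

lemma infinitely_many_big_steps:
  assumes \<omega>: "\<omega> \<in> (\<Inter>n. \<Union>k\<in>{n..}. big k)" and K: "0 < K"
  shows "\<exists>j. 1 \<le> j \<and> n0 \<le> nat j + 1 \<and> K * \<sigma> (nat j + 1) \<le> b 0 * \<bar>\<omega> j\<bar>"
proof -
  have "eventually (\<lambda>k. \<forall>j\<in>{1..int n0}. \<bar>\<omega> j\<bar> < w k) sequentially"
    by (intro eventually_ball_finite ballI eventually_w_gt) simp
  then have "eventually (\<lambda>k. (\<forall>j\<in>{1..int n0}. \<bar>\<omega> j\<bar> < w k) \<and> (\<forall>n\<le>2 ^ Suc k + 1. K * \<sigma> n \<le> b 0 * w k)) sequentially"
    using eventually_w_large[OF K] by (rule eventually_conj)
  then obtain k0 where k0: "\<And>k. k0 \<le> k \<Longrightarrow> (\<forall>j\<in>{1..int n0}. \<bar>\<omega> j\<bar> < w k) \<and> (\<forall>n\<le>2 ^ Suc k + 1. K * \<sigma> n \<le> b 0 * w k)"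
    unfolding eventually_sequentially by blast
  obtain k where k: "k0 \<le> k" "\<omega> \<in> big k" using \<omega> by auto
  then obtain j where j: "1 \<le> j" "j \<le> 2 ^ Suc k" "w k \<le> \<bar>\<omega> j\<bar>" by (auto simp: big_def)
  have "\<not> j \<le> int n0"
    using k0[OF k(1)] j by (meson atLeastAtMost_iff not_less)
  moreover have "nat j + 1 \<le> 2 ^ Suc k + 1"
    using j(2) by (simp add: nat_le_iff)
  then have "K * \<sigma> (nat j + 1) \<le> b 0 * w k" using k0[OF k(1)] by blast
  then have "K * \<sigma> (nat j + 1) \<le> b 0 * \<bar>\<omega> j\<bar>"
    using mult_left_mono[OF j(3), of "b 0"] b_0_pos by linarith
  ultimately show ?thesis using j(1) by (intro exI[of _ j]) auto
qed

text \<open>h stands for everything known to \<open>F 0\<close>, which is constant along the orbit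
  of \<omega>; with it both normalized sequences are covered at once.\<close>

lemma not_clt_future_sign_law:
  assumes \<omega>: "\<omega> \<in> (\<Inter>n. \<Union>k\<in>{n..}. big k)"
    and Y [measurable]: "\<And>n. Y n \<in> borel_measurable M"
    and h: "\<And>n s. Y n (flip_future s \<omega>) = (D n (flip_future s \<omega>) + h n) / \<sigma> n"
  shows "\<not> clt (future_sign_law \<omega>) Y"
proof (rule not_clt_if_not_tight)
  show "prob_space (future_sign_law \<omega>)" by (rule prob_space_future_sign_law)
  have sets: "sets (future_sign_law \<omega>) = sets M" by (simp add: future_sign_law_def)
  show "Y n \<in> borel_measurable (future_sign_law \<omega>)" for n
    using Y[of n] unfolding measurable_cong_sets[OF sets refl] .
  fix K :: real and n0 :: nat
  obtain j where j: "1 \<le> j" "n0 \<le> nat j + 1" "max K 1 * \<sigma> (nat j + 1) \<le> b 0 * \<bar>\<omega> j\<bar>"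
    using infinitely_many_big_steps[OF \<omega> max_1_pos, of n0 K] by blast
  define n where "n = nat j + 1"
  have \<sigma>n: "0 < \<sigma> n" by (rule \<sigma>_pos) (simp add: n_def)
  let ?E = "{s. flip_future s \<omega> \<in> {x. K \<le> \<bar>Y n x\<bar>}}"
  let ?\<psi> = "\<lambda>s i. s i \<noteq> (i = j)"
  have E: "{x. K \<le> \<bar>Y n x\<bar>} \<in> sets M"
  proof -
    have "{x \<in> space M. K \<le> \<bar>Y n x\<bar>} \<in> sets M" by measurable
    then show ?thesis by simp
  qed
  have "1/2 \<le> measure coins ?E"
  proof (rule half_le_measure[OF prob_space_coins])
    show "?\<psi> \<in> measurable coins coins"
      unfolding measurable_cong_sets[OF refl sets_coins]
      by (intro measurable_PiM_single') (auto simp: space_PiM)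
    show "distr coins coins ?\<psi> = coins" by (rule distr_coins_xor)
    show "?E \<in> sets coins"
      using measurable_sets[OF measurable_flip_future E, of \<omega>] by (simp add: vimage_def)
    fix s
    let ?x = "flip_future s \<omega>"
    have "(\<lambda>i. 0 < i \<and> ?\<psi> s i) = (\<lambda>i. (i = j) \<noteq> (0 < i \<and> s i))"
      using j(1) by auto
    then have x': "flip_future (?\<psi> s) \<omega> = flip (\<lambda>i. i = j) ?x"
      unfolding flip_future_def flip_flip by simp
    have "\<bar>?x j\<bar> = \<bar>\<omega> j\<bar>" by (simp add: flip_future_def flip_def)
    then have "2 * (max K 1 * \<sigma> n) \<le> \<bar>2 * b 0 * ?x j\<bar>"
      using j(3) b_0_pos by (simp add: abs_mult n_def)
    \<comment> \<open>The term \<open>h n\<close> cancels in the difference, and two numbers at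
      distance at least 2m cannot both have modulus below m.\<close>
    also have "2 * b 0 * ?x j = (D n ?x + h n) - (D n (flip (\<lambda>i. i = j) ?x) + h n)"
      using D_flip_one[OF j(1) n_def, of ?x] by simp
    finally have "max K 1 * \<sigma> n \<le> \<bar>D n ?x + h n\<bar> \<or> max K 1 * \<sigma> n \<le> \<bar>D n (flip (\<lambda>i. i = j) ?x) + h n\<bar>"
      by linarith
    then have "max K 1 \<le> \<bar>Y n ?x\<bar> \<or> max K 1 \<le> \<bar>Y n (flip_future (?\<psi> s) \<omega>)\<bar>"
      using \<sigma>n unfolding h unfolding x' by (simp add: pos_le_divide_eq del: max.bounded_iff max_less_iff_conj)
    then show "s \<in> ?E \<or> ?\<psi> s \<in> ?E" by auto
  qed
  then have "1/2 \<le> measure (future_sign_law \<omega>) {x. K \<le> \<bar>Y n x\<bar>}"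
    by (simp add: measure_future_sign_law[OF E])
  moreover have "space (future_sign_law \<omega>) = UNIV" by (simp add: future_sign_law_def)
  ultimately show "\<exists>n\<ge>n0. 1/2 \<le> measure (future_sign_law \<omega>) {x \<in> space (future_sign_law \<omega>). K \<le> \<bar>Y n x\<bar>}"
    using j(2) by (intro exI[of _ n]) (simp add: n_def)
qed

lemma not_quenched_clt:
  assumes Y: "\<And>n. Y n \<in> borel_measurable M"
    and h: "\<And>\<omega> n s. good \<omega> \<Longrightarrow> Y n (flip_future s \<omega>) = (D n (flip_future s \<omega>) + h n \<omega>) / \<sigma> n"
  shows "\<not> quenched_clt M future_sign_law Y"
proof
  assume "quenched_clt M future_sign_law Y"
  then have "AE \<omega> in M. clt (future_sign_law \<omega>) Y" by (simp add: quenched_clt_def)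
  with AE_good have ae: "AE \<omega> in M. \<omega> \<notin> (\<Inter>n. \<Union>k\<in>{n..}. big k)"
  proof eventually_elim
    case (elim \<omega>)
    then show ?case using not_clt_future_sign_law[of \<omega> Y "\<lambda>n. h n \<omega>"] Y h by blast
  qed
  have "(\<Inter>n. \<Union>k\<in>{n..}. big k) \<in> sets M"
    by (intro sets.countable_INT' sets.countable_UN') (auto simp: sets_big)
  then have "prob (\<Inter>n. \<Union>k\<in>{n..}. big k) = 0"
    using ae by (subst (asm) AE_iff_measurable[of "\<Inter>n. \<Union>k\<in>{n..}. big k"]) (auto simp: measure_def)
  then show False using prob_limsup_big by simp
qed

lemma not_quenched_clt_S: "\<not> quenched_clt M future_sign_law (\<lambda>n x. S n x / \<sigma> n)"
proof (rule not_quenched_clt)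
  fix \<omega> n s assume g: "good \<omega>"
  then have "good (flip_future s \<omega>)" by (simp add: flip_future_def)
  moreover have "Q n (flip_future s \<omega>) = Q n \<omega>"
    unfolding flip_future_def by (rule measurable_F_invariant[OF measurable_F_Q]) simp
  ultimately show "S n (flip_future s \<omega>) / \<sigma> n = (D n (flip_future s \<omega>) + Q n \<omega>) / \<sigma> n"
    by (simp add: S_eq_D_Q)
qed measurable

text \<open>\<open>ES n\<close> equals \<open>Q n\<close> only almost everywhere, and the orbit of a
  given \<omega> might lie in the exceptional set. But both are measurable for \<open>F 0\<close>,
  hence constant along the orbit, and their difference is absorbed into h.\<close>

lemma not_quenched_clt_S_minus_ES: "\<not> quenched_clt M future_sign_law (\<lambda>n x. (S n x - ES n x) / \<sigma> n)"
proof (rule not_quenched_clt)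
  fix \<omega> n s assume g: "good \<omega>"
  then have "good (flip_future s \<omega>)" by (simp add: flip_future_def)
  moreover have "Q n (flip_future s \<omega>) = Q n \<omega>" "ES n (flip_future s \<omega>) = ES n \<omega>"
    unfolding flip_future_def
    by (rule measurable_F_invariant[OF measurable_F_Q], simp) (rule measurable_F_invariant[OF measurable_F_ES], simp)
  ultimately show "(S n (flip_future s \<omega>) - ES n (flip_future s \<omega>)) / \<sigma> n
      = (D n (flip_future s \<omega>) + (Q n \<omega> - ES n \<omega>)) / \<sigma> n"
    by (simp add: S_eq_D_Q)
qed measurable

subsection \<open>Failure of the weak invariance principle\<close>

text \<open>Decomposition by the first large position: the pieces are disjoint and, being defined
  through absolute values, are unchanged by sign reversals.\<close>

definition first_big :: "nat \<Rightarrow> int \<Rightarrow> (int \<Rightarrow> real) set" where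
  "first_big k j = {\<omega>. w k \<le> \<bar>\<omega> j\<bar> \<and> (\<forall>i\<in>{1..<j}. \<bar>\<omega> i\<bar> < w k)}"

lemma sets_first_big: "first_big k j \<in> sets M"
proof -
  have "first_big k j = {\<omega>. w k \<le> \<bar>\<omega> j\<bar>} - (\<Union>i\<in>{1..<j}. {\<omega>. w k \<le> \<bar>\<omega> i\<bar>})"
    by (auto simp: first_big_def not_le)
  also have "\<dots> \<in> sets M" by (intro sets.Diff sets.finite_UN sets_coordinate_large) simp
  finally show ?thesis .
qed

lemma disjoint_first_big: "disjoint_family_on (first_big k) {1..}"
  unfolding disjoint_family_on_def
proof (intro ballI impI)
  fix i j :: int assume ij: "i \<in> {1..}" "j \<in> {1..}" "i \<noteq> j"
  show "first_big k i \<inter> first_big k j = {}"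
    using ij by (cases "i < j") (force simp: first_big_def)+
qed

lemma big_eq_first_big: "big k = (\<Union>j\<in>{1..2 ^ Suc k}. first_big k j)"
proof (rule antisym; rule subsetI)
  fix \<omega> assume "\<omega> \<in> big k"
  then obtain j where j: "j \<in> {1..2 ^ Suc k}" "w k \<le> \<bar>\<omega> j\<bar>" by (auto simp: big_def)
  let ?P = "\<lambda>m. 1 \<le> m \<and> w k \<le> \<bar>\<omega> (int m)\<bar>"
  have P: "?P (nat j)" using j by (auto simp: le_nat_iff)
  \<comment> \<open>The minimum is taken over natural numbers because the integers are not
    well-ordered.\<close>
  define m where "m = (LEAST m. ?P m)"
  have m: "?P m" "m \<le> nat j" unfolding m_def using P by (rule LeastI, rule Least_le)
  have "\<bar>\<omega> i\<bar> < w k" if i: "1 \<le> i" "i < int m" for i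
  proof -
    have "nat i < m" using i by simp
    then have "\<not> ?P (nat i)" unfolding m_def by (rule not_less_Least)
    then show ?thesis using i by (auto simp: le_nat_iff)
  qed
  then have "\<omega> \<in> first_big k (int m)" using m(1) by (auto simp: first_big_def)
  moreover have "int m \<in> {1..2 ^ Suc k}" using m j by auto
  ultimately show "\<omega> \<in> (\<Union>j\<in>{1..2 ^ Suc k}. first_big k j)" by blast
qed (auto simp: big_def first_big_def)

definition large_sum :: "nat \<Rightarrow> int \<Rightarrow> (int \<Rightarrow> real) set" where
  "large_sum k j = {\<omega>. b 0 * w k \<le> \<bar>S (nat j + 1) \<omega>\<bar>}"

lemma sets_large_sum: "large_sum k j \<in> sets M"
proof -
  have "{\<omega> \<in> space M. b 0 * w k \<le> \<bar>S (nat j + 1) \<omega>\<bar>} \<in> sets M" by measurable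
  then show ?thesis by (simp add: large_sum_def)
qed

text \<open>Reversing the sign of the first large coordinate moves the partial sum by twice its weight,
  so that one of the two partial sums is large.\<close>

lemma prob_first_big_le:
  assumes j: "1 \<le> j"
  shows "prob (first_big k j) \<le> 2 * prob (first_big k j \<inter> large_sum k j)"
proof -
  let ?E = "first_big k j \<inter> large_sum k j" and ?f = "flip (\<lambda>i. i = j)"
  have E: "?E \<in> sets M" by (intro sets.Int sets_first_big sets_large_sum)
  have fE: "?f -` ?E \<in> sets M" using measurable_sets[OF measurable_flip E] by simp
  have "prob (first_big k j) \<le> prob (?E \<union> ?f -` ?E)"
  proof (rule finite_measure_mono_AE)
    show "AE \<omega> in M. \<omega> \<in> first_big k j \<longrightarrow> \<omega> \<in> ?E \<union> ?f -` ?E"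
      using AE_good
    proof eventually_elim
      case (elim \<omega>)
      let ?n = "nat j + 1"
      have "Q ?n (?f \<omega>) = Q ?n \<omega>"
        by (rule measurable_F_invariant[OF measurable_F_Q]) (use j in auto)
      then have d: "S ?n (?f \<omega>) = S ?n \<omega> - 2 * b 0 * \<omega> j"
        using elim D_flip_one[OF j refl, of \<omega>] by (simp add: S_eq_D_Q)
      show ?case
      proof
        assume f: "\<omega> \<in> first_big k j"
        then have "2 * (b 0 * w k) \<le> \<bar>2 * b 0 * \<omega> j\<bar>"
          using b_0_pos by (simp add: first_big_def abs_mult)
        then have "b 0 * w k \<le> \<bar>S ?n \<omega>\<bar> \<or> b 0 * w k \<le> \<bar>S ?n (?f \<omega>)\<bar>"
          using d by linarith
        moreover have "?f \<omega> \<in> first_big k j"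
          using f by (auto simp: first_big_def flip_apply)
        ultimately show "\<omega> \<in> ?E \<union> ?f -` ?E"
          using f by (auto simp: large_sum_def)
      qed
    qed
  qed (use E fE in auto)
  also have "\<dots> \<le> prob ?E + prob (?f -` ?E)"
    by (rule measure_Un_le[OF E fE])
  also have "prob (?f -` ?E) = prob ?E" by (rule prob_flip[OF E])
  finally show ?thesis by simp
qed

text \<open>In the manner of a reflection inequality: on each disjoint piece at least half of the
  probability also has a large sum, and summation over the pieces loses only this factor 2.\<close>

lemma prob_large_sum: "1/4 \<le> prob (\<Union>j\<in>{1..2 ^ Suc k}. large_sum k j)"
proof -
  let ?J = "{1..2 ^ Suc k :: int}"
  have dis: "disjoint_family_on (first_big k) ?J"
    by (rule disjoint_family_on_mono[OF _ disjoint_first_big]) auto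
  have "1/2 \<le> prob (\<Union>j\<in>?J. first_big k j)"
    using prob_big[of k] by (simp add: big_eq_first_big)
  also have "\<dots> = (\<Sum>j\<in>?J. prob (first_big k j))"
    by (rule finite_measure_finite_Union[OF _ _ dis]) (auto simp: sets_first_big)
  also have "\<dots> \<le> (\<Sum>j\<in>?J. 2 * prob (first_big k j \<inter> large_sum k j))"
    by (intro sum_mono prob_first_big_le) simp
  also have "\<dots> = 2 * (\<Sum>j\<in>?J. prob (first_big k j \<inter> large_sum k j))"
    by (simp add: sum_distrib_left)
  also have "(\<Sum>j\<in>?J. prob (first_big k j \<inter> large_sum k j)) = prob (\<Union>j\<in>?J. first_big k j \<inter> large_sum k j)"
  proof (rule finite_measure_finite_Union[symmetric])
    show "disjoint_family_on (\<lambda>j. first_big k j \<inter> large_sum k j) ?J"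
      using dis unfolding disjoint_family_on_def by blast
  qed (auto intro!: sets_first_big sets_large_sum)
  also have "\<dots> \<le> prob (\<Union>j\<in>?J. large_sum k j)"
    by (rule finite_measure_mono) (auto intro!: sets.finite_UN sets_large_sum)
  finally show ?thesis by simp
qed

lemma not_weak_invariance_principle: "\<not> weak_invariance_principle M S \<sigma>"
proof
  assume "weak_invariance_principle M S \<sigma>"
  then obtain N where N: "wiener_law N"
    and conv: "converges_in_law_D M (\<lambda>n \<omega>. step_path n (\<lambda>k. S k \<omega> / \<sigma> n)) N"
    by (auto simp: weak_invariance_principle_def)
  have "\<not> converges_in_law_D M (\<lambda>n \<omega>. step_path n (\<lambda>k. S k \<omega> / \<sigma> n)) N"
  proof (rule not_converges_in_law_D_if_not_tight[OF prob_space_axioms _ N])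
    show "(\<lambda>\<omega>. S k \<omega> / \<sigma> n) \<in> borel_measurable M" for n k by measurable
    fix K :: real and n0 :: nat
    obtain k0 where k0: "\<And>k. k0 \<le> k \<Longrightarrow> \<forall>n\<le>2 ^ Suc k + 1. max K 1 * \<sigma> n \<le> b 0 * w k"
      using eventually_w_large[OF max_1_pos, of K] unfolding eventually_sequentially by blast
    define k where "k = max k0 n0"
    \<comment> \<open>The last time j + 1 at which a coordinate of \<open>big k\<close> is
      tested.\<close>
    define n :: nat where "n = 2 ^ Suc k + 1"
    have "k < 2 ^ Suc k" by (rule less_trans[OF lessI less_exp])
    then have n: "n0 \<le> n" "0 < n" by (auto simp: n_def k_def)
    have \<sigma>n: "0 < \<sigma> n" by (rule \<sigma>_pos[OF n(2)])
    have "max K 1 * \<sigma> n \<le> b 0 * w k" using k0[of k] by (simp add: k_def n_def)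
    then have K: "K * \<sigma> n \<le> b 0 * w k"
      using mult_right_mono[of K "max K 1" "\<sigma> n"] \<sigma>n by linarith
    have "1/4 \<le> prob (\<Union>j\<in>{1..2 ^ Suc k}. large_sum k j)" by (rule prob_large_sum)
    also have "\<dots> \<le> prob {x \<in> space M. \<exists>i\<le>n. K \<le> \<bar>S i x / \<sigma> n\<bar>}"
    proof (rule finite_measure_mono)
      have "{x \<in> space M. K \<le> \<bar>S i x / \<sigma> n\<bar>} \<in> sets M" for i by measurable
      then have "{x \<in> space M. \<exists>i\<in>{..n}. K \<le> \<bar>S i x / \<sigma> n\<bar>} \<in> sets M"
        by (rule sets.sets_Collect_finite_Ex) simp
      then show "{x \<in> space M. \<exists>i\<le>n. K \<le> \<bar>S i x / \<sigma> n\<bar>} \<in> sets M"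
        by (simp add: Bex_def)
      show "(\<Union>j\<in>{1..2 ^ Suc k}. large_sum k j) \<subseteq> {x \<in> space M. \<exists>i\<le>n. K \<le> \<bar>S i x / \<sigma> n\<bar>}"
      proof
        fix x assume "x \<in> (\<Union>j\<in>{1..2 ^ Suc k}. large_sum k j)"
        then obtain j :: int where j: "j \<le> 2 ^ Suc k" "b 0 * w k \<le> \<bar>S (nat j + 1) x\<bar>"
          by (auto simp: large_sum_def)
        have "nat j + 1 \<le> n" using j(1) by (simp add: n_def nat_le_iff)
        moreover have "K \<le> \<bar>S (nat j + 1) x / \<sigma> n\<bar>"
          using j(2) K \<sigma>n by (simp add: abs_divide pos_le_divide_eq)
        ultimately show "x \<in> {x \<in> space M. \<exists>i\<le>n. K \<le> \<bar>S i x / \<sigma> n\<bar>}" by auto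
      qed
    qed
    finally show "\<exists>n\<ge>n0. 0 < n \<and> 1/4 \<le> prob {x \<in> space M. \<exists>i\<le>n. K \<le> \<bar>S i x / \<sigma> n\<bar>}"
      using n by blast
  qed
  then show False using conv by contradiction
qed

end

section \<open>Estimates for the logarithmic weights\<close>

definition log_weight :: "nat \<Rightarrow> real" where
  "log_weight l = 1 / (ln (real l + 3))\<^sup>2"

text \<open>This is the reason for the shift by 3: since e \<le> 3, all logarithms are at least 1
  and higher powers of them are larger.\<close>

lemma ln_add_3_ge_1: "1 \<le> ln (real l + 3)"
proof -
  have "exp 1 \<le> real l + 3" using exp_le by (simp add: add_increasing)
  then show ?thesis by (subst ln_ge_iff) auto
qed

lemma log_weight_le_1: "log_weight l \<le> 1"
  using ln_add_3_ge_1[of l] by (simp add: log_weight_def divide_le_eq_1)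

lemma log_weight_nonneg: "0 \<le> log_weight l"
  by (simp add: log_weight_def)

lemma decseq_log_weight: "decseq log_weight"
proof (rule decseq_SucI)
  fix l
  have "ln (real l + 3) \<le> ln (real (Suc l) + 3)" by simp
  then show "log_weight (Suc l) \<le> log_weight l"
    unfolding log_weight_def using ln_add_3_ge_1[of l] by (intro divide_left_mono power_mono) auto
qed

lemma log_weight_le:
  assumes "1 < x" "x \<le> real l + 3"
  shows "log_weight l \<le> 1 / (ln x)\<^sup>2"
proof -
  have "ln x \<le> ln (real l + 3)" "0 < ln x" using assms by simp_all
  then show ?thesis unfolding log_weight_def by (intro divide_left_mono power_mono) auto
qed

text \<open>The square of this bound is linear in x. At x = n / (l + 3) one formula then serves the
  ranges l < n and l \<ge> n alike.\<close>

lemma ln_add_one_le_2_sqrt: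
  fixes x :: real
  assumes "0 \<le> x"
  shows "ln (1 + x) \<le> 2 * sqrt x"
proof -
  have "ln (1 + x) \<le> ln ((1 + sqrt x)\<^sup>2)"
    using assms by (subst ln_le_cancel_iff) (auto simp: power2_sum intro: add_pos_nonneg)
  also have "\<dots> = 2 * ln (1 + sqrt x)"
    using assms by (simp add: ln_realpow add_pos_nonneg)
  also have "\<dots> \<le> 2 * sqrt x"
    using assms ln_add_one_self_le_self[of "sqrt x"] by simp
  finally show ?thesis .
qed

text \<open>With L \<le> R the two logarithms, 1/L^2 - 1/R^2 = (R - L)(R + L) / (L^2 R^2) is at most
  2 (R - L) / L^3, and R - L is controlled by the preceding lemma.\<close>

lemma log_weight_diff_square_le:
  "(log_weight l - log_weight (l + n))\<^sup>2 \<le> 16 * real n * (1 / ((real l + 3) * ln (real l + 3) ^ 6))"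
proof -
  let ?L = "ln (real l + 3)" and ?R = "ln (real (l + n) + 3)"
  have L: "1 \<le> ?L" "?L \<le> ?R" using ln_add_3_ge_1[of l] by simp_all
  have "?R - ?L = ln ((real (l + n) + 3) / (real l + 3))" by (simp add: ln_div)
  also have "(real (l + n) + 3) / (real l + 3) = 1 + real n / (real l + 3)" by (simp add: field_simps)
  also have "ln (1 + real n / (real l + 3)) \<le> 2 * sqrt (real n / (real l + 3))"
    by (rule ln_add_one_le_2_sqrt) simp
  finally have d: "?R - ?L \<le> 2 * sqrt (real n / (real l + 3))" .
  have "log_weight l - log_weight (l + n) = (?R - ?L) * (?R + ?L) / (?L\<^sup>2 * ?R\<^sup>2)"
    using L by (simp add: log_weight_def field_simps power2_eq_square)
  also have "\<dots> \<le> (?R - ?L) * (2 * ?R) / (?L\<^sup>2 * ?R\<^sup>2)"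
    using L by (intro divide_right_mono mult_left_mono) auto
  also have "\<dots> = 2 * (?R - ?L) / (?L\<^sup>2 * ?R)"
    using L by (simp add: field_simps power2_eq_square)
  also have "\<dots> \<le> 2 * (2 * sqrt (real n / (real l + 3))) / (?L\<^sup>2 * ?L)"
    using L d by (intro frac_le mult_left_mono) auto
  finally have "log_weight l - log_weight (l + n) \<le> 4 * sqrt (real n / (real l + 3)) / ?L ^ 3"
    by (simp add: power3_eq_cube power2_eq_square)
  moreover have "0 \<le> log_weight l - log_weight (l + n)"
    using decseqD[OF decseq_log_weight, of l "l + n"] by simp
  ultimately have "(log_weight l - log_weight (l + n))\<^sup>2 \<le> (4 * sqrt (real n / (real l + 3)) / ?L ^ 3)\<^sup>2"
    by (rule power_mono)
  also have "\<dots> = 16 * real n * (1 / ((real l + 3) * ?L ^ 6))"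
    by (simp add: power_divide power_mult_distrib)
  finally show ?thesis .
qed

lemma decreasing_weights_log_weight:
  assumes "unit_variance_sequence \<nu>"
  shows "decreasing_weights \<nu> log_weight"
proof (intro decreasing_weights.intro assms decreasing_weights_axioms.intro decseq_log_weight)
  show "log_weight \<longlonglongrightarrow> 0" unfolding log_weight_def by real_asymp
  show "0 < log_weight 0" by (simp add: log_weight_def)
qed

text \<open>\<open>V_bound\<close> and \<open>W_bound\<close> come from splitting the sums at m, the
  integer part of sqrt n: m + 1 \<ge> sqrt n replaces the arguments m + 3 and m + 2 of the
  logarithms by sqrt n + 2 and sqrt n + 1. As functions of a real variable they suit
  \<open>real_asymp\<close>.\<close>

definition V_bound :: "real \<Rightarrow> real" where
  "V_bound x = sqrt x + x / ln (sqrt x + 2) ^ 4"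

definition W_bound :: "real \<Rightarrow> real" where
  "W_bound x = sqrt x + 16 * x / ln (sqrt x + 1) ^ 5"

lemma V_log_weight_le:
  assumes "decreasing_weights \<nu> log_weight"
  shows "decreasing_weights.V log_weight n \<le> V_bound (real n)"
proof -
  interpret decreasing_weights \<nu> log_weight by fact
  define m where "m = nat \<lfloor>sqrt (real n)\<rfloor>"
  have m: "real m \<le> sqrt (real n)" "sqrt (real n) \<le> real m + 1" by (simp_all add: m_def)
  have "sqrt (real n) \<le> real n" 
  proof (rule real_le_lsqrt)
    have "n \<le> n\<^sup>2" by (simp add: power2_eq_square)
    then show "real n \<le> (real n)\<^sup>2" unfolding of_nat_power[symmetric] of_nat_le_iff .
  qed simp
  then have "m \<le> n" using m(1) by linarith
  then have "V n \<le> real m * (log_weight 0)\<^sup>2 + real n * (log_weight m)\<^sup>2" by (rule V_le)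
  also have "\<dots> \<le> sqrt (real n) * 1 + real n * (1 / ln (sqrt (real n) + 2) ^ 4)"
  proof (intro add_mono mult_mono)
    show "(log_weight 0)\<^sup>2 \<le> 1" using log_weight_le_1 log_weight_nonneg by (simp add: power_le_one)
    have "log_weight m \<le> 1 / (ln (sqrt (real n) + 2))\<^sup>2"
      using m by (intro log_weight_le) auto
    then have "(log_weight m)\<^sup>2 \<le> (1 / (ln (sqrt (real n) + 2))\<^sup>2)\<^sup>2"
      using log_weight_nonneg by (intro power_mono)
    then show "(log_weight m)\<^sup>2 \<le> 1 / ln (sqrt (real n) + 2) ^ 4"
      by (simp add: power_divide)
  qed (use m in auto)
  finally show ?thesis by (simp add: V_bound_def)
qed

text \<open>The tail sum of \<open>1 / (x ln\<^sup>6 x)\<close> is compared with the telescoping sum of the increments of \<open>1 / ln\<^sup>5 x\<close>.\<close>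

lemma eventually_W_log_weight_le:
  assumes "decreasing_weights \<nu> log_weight"
  shows "eventually (\<lambda>n. decreasing_weights.W log_weight n \<le> W_bound (real n)) sequentially"
proof -
  interpret decreasing_weights \<nu> log_weight by fact
  let ?g = "\<lambda>l :: nat. 1 / ln (real l + 2) ^ 5"
  \<comment> \<open>The derivative of -1 / ln^5 x is 5 / (x ln^6 x), so the increments exceed the
    left-hand side by a factor close to 5.\<close>
  have "eventually (\<lambda>l :: nat. 1 / ((real l + 3) * ln (real l + 3) ^ 6) \<le> 1 / ln (real l + 2) ^ 5 - 1 / ln (real l + 3) ^ 5) sequentially"
    by real_asymp
  moreover have "real (Suc l) + 2 = real l + 3" for l by simp
  ultimately obtain l0 where l0: "\<And>l. l0 \<le> l \<Longrightarrow> 1 / ((real l + 3) * ln (real l + 3) ^ 6) \<le> ?g l - ?g (Suc l)"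
    unfolding eventually_sequentially by metis
  show ?thesis
  proof (rule eventually_sequentiallyI)
    \<comment> \<open>The square puts m, the integer part of sqrt n, beyond l0, where the increments
      dominate; n \<ge> 1 keeps ln (sqrt n + 1) positive.\<close>
    fix n :: nat assume n: "max 1 ((l0 + 1)\<^sup>2) \<le> n"
    define m where "m = nat \<lfloor>sqrt (real n)\<rfloor>"
    have m: "real m \<le> sqrt (real n)" "sqrt (real n) \<le> real m + 1" by (simp_all add: m_def)
    have "real ((l0 + 1)\<^sup>2) \<le> real n" using n by (simp only: of_nat_le_iff max.bounded_iff)
    then have "real (l0 + 1) \<le> sqrt (real n)" by (intro real_le_rsqrt) simp
    then have lm: "l0 \<le> m" using m(2) by linarith
    let ?t = "\<lambda>l. (log_weight l - log_weight (l + n))\<^sup>2"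
    have t1: "?t l \<le> 1" for l
    proof -
      have "\<bar>log_weight l - log_weight (l + n)\<bar> \<le> 1"
        using log_weight_le_1[of l] log_weight_le_1[of "l + n"] log_weight_nonneg[of l] log_weight_nonneg[of "l + n"]
        by linarith
      then show ?thesis by (simp add: abs_square_le_1)
    qed
    have tail: "(\<Sum>l=m..<N. ?t l) \<le> 16 * real n * ?g m" for N
    proof (cases "m \<le> N")
      case True
      have "(\<Sum>l=m..<N. ?t l) \<le> (\<Sum>l=m..<N. 16 * real n * (?g l - ?g (Suc l)))"
      proof (rule sum_mono)
        fix l assume l: "l \<in> {m..<N}"
        have "?t l \<le> 16 * real n * (1 / ((real l + 3) * ln (real l + 3) ^ 6))"
          by (rule log_weight_diff_square_le)
        also have "\<dots> \<le> 16 * real n * (?g l - ?g (Suc l))"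
          using l lm by (intro mult_left_mono l0) auto
        finally show "?t l \<le> 16 * real n * (?g l - ?g (Suc l))" .
      qed
      also have "\<dots> = 16 * real n * (?g m - ?g N)"
        unfolding sum_distrib_left[symmetric] using sum_Suc_diff'[OF True, of "\<lambda>l. - ?g l"] by simp
      also have "\<dots> \<le> 16 * real n * ?g m" by (intro mult_left_mono) auto
      finally show ?thesis .
    qed simp
    have "W n \<le> real m + 16 * real n * ?g m"
      unfolding W_def
    proof (rule suminf_le_const[OF summable_W])
      fix N
      have "(\<Sum>l<N. ?t l) \<le> (\<Sum>l<max m N. ?t l)" by (rule sum_mono2) auto
      also have "\<dots> = (\<Sum>l<m. ?t l) + (\<Sum>l=m..<max m N. ?t l)"
        using sum.atLeastLessThan_concat[of 0 m "max m N" ?t] by (simp add: atLeast0LessThan)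
      also have "(\<Sum>l<m. ?t l) \<le> (\<Sum>l<m. 1)" by (intro sum_mono t1)
      finally show "(\<Sum>l<N. ?t l) \<le> real m + 16 * real n * ?g m" using tail[of "max m N"] by simp
    qed
    also have "\<dots> \<le> sqrt (real n) + 16 * real n * (1 / ln (sqrt (real n) + 1) ^ 5)"
    proof (intro add_mono mult_left_mono divide_left_mono power_mono)
      have "1 \<le> n" using n by (rule max.boundedE)
      then have "0 < sqrt (real n)" by simp
      then have *: "0 < ln (sqrt (real n) + 1)" by (intro ln_gt_zero) simp
      then show "0 \<le> ln (sqrt (real n) + 1)" by simp
      show le: "ln (sqrt (real n) + 1) \<le> ln (real m + 2)"
        using m by (subst ln_le_cancel_iff) (auto intro: add_nonneg_pos)
      show "0 < ln (real m + 2) ^ 5 * ln (sqrt (real n) + 1) ^ 5"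
        using * le by (intro mult_pos_pos zero_less_power) auto
    qed (use m in auto)
    finally show "W n \<le> W_bound (real n)" by (simp add: W_bound_def)
  qed
qed

text \<open>A comparison series of order 1 / (n ln^2 n) that converges by telescoping; the bound for
  the Maxwell-Woodroofe terms is of the smaller order 1 / (n ln^(5/2) n).\<close>

lemma summable_telescoping_ln: "summable (\<lambda>n. 1 / ln (real n + 2) - 1 / ln (real n + 3))"
proof -
  have "(\<lambda>n :: nat. 1 / ln (real n + 2)) \<longlonglongrightarrow> 0" by real_asymp
  from telescope_summable'[OF this] have "summable (\<lambda>n. 1 / ln (real n + 2) - 1 / ln (real (Suc n) + 2))" .
  moreover have "real (Suc n) + 2 = real n + 3" for n by simp
  ultimately show ?thesis by (simp only:)
qed

lemma slow_weights_log_weight: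
  assumes "unit_variance_sequence \<nu>"
  shows "slow_weights \<nu> log_weight"
proof -
  have dw: "decreasing_weights \<nu> log_weight" by (rule decreasing_weights_log_weight[OF assms])
  interpret decreasing_weights \<nu> log_weight by (rule dw)
  have V_ge': "real n / ln (real n + 3) ^ 4 \<le> V n" for n
    using V_ge[of n] by (simp add: log_weight_def power_divide)
  note V_le' = V_log_weight_le[OF dw] and W_le' = eventually_W_log_weight_le[OF dw]
  show ?thesis
  proof (intro slow_weights.intro dw slow_weights_axioms.intro)
    have "filterlim (\<lambda>n. real n / ln (real n + 3) ^ 4) at_top sequentially" by real_asymp
    then show "filterlim V at_top sequentially"
      by (rule filterlim_at_top_mono) (simp add: V_ge')
    show "(\<lambda>n. V n / real n) \<longlonglongrightarrow> 0"
    proof (rule tendsto_sandwich[OF _ _ tendsto_const])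
      show "(\<lambda>n. V_bound (real n) / real n) \<longlonglongrightarrow> 0" unfolding V_bound_def by real_asymp
    qed (auto simp: V_nonneg intro!: always_eventually divide_right_mono V_le')
    show "(\<lambda>n. W n / V n) \<longlonglongrightarrow> 0"
    proof (rule tendsto_sandwich[OF _ _ tendsto_const])
      show "(\<lambda>n. W_bound (real n) / (real n / ln (real n + 3) ^ 4)) \<longlonglongrightarrow> 0" unfolding W_bound_def by real_asymp
      show "eventually (\<lambda>n. W n / V n \<le> W_bound (real n) / (real n / ln (real n + 3) ^ 4)) sequentially"
        using W_le' eventually_gt_at_top[of 0]
      proof eventually_elim
        case (elim n)
        have "0 < real n / ln (real n + 3) ^ 4"
          using elim ln_add_3_ge_1[of n] by (intro divide_pos_pos zero_less_power) auto
        then show ?case using elim(1) W_nonneg[of n] V_ge' by (intro frac_le) auto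
      qed
    qed (simp add: V_nonneg W_nonneg)
    let ?h = "\<lambda>n. sqrt (1 + W_bound (real n + 1)) / (real n + 1) powr (3/2)"
    have "?h \<in> O(\<lambda>n. 1 / ln (real n + 2) - 1 / ln (real n + 3))"
      unfolding W_bound_def by real_asymp
    moreover have "summable (\<lambda>n. norm (1 / ln (real n + 2) - 1 / ln (real n + 3)))"
    proof -
      have "0 \<le> 1 / ln (real n + 2) - 1 / ln (real n + 3)" for n
        by (simp add: frac_le)
      then show ?thesis using summable_telescoping_ln by simp
    qed
    ultimately have h: "summable ?h" by (rule summable_comparison_test_bigo[rotated])
    show "summable (\<lambda>n. sqrt ((log_weight n)\<^sup>2 + W (Suc n)) / real (Suc n) powr (3/2))"
    proof (rule summable_comparison_test_ev[OF _ h])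
      have "eventually (\<lambda>n. W (Suc n) \<le> W_bound (real (Suc n))) sequentially"
        using W_le' by (rule eventually_compose_filterlim) (rule filterlim_Suc)
      then show "eventually (\<lambda>n. norm (sqrt ((log_weight n)\<^sup>2 + W (Suc n)) / real (Suc n) powr (3/2)) \<le> ?h n) sequentially"
      proof eventually_elim
        case (elim n)
        have "(log_weight n)\<^sup>2 \<le> 1" using log_weight_le_1 log_weight_nonneg by (simp add: power_le_one)
        then have "sqrt ((log_weight n)\<^sup>2 + W (Suc n)) \<le> sqrt (1 + W_bound (real n + 1))"
          using elim by (simp add: add.commute)
        then have "sqrt ((log_weight n)\<^sup>2 + W (Suc n)) / (real n + 1) powr (3/2) \<le> ?h n"
          by (rule divide_right_mono) simp
        then show ?case by (simp add: W_nonneg add.commute)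
      qed
    qed
  qed
qed

subsection \<open>A heavy-tailed symmetric law\<close>

text \<open>The \<open>k\<close>-th size has probability \<open>1 / 2 ^ (k + 1)\<close>; the other factor is a simple series summing to \<open>1\<close>, which makes the variance \<open>1\<close>.\<close>

definition value_size :: "nat \<Rightarrow> real" where
  "value_size k = sqrt (2 ^ Suc k / ((real k + 1) * (real k + 2)))"

definition signed_value :: "nat \<times> bool \<Rightarrow> real" where
  "signed_value x = (if snd x then - value_size (fst x) else value_size (fst x))"

definition value_pmf :: "(nat \<times> bool) pmf" where
  "value_pmf = pair_pmf (geometric_pmf (1/2)) (pmf_of_set UNIV)"

definition heavy_law :: "real measure" where
  "heavy_law = distr (measure_pmf value_pmf) borel signed_value"

lemma value_size_nonneg: "0 \<le> value_size k"
  by (simp add: value_size_def)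

lemma value_size_square: "(value_size k)\<^sup>2 = 2 ^ Suc k / ((real k + 1) * (real k + 2))"
  by (simp add: value_size_def)

lemma map_fst_value_pmf: "map_pmf fst value_pmf = geometric_pmf (1/2)"
  by (simp add: value_pmf_def map_fst_pair_pmf)

lemma heavy_law_symmetric: "distr heavy_law borel uminus = heavy_law"
proof -
  let ?h = "\<lambda>(k :: nat, s). (k, \<not> s)"
  have "map_pmf Not (pmf_of_set UNIV) = pmf_of_set UNIV"
    by (rule map_pmf_of_set_bij_betw) (auto simp: bij_betw_def inj_on_def image_iff)
  then have h: "map_pmf ?h value_pmf = value_pmf"
    using map_pair[of "\<lambda>k. k" Not "geometric_pmf (1/2)" "pmf_of_set UNIV"]
    by (simp add: value_pmf_def)
  have "distr heavy_law borel uminus = distr (measure_pmf value_pmf) borel (\<lambda>x. - signed_value x)"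
    unfolding heavy_law_def by (subst distr_distr) (simp_all add: comp_def)
  also have "(\<lambda>x. - signed_value x) = (\<lambda>x. signed_value (?h x))"
    by (auto simp: signed_value_def)
  also have "distr (measure_pmf value_pmf) borel (\<lambda>x. signed_value (?h x))
      = distr (distr (measure_pmf value_pmf) (count_space UNIV) ?h) borel signed_value"
    by (subst distr_distr) (simp_all add: comp_def)
  also have "distr (measure_pmf value_pmf) (count_space UNIV) ?h = measure_pmf (map_pmf ?h value_pmf)"
    by (rule map_pmf_rep_eq[symmetric])
  finally show ?thesis unfolding h heavy_law_def .
qed

lemma geometric_value_size_square:
  "pmf (geometric_pmf (1/2)) k * (value_size k)\<^sup>2 = 1 / (real k + 1) - 1 / (real (Suc k) + 1)"
proof -
  have "pmf (geometric_pmf (1/2)) k = (1/2) ^ Suc k" by (subst pmf_geometric) auto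
  moreover have "(1/2) ^ Suc k * (2 :: real) ^ Suc k = 1" by (simp add: power_mult_distrib[symmetric])
  ultimately have "pmf (geometric_pmf (1/2)) k * (value_size k)\<^sup>2 = 1 / ((real k + 1) * (real k + 2))"
    by (simp add: value_size_square)
  also have "\<dots> = 1 / (real k + 1) - 1 / (real (Suc k) + 1)"
    by (simp add: field_simps)
  finally show ?thesis .
qed

lemma
  shows integrable_value_size_square: "integrable (measure_pmf (geometric_pmf (1/2))) (\<lambda>k. (value_size k)\<^sup>2)"
    and integral_value_size_square: "(\<integral>k. (value_size k)\<^sup>2 \<partial>measure_pmf (geometric_pmf (1/2))) = 1"
proof -
  let ?p = "pmf (geometric_pmf (1/2))"
  have lim: "(\<lambda>k. 1 / (real k + 1)) \<longlonglongrightarrow> 0" by real_asymp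
  have sums: "(\<lambda>k. ?p k * (value_size k)\<^sup>2) sums 1"
    using telescope_sums'[OF lim] unfolding geometric_value_size_square by simp
  have i: "integrable (count_space UNIV) (\<lambda>k. ?p k * (value_size k)\<^sup>2)"
    unfolding integrable_count_space_nat_iff using sums by (simp add: sums_iff)
  then show "integrable (measure_pmf (geometric_pmf (1/2))) (\<lambda>k. (value_size k)\<^sup>2)"
    unfolding measure_pmf_eq_density by (subst integrable_density) auto
  have "(\<integral>k. (value_size k)\<^sup>2 \<partial>measure_pmf (geometric_pmf (1/2))) = (\<integral>k. ?p k * (value_size k)\<^sup>2 \<partial>count_space UNIV)"
    unfolding measure_pmf_eq_density by (subst integral_density) auto
  also have "\<dots> = 1"
    using integral_count_space_nat[OF i] sums by (simp add: sums_iff)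
  finally show "(\<integral>k. (value_size k)\<^sup>2 \<partial>measure_pmf (geometric_pmf (1/2))) = 1" .
qed

lemma unit_variance_heavy_law: "unit_variance_sequence heavy_law"
proof (intro unit_variance_sequence.intro symmetric_sequence.intro unit_variance_sequence_axioms.intro)
  show "prob_space heavy_law"
    unfolding heavy_law_def by (rule measure_pmf.prob_space_distr) simp
  show "sets heavy_law = sets borel" by (simp add: heavy_law_def)
  show "distr heavy_law borel uminus = heavy_law" by (rule heavy_law_symmetric)
  have sq: "(\<lambda>x. (signed_value x)\<^sup>2) = (\<lambda>x. (value_size (fst x))\<^sup>2)"
    by (auto simp: signed_value_def)
  have "integrable (measure_pmf value_pmf) (\<lambda>x. (value_size (fst x))\<^sup>2)"
    using integrable_value_size_square unfolding map_fst_value_pmf[symmetric]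
    by (simp add: integrable_map_pmf_eq)
  then show "integrable heavy_law (\<lambda>x. x\<^sup>2)"
    unfolding heavy_law_def by (subst integrable_distr_eq) (auto simp: sq)
  have "(\<integral>x. (value_size (fst x))\<^sup>2 \<partial>measure_pmf value_pmf) = 1"
    using integral_value_size_square unfolding map_fst_value_pmf[symmetric] by simp
  then show "(\<integral>x. x\<^sup>2 \<partial>heavy_law) = 1"
    unfolding heavy_law_def by (subst integral_distr) (auto simp: sq)
qed

lemma heavy_law_tail: "(1/2) ^ Suc k \<le> measure heavy_law {x. value_size k \<le> \<bar>x\<bar>}"
proof -
  have "(1/2) ^ Suc k = measure (measure_pmf (map_pmf fst value_pmf)) {k}"
    unfolding map_fst_value_pmf by (simp add: measure_pmf_single)
  also have "\<dots> = measure (measure_pmf value_pmf) (fst -` {k})"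
    by (rule measure_map_pmf)
  also have "\<dots> \<le> measure (measure_pmf value_pmf) (signed_value -` {x. value_size k \<le> \<bar>x\<bar>})"
    by (rule measure_pmf.finite_measure_mono) (auto simp: signed_value_def)
  also have "\<dots> = measure heavy_law {x. value_size k \<le> \<bar>x\<bar>}"
    unfolding heavy_law_def by (subst measure_distr) auto
  finally show ?thesis .
qed

text \<open>The squared size is of order 2^k / k^2 and the bound on V at 2^Suc k + 1 of order 2^k /
  k^4, so the quotient grows at least like k^2. This fixes the power of the logarithm: with weights
  1 / ln l it would stay bounded.\<close>

lemma heavy_tailed_heavy_law: "heavy_tailed heavy_law log_weight value_size"
proof (intro heavy_tailed.intro heavy_tailed_axioms.intro)
  show "slow_weights heavy_law log_weight"
    by (rule slow_weights_log_weight[OF unit_variance_heavy_law])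
  have dw: "decreasing_weights heavy_law log_weight"
    by (rule decreasing_weights_log_weight[OF unit_variance_heavy_law])
  interpret decreasing_weights heavy_law log_weight by (rule dw)
  show "filterlim (\<lambda>k. (value_size k)\<^sup>2 / V (2 ^ Suc k + 1)) at_top sequentially"
  proof (rule filterlim_at_top_mono)
    show "filterlim (\<lambda>k :: nat. (2 * 2 ^ k / ((real k + 1) * (real k + 2))) / V_bound (2 * 2 ^ k + 1)) at_top sequentially"
      unfolding V_bound_def by real_asymp
    have "(2 * 2 ^ k / ((real k + 1) * (real k + 2))) / V_bound (2 * 2 ^ k + 1) \<le> (value_size k)\<^sup>2 / V (2 ^ Suc k + 1)" for k
    proof -
      have "V (2 ^ Suc k + 1) \<le> V_bound (real (2 ^ Suc k + 1))" by (rule V_log_weight_le[OF dw])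
      moreover have "real (2 ^ Suc k + 1) = 2 * 2 ^ k + 1" by simp
      moreover have "0 < V (2 ^ Suc k + 1)" by (rule V_pos) simp
      ultimately show ?thesis
        unfolding value_size_square power_Suc by (intro frac_le) (auto simp: add.commute)
    qed
    then show "eventually (\<lambda>k. (2 * 2 ^ k / ((real k + 1) * (real k + 2))) / V_bound (2 * 2 ^ k + 1) \<le> (value_size k)\<^sup>2 / V (2 ^ Suc k + 1)) sequentially"
      by (intro always_eventually allI)
  qed
qed (rule heavy_law_tail, rule value_size_nonneg)

theorem theorem2:
  "\<exists>(M :: (int \<Rightarrow> real) measure) T F m e a f.
     prob_space M \<and> automorphism M T \<and> ergodic M T \<and>
     stationary_filtration M T F \<and> regular_cond_prob M (F 0) m \<and>
     e \<in> L2_ominus M (F 0) (F (-1)) \<and> L2_norm M e = 1 \<and>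
     summable (\<lambda>i. (a i)\<^sup>2) \<and>
     f \<in> L2_on M M \<and> is_linear_process M T e a f \<and>
     (let S = partial_sum T f;
          ES = (\<lambda>n. real_cond_exp M (F 0) (S n));
          \<sigma> = (\<lambda>n. L2_norm M (S n));
          \<sigma>' = (\<lambda>n. L2_norm M (\<lambda>x. S n x - ES n x))
      in
        (adapted_regular M F f \<and> maxwell_woodroofe M T F f \<and> hannan M T F f) \<and>
        (filterlim \<sigma> at_top sequentially \<and>
         (\<lambda>n. \<sigma> n / sqrt (real n)) \<longlonglongrightarrow> 0 \<and>
         (\<lambda>n. L2_norm M (ES n) / \<sigma> n) \<longlonglongrightarrow> 0 \<and>
         (\<lambda>n. \<sigma>' n / \<sigma> n) \<longlonglongrightarrow> 1) \<and>
        clt M (\<lambda>n x. S n x / \<sigma> n) \<and>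
        (\<not> quenched_clt M m (\<lambda>n x. S n x / \<sigma> n) \<and>
         \<not> quenched_clt M m (\<lambda>n x. (S n x - ES n x) / \<sigma> n)) \<and>
        \<not> weak_invariance_principle M S \<sigma>)"
proof -
  interpret heavy_tailed heavy_law log_weight value_size by (rule heavy_tailed_heavy_law)
  have "(\<lambda>\<omega>. \<omega> 0) \<in> L2_ominus M (F 0) (F (-1))" using coordinate_L2_ominus[of 0] by simp
  moreover have "L2_norm M (\<lambda>\<omega>. \<omega> 0) = 1" by (simp add: L2_norm_def integral_square_coordinate)
  moreover have "summable (\<lambda>i. (a i)\<^sup>2)" by (rule summable_square_coeff[OF summable_a])
  ultimately show ?thesis
    unfolding Let_def
    by (intro exI[of _ M] exI[of _ left_shift] exI[of _ F] exI[of _ future_sign_law]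
        exI[of _ "\<lambda>\<omega>. \<omega> 0"] exI[of _ a] exI[of _ f] conjI prob_space_axioms automorphism_left_shift
        ergodic_left_shift stationary_filtration_F regular_cond_prob_future_sign_law f_L2
        is_linear_process_f adapted_regular_f maxwell_woodroofe_f hannan_f
        \<sigma>_at_top[unfolded \<sigma>_def[abs_def] S_def]
        \<sigma>_over_sqrt[unfolded \<sigma>_def[abs_def] S_def]
        L2_norm_ES_over_\<sigma>[unfolded \<sigma>_def[abs_def] ES_def[abs_def] S_def]
        \<sigma>'_over_\<sigma>[unfolded \<sigma>_def[abs_def] ES_def[abs_def] S_def]
        clt_S[unfolded \<sigma>_def[abs_def] S_def]
        not_quenched_clt_S[unfolded \<sigma>_def[abs_def] S_def]
        not_quenched_clt_S_minus_ES[unfolded \<sigma>_def[abs_def] ES_def[abs_def] S_def]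
        not_weak_invariance_principle[unfolded \<sigma>_def[abs_def] S_def])
qed

end
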